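(* Let $(X_n)_{n\geq -1}$ be a second-order Galton--Watson process with immigration with generic offspring variables $\xi,\eta$ and generic immigration variable $\varepsilon$, such that $X_0$, $X_{-1}$, $\xi$ and $\eta$ are regularly varying with index $\alpha\in[1,\infty)$, $\mathbb{E}(X_0),\mathbb{E}(X_{-1}),m_\xi,m_\eta\in(0,\infty)$, $\mathbb{P}(\xi>x)=O(\mathbb{P}(X_0>x))$, $\mathbb{P}(\xi>x)=O(\mathbb{P}(X_{-1}>x))$, $\mathbb{P}(\eta>x)=O(\mathbb{P}(X_0>x))$, $\mathbb{P}(\eta>x)=O(\mathbb{P}(X_{-1}>x))$ and $\mathbb{P}(\xi>x)\asymp\mathbb{P}(\eta>x)$ as $x\to\infty$, and there exists $r\in(\alpha,\infty)$ such that $\mathbb{E}(\varepsilon^r)<\infty$. Then for all $n\in\mathbb{N}$, writing $u(x) := (\mathbb{P}(\xi>x), \mathbb{P}(\eta>x))^\top$, \begin{align*} \mathbb{P}(X_n > x) &\sim \begin{bmatrix}\mathbb{E}(X_0)\\ \mathbb{E}(X_{-1})\end{bmatrix}^\top \sum_{k=0}^{n-1} m_k^\alpha \bigl(M^{n-k-1}\bigr)^\top u(x) + \begin{bmatrix} m_\varepsilon \\ 0\end{bmatrix}^\top \sum_{i=1}^{n-1}\sum_{j=0}^{n-i-1} m_j^\alpha \bigl(M^{n-i-j-1}\bigr)^\top u(x) \\ &\quad + m_n^\alpha\,\mathbb{P}(X_0>x) + m_{n-1}^\alpha m_\eta^\alpha\,\mathbb{P}(X_{-1}>x) \end{align*}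 as $x\to\infty$, yielding that $X_n$ is regularly varying with index $\alpha$.
   Context: A second-order Galton--Watson process with immigration $(X_n)_{n\geq -1}$ is defined by $X_n = \sum_{i=1}^{X_{n-1}} \xi_{n,i} + \sum_{j=1}^{X_{n-2}} \eta_{n,j} + \varepsilon_n$ for $n\in\mathbb{N}=\{1,2,\dots\}$, where $X_{-1}, X_0$ (initial values) and all $\xi_{n,i},\eta_{n,j},\varepsilon_n$ ($n,i,j\in\mathbb{N}$) are independent non-negative integer-valued random variables, the $\xi_{n,i}$ are identically distributed with generic copy $\xi$, the $\eta_{n,j}$ identically distributed with generic copy $\eta$, and the $\varepsilon_n$ identically distributed with generic copy $\varepsilon$. Write $m_\xi=\mathbb{E}(\xi)$, $m_\eta=\mathbb{E}(\eta)$, $m_\varepsilon=\mathbb{E}(\varepsilon)$, and $M := \begin{bmatrix} m_\xi & m_\eta\\ 1 & 0\end{bmatrix}$. Set $m_0:=1$ and for $k\in\mathbb{N}$, $m_k := \frac{\lambda_+^{k+1}-\lambda_-^{k+1}}{\lambda_+-\lambda_-}$ with $\lambda_\pm := \frac{m_\xi \pm \sqrt{m_\xi^2+4m_\eta}}{2}$. A non-negative random variable $X$ is regularly varying with index $\alpha\geq 0$ if $\lim_{x\to\infty}\mathbb{P}(X>qx)/\mathbb{P}(X>x) = q^{-\alpha}$ for all $q>0$. For positive functions, $f\sim g$ means $f/g\to1$, $f=O(g)$ means $\limsup f/g<\infty$, and $f\asymp g$ means $f=O(g)$ and $g=O(f)$, as $x\to\infty$. *)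

theory Defs
  imports "HOL-Probability.Probability" "HOL-Library.Landau_Symbols"
begin

(* Index set for the family of all random variables of the model (used to
   express mutual independence). *)
datatype gw_idx = IX0 | IXm1 | IXi nat nat | IEta nat nat | IEps nat

(* gw_Y k = X_{k-1}:  gw_Y 0 = X_{-1}, gw_Y 1 = X_0, and for n >= 0
   X_{n+1} = sum_{i=1}^{X_n} xi_{n+1,i} + sum_{j=1}^{X_{n-1}} eta_{n+1,j} + eps_{n+1}. *)
fun gw_Y :: "('a \<Rightarrow> nat) \<Rightarrow> ('a \<Rightarrow> nat) \<Rightarrow> (nat \<Rightarrow> nat \<Rightarrow> 'a \<Rightarrow> nat)
    \<Rightarrow> (nat \<Rightarrow> nat \<Rightarrow> 'a \<Rightarrow> nat) \<Rightarrow> (nat \<Rightarrow> 'a \<Rightarrow> nat) \<Rightarrow> nat \<Rightarrow> 'a \<Rightarrow> nat" where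
  "gw_Y X0 Xm1 xi eta eps 0 = Xm1"
| "gw_Y X0 Xm1 xi eta eps (Suc 0) = X0"
| "gw_Y X0 Xm1 xi eta eps (Suc (Suc n)) =
     (\<lambda>\<omega>. (\<Sum>i\<in>{1..gw_Y X0 Xm1 xi eta eps (Suc n) \<omega>}. xi (Suc n) i \<omega>)
         + (\<Sum>j\<in>{1..gw_Y X0 Xm1 xi eta eps n \<omega>}. eta (Suc n) j \<omega>)
         + eps (Suc n) \<omega>)"

definition gw_X :: "('a \<Rightarrow> nat) \<Rightarrow> ('a \<Rightarrow> nat) \<Rightarrow> (nat \<Rightarrow> nat \<Rightarrow> 'a \<Rightarrow> nat)
    \<Rightarrow> (nat \<Rightarrow> nat \<Rightarrow> 'a \<Rightarrow> nat) \<Rightarrow> (nat \<Rightarrow> 'a \<Rightarrow> nat) \<Rightarrow> nat \<Rightarrow> 'a \<Rightarrow> nat" where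
  "gw_X X0 Xm1 xi eta eps n = gw_Y X0 Xm1 xi eta eps (Suc n)"

definition tail :: "'a measure \<Rightarrow> ('a \<Rightarrow> real) \<Rightarrow> real \<Rightarrow> real" where
  "tail M X x = measure M {\<omega> \<in> space M. X \<omega> > x}"

definition regularly_varying :: "'a measure \<Rightarrow> ('a \<Rightarrow> real) \<Rightarrow> real \<Rightarrow> bool" where
  "regularly_varying M X \<alpha> \<longleftrightarrow> \<alpha> \<ge> 0 \<and>
     (\<forall>q>0. ((\<lambda>x. tail M X (q * x) / tail M X x) \<longlongrightarrow> q powr (- \<alpha>)) at_top)"

fun mat_pow :: "real^'n^'n \<Rightarrow> nat \<Rightarrow> real^'n^'n" where
  "mat_pow A 0 = mat 1"
| "mat_pow A (Suc k) = A ** mat_pow A k"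

definition gw_M :: "real \<Rightarrow> real \<Rightarrow> real^2^2" where
  "gw_M mxi meta = vector [vector [mxi, meta], vector [1, 0]]"

definition lam_plus :: "real \<Rightarrow> real \<Rightarrow> real" where
  "lam_plus mxi meta = (mxi + sqrt (mxi\<^sup>2 + 4 * meta)) / 2"

definition lam_minus :: "real \<Rightarrow> real \<Rightarrow> real" where
  "lam_minus mxi meta = (mxi - sqrt (mxi\<^sup>2 + 4 * meta)) / 2"

definition gw_m :: "real \<Rightarrow> real \<Rightarrow> nat \<Rightarrow> real" where
  "gw_m mxi meta k = (if k = 0 then 1 else
     (lam_plus mxi meta ^ (k + 1) - lam_minus mxi meta ^ (k + 1))
       / (lam_plus mxi meta - lam_minus mxi meta))"

end

theory Submission
  imports Defs
begin

text \<open>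
  Write the process as \<open>Y k = X\<^bsub>k-1\<^esub>\<close>. By induction on \<open>n\<close> one determines the tail of every combination
  \<open>a * Y (n + 1) + b * Y n\<close> with \<open>a, b \<ge> 0\<close> not both zero; such a combination is a sum over the \<open>Y n\<close> and \<open>Y (n - 1)\<close>
  members of the two previous generations. The driving fact concerns a random sum \<open>A 1 + \<dots> + A N + R\<close> whose i.i.d. terms are
  independent of the (possibly dependent) pair \<open>(N, R)\<close>: its tail is asymptotically
  \<open>P (m * N + R > x) + E N * P (A 1 > x)\<close> with \<open>m = E (A 1)\<close>, since it exceeds \<open>x\<close> either because one summand is large or,
  by the law of large numbers, because \<open>m * N + R\<close> is. Allowing \<open>R\<close> to depend on \<open>N\<close> lets the \<open>xi\<close>-sum and the \<open>eta\<close>-sum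
  be replaced by multiples of their numbers of terms one after the other, which turns the coefficients \<open>(a, b)\<close> into
  \<open>(a * mxi + b, a * meta)\<close>; starting from \<open>(1, 0)\<close> the first coefficients are the numbers \<open>m\<^sub>k\<close>.
\<close>

section \<open>Regularly varying tail functions\<close>

text \<open>Consecutive generations are dependent, so the tail of the next one cannot be assembled
  from separate tails of the previous two. Knowing the tail of every nonnegative linear combination
  stands in for knowing their joint law, and this knowledge is stable under the recursion. For
  \<alpha> = 1 the offspring have no finite moment of order above one. Hence variance arguments give
  way to a weak law by truncation and a Chernoff bound for truncated summands. All errors in a
  random sum are measured against the tail \<open>H\<close> of \<open>mean * N + R\<close>: by
  nonnegativity it dominates the tails of \<open>mean * N\<close> and of \<open>R\<close> whatever
  their dependence, and the assumption that the summand tail is \<open>O(H)\<close> lets it control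
  the jumps. The O-hypotheses on the initial values start this comparison; it persists because each
  generation only adds nonnegative terms. Potter bounds and Karamata's theorem are replaced by
  one-sided doubling estimates. Immigration reaches the limit through its mean alone: a moment of
  order \<open>r > \<alpha>\<close> makes its own tail negligible.\<close>

text \<open>Stated for bare functions because sums such as \<open>lim_tail\<close> are not given as
  tails of random variables. Strict positivity everywhere keeps all quotients meaningful; for an
  actual tail it follows from the limits by monotonicity.\<close>

definition rv_tail :: "real \<Rightarrow> (real \<Rightarrow> real) \<Rightarrow> bool" where
  "rv_tail \<alpha> f \<longleftrightarrow> antimono f \<and> (\<forall>x. 0 < f x) \<and>
     (\<forall>q>0. ((\<lambda>x. f (q * x) / f x) \<longlongrightarrow> q powr (- \<alpha>)) at_top)"

lemma rv_tail_pos: "rv_tail \<alpha> f \<Longrightarrow> 0 < f x"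
  and rv_tail_antimono: "rv_tail \<alpha> f \<Longrightarrow> x \<le> y \<Longrightarrow> f y \<le> f x"
  and rv_tail_lim: "rv_tail \<alpha> f \<Longrightarrow> q > 0 \<Longrightarrow> ((\<lambda>x. f (q * x) / f x) \<longlongrightarrow> q powr (- \<alpha>)) at_top"
  by (auto simp: rv_tail_def antimono_def)

lemma rv_tail_scale_asymp:
  assumes "rv_tail \<alpha> f" "q > 0"
  shows "(\<lambda>x. f (q * x)) \<sim>[at_top] (\<lambda>x. q powr (- \<alpha>) * f x)"
proof (rule asymp_equivI')
  have "((\<lambda>x. f (q * x) / f x / q powr (-\<alpha>)) \<longlongrightarrow> q powr (- \<alpha>) / q powr (- \<alpha>)) at_top"
    using assms by (intro tendsto_divide rv_tail_lim) auto
  then show "((\<lambda>x. f (q * x) / (q powr (- \<alpha>) * f x)) \<longlongrightarrow> 1) at_top"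
    using assms(2) by (simp add: divide_divide_eq_left mult.commute)
qed

lemma rv_tail_scale_bigo:
  assumes "rv_tail \<alpha> f" "q > 0"
  shows "(\<lambda>x. f (q * x)) \<in> O[at_top](f)"
  using asymp_equiv_imp_bigo[OF rv_tail_scale_asymp[OF assms]] assms by simp

lemma filterlim_scale_at_top: "q > (0::real) \<Longrightarrow> filterlim (\<lambda>x. q * x) at_top at_top"
  by (rule filterlim_tendsto_pos_mult_at_top[OF tendsto_const]) (auto simp: filterlim_ident)

lemma rv_tail_scale:
  assumes f: "rv_tail \<alpha> f" and c: "c > 0"
  shows "rv_tail \<alpha> (\<lambda>x. f (c * x))"
  unfolding rv_tail_def
proof (intro conjI allI impI)
  show "antimono (\<lambda>x. f (c * x))"
    using c by (intro antimonoI rv_tail_antimono[OF f]) auto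
  show "0 < f (c * x)" for x by (rule rv_tail_pos[OF f])
  fix q :: real assume q: "q > 0"
  have "((\<lambda>x. f (q * (c * x)) / f (c * x)) \<longlongrightarrow> q powr (- \<alpha>)) at_top"
    by (rule filterlim_compose[OF rv_tail_lim[OF f q] filterlim_scale_at_top[OF c]])
  then show "((\<lambda>x. f (c * (q * x)) / f (c * x)) \<longlongrightarrow> q powr (- \<alpha>)) at_top"
    by (simp add: mult.left_commute)
qed

lemma rv_tail_cmult:
  assumes f: "rv_tail \<alpha> f" and c: "c > 0"
  shows "rv_tail \<alpha> (\<lambda>x. c * f x)"
  using assms unfolding rv_tail_def antimono_def by auto

text \<open>Quotients do not add, whereas differences do: the little-o form is what makes closure
  under sums immediate.\<close>

lemma rv_tail_iff_smallo:
  assumes "antimono f" "\<And>x. 0 < f x"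
  shows "rv_tail \<alpha> f \<longleftrightarrow> (\<forall>q>0. (\<lambda>x. f (q * x) - q powr (- \<alpha>) * f x) \<in> o[at_top](f))"
proof -
  have "(\<lambda>x. f (q * x) - q powr (- \<alpha>) * f x) \<in> o[at_top](f) \<longleftrightarrow>
        ((\<lambda>x. f (q * x) / f x) \<longlongrightarrow> q powr (- \<alpha>)) at_top" for q
  proof -
    have f0: "f x \<noteq> 0" for x using assms(2)[of x] by auto
    have eq: "(f (q * x) - q powr (- \<alpha>) * f x) / f x = f (q * x) / f x - q powr (- \<alpha>)" for x
      using assms(2)[of x] by (simp add: field_simps)
    have "(\<lambda>x. f (q * x) - q powr (- \<alpha>) * f x) \<in> o[at_top](f) \<longleftrightarrow>
       ((\<lambda>x. (f (q * x) - q powr (- \<alpha>) * f x) / f x) \<longlongrightarrow> 0) at_top"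
      by (rule iffI, erule smalloD_tendsto, erule smalloI_tendsto) (simp add: f0)
    also have "\<dots> \<longleftrightarrow> ((\<lambda>x. f (q * x) / f x) \<longlongrightarrow> q powr (- \<alpha>)) at_top"
      unfolding eq by (rule LIM_zero_iff)
    finally show ?thesis .
  qed
  then show ?thesis using assms unfolding rv_tail_def by blast
qed

lemma rv_tail_smallo:
  assumes "rv_tail \<alpha> f" "q > 0"
  shows "(\<lambda>x. f (q * x) - q powr (- \<alpha>) * f x) \<in> o[at_top](f)"
  using rv_tail_iff_smallo[of f \<alpha>] assms unfolding rv_tail_def by blast

lemma smallo_add_pos_right:
  fixes f g :: "real \<Rightarrow> real"
  assumes "h \<in> o[at_top](f)" "\<And>x. 0 \<le> f x" "\<And>x. 0 \<le> g x"
  shows "h \<in> o[at_top](\<lambda>x. f x + g x)"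
  using assms by (intro landau_o.small_big_trans[OF assms(1)] landau_o.big_mono) auto

text \<open>Each error is small against its own tail, hence against the sum, whether or not
  \<open>f\<close> and \<open>g\<close> have comparable size.\<close>

lemma rv_tail_add:
  assumes f: "rv_tail \<alpha> f" and g: "rv_tail \<alpha> g"
  shows "rv_tail \<alpha> (\<lambda>x. f x + g x)"
proof -
  note fp = rv_tail_pos[OF f] and gp = rv_tail_pos[OF g]
  have am: "antimono (\<lambda>x. f x + g x)"
    by (intro antimonoI add_mono rv_tail_antimono[OF f] rv_tail_antimono[OF g])
  have "(\<lambda>x. (f (q * x) + g (q * x)) - q powr (- \<alpha>) * (f x + g x)) \<in> o[at_top](\<lambda>x. f x + g x)"
    if q: "q > 0" for q
  proof -
    have "(\<lambda>x. f (q * x) - q powr (- \<alpha>) * f x) \<in> o[at_top](\<lambda>x. f x + g x)"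
      using f fp gp q by (intro smallo_add_pos_right) (auto simp: rv_tail_smallo less_imp_le)
    moreover have "(\<lambda>x. g (q * x) - q powr (- \<alpha>) * g x) \<in> o[at_top](\<lambda>x. g x + f x)"
      using g fp gp q by (intro smallo_add_pos_right) (auto simp: rv_tail_smallo less_imp_le)
    ultimately have "(\<lambda>x. (f (q * x) - q powr (- \<alpha>) * f x) + (g (q * x) - q powr (- \<alpha>) * g x)) \<in> o[at_top](\<lambda>x. f x + g x)"
      by (intro sum_in_smallo(1)) (simp_all only: add.commute)
    then show ?thesis by (simp add: algebra_simps)
  qed
  then show ?thesis
    using fp gp by (subst rv_tail_iff_smallo[OF am]) (auto intro: add_pos_pos)
qed

lemma rv_tail_asymp_equiv:
  assumes g: "rv_tail \<alpha> g" and fg: "f \<sim>[at_top] g" and am: "antimono f" and pos: "\<And>x. 0 < f x"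
  shows "rv_tail \<alpha> f"
  unfolding rv_tail_def
proof (intro conjI allI impI am pos)
  fix q :: real assume q: "q > 0"
  have "((\<lambda>x. f x / g x) \<longlongrightarrow> 1) at_top"
    using rv_tail_pos[OF g] by (intro asymp_equivD_strong[OF fg] always_eventually) (metis less_irrefl)
  then have l: "((\<lambda>x. f x / g x) \<longlongrightarrow> 1) at_top" "((\<lambda>x. f (q * x) / g (q * x)) \<longlongrightarrow> 1) at_top"
    using filterlim_compose[OF _ filterlim_scale_at_top[OF q], of "\<lambda>x. f x / g x"] by auto
  have "((\<lambda>x. (f (q * x) / g (q * x)) * (g (q * x) / g x) / (f x / g x)) \<longlongrightarrow> 1 * q powr (-\<alpha>) / 1) at_top"
    by (intro tendsto_mult tendsto_divide l rv_tail_lim[OF g q]) auto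
  moreover have "(f (q * x) / g (q * x)) * (g (q * x) / g x) / (f x / g x) = f (q * x) / f x" for x
    using rv_tail_pos[OF g, of x] rv_tail_pos[OF g, of "q*x"] by simp
  ultimately show "((\<lambda>x. f (q * x) / f x) \<longlongrightarrow> q powr (- \<alpha>)) at_top"
    by (simp only: mult_1 div_by_1)
qed

text \<open>Continuity of \<open>q powr (- \<alpha>)\<close> at \<open>q = 1\<close>: moving a level
  by a factor near one costs a factor near one. All \<open>d\<close> up to \<open>d0\<close> are
  covered so that two tails can be treated with a common \<open>d\<close>.\<close>

lemma rv_tail_near_one:
  assumes f: "rv_tail \<alpha> f" and e: "e > 0"
  shows "\<exists>d0>0. d0 < 1 \<and> (\<forall>d. 0 < d \<and> d \<le> d0 \<longrightarrow>
     eventually (\<lambda>x. f ((1 - d) * x) \<le> (1 + e) * f x) at_top \<and>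
     eventually (\<lambda>x. f ((1 + d) * x) \<ge> (1 - e) * f x) at_top)"
proof -
  have t: "((\<lambda>t. (1 + s * t) powr (-\<alpha>)) \<longlongrightarrow> 1) (at_right (0::real))" for s :: real
  proof -
    have "((\<lambda>t. (1 + s * t) powr (-\<alpha>)) \<longlongrightarrow> (1 + s * 0) powr (-\<alpha>)) (at_right (0::real))"
      by (intro tendsto_intros) auto
    then show ?thesis by simp
  qed
  have "eventually (\<lambda>t. (1 + (-1) * t) powr (-\<alpha>) < 1 + e) (at_right (0::real))"
       "eventually (\<lambda>t. (1 + 1 * t) powr (-\<alpha>) > 1 - e) (at_right (0::real))"
    using e by (intro order_tendstoD[OF t]; simp)+
  then have "eventually (\<lambda>t. (1 - t) powr (-\<alpha>) < 1 + e \<and> (1 + t) powr (-\<alpha>) > 1 - e) (at_right (0::real))"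
    by eventually_elim auto
  then obtain b where b: "b > 0" "\<And>t. 0 < t \<Longrightarrow> t < b \<Longrightarrow> (1 - t) powr (-\<alpha>) < 1 + e \<and> (1 + t) powr (-\<alpha>) > 1 - e"
    by (auto simp: eventually_at_right_field)
  define d0 where "d0 = min (b/2) (1/2)"
  have main: "eventually (\<lambda>x. f ((1 - d) * x) \<le> (1 + e) * f x) at_top \<and>
     eventually (\<lambda>x. f ((1 + d) * x) \<ge> (1 - e) * f x) at_top" if d: "0 < d" "d \<le> d0" for d
  proof -
    have d': "d < b" "d < 1" using d b by (auto simp: d0_def)
    have "eventually (\<lambda>x. f ((1 - d) * x) / f x < 1 + e) at_top"
      using d d' b by (intro order_tendstoD(2)[OF rv_tail_lim[OF f]]) auto
    then have "eventually (\<lambda>x. f ((1 - d) * x) \<le> (1 + e) * f x) at_top"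
      by eventually_elim (use rv_tail_pos[OF f] in \<open>simp add: pos_divide_less_eq\<close>)
    moreover have "eventually (\<lambda>x. f ((1 + d) * x) / f x > 1 - e) at_top"
      using d d' b by (intro order_tendstoD(1)[OF rv_tail_lim[OF f]]) auto
    then have "eventually (\<lambda>x. f ((1 + d) * x) \<ge> (1 - e) * f x) at_top"
      by eventually_elim (use rv_tail_pos[OF f] in \<open>simp add: pos_less_divide_eq\<close>)
    ultimately show ?thesis by blast
  qed
  have "d0 > 0" "d0 < 1" using b by (auto simp: d0_def)
  with main show ?thesis by blast
qed

text \<open>One dyadic step of a Potter bound. The limiting ratio \<open>2 powr (- \<alpha>)\<close>
  lies strictly above \<open>2 powr (- \<beta>)\<close>, and this gap makes the step valid for all
  large \<open>x\<close>, hence iterable.\<close>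

lemma rv_tail_doubling:
  assumes f: "rv_tail \<alpha> f" and "\<beta> > \<alpha>"
  obtains z where "z > 0" "\<And>x. x \<ge> z \<Longrightarrow> f x \<le> 2 powr \<beta> * f (2 * x)"
proof -
  have "eventually (\<lambda>x. f (2 * x) / f x > 2 powr (-\<beta>)) at_top"
    using assms by (intro order_tendstoD(1)[OF rv_tail_lim[OF f]]) auto
  then obtain z where z: "\<And>x. x \<ge> z \<Longrightarrow> f (2 * x) / f x > 2 powr (-\<beta>)"
    by (auto simp: eventually_at_top_linorder)
  show thesis
  proof (rule that[of "max z 1"])
    fix x assume "max z 1 \<le> x"
    then have "f (2 * x) / f x > 2 powr (-\<beta>)" using z by simp
    then show "f x \<le> 2 powr \<beta> * f (2 * x)"
      using rv_tail_pos[OF f, of x] by (simp add: powr_minus field_simps)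
  qed auto
qed

text \<open>Finitely many doublings lead from a point of the block between \<open>z\<close> and
  \<open>2 * z\<close> to any larger \<open>x\<close>. This turns one-step estimates into bounds for
  all large arguments.\<close>

lemma dyadic_induct [case_names pos ge base step]:
  fixes z :: real
  assumes "z > 0" "x \<ge> z"
    and base: "\<And>x. z \<le> x \<Longrightarrow> x \<le> 2 * z \<Longrightarrow> P x"
    and step: "\<And>x. z \<le> x \<Longrightarrow> P x \<Longrightarrow> P (2 * x)"
  shows "P x"
proof -
  have "\<forall>x. z \<le> x \<and> x \<le> 2 ^ Suc k * z \<longrightarrow> P x" for k
  proof (induction k)
    case 0 then show ?case using base by simp
  next
    case (Suc k)
    show ?case
    proof (intro allI impI)
      fix x assume x: "z \<le> x \<and> x \<le> 2 ^ Suc (Suc k) * z"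
      show "P x"
      proof (cases "x \<le> 2 * z")
        case False
        then have "P (x / 2)" using Suc x by auto
        then show ?thesis using step[of "x / 2"] False by auto
      qed (use base x in auto)
    qed
  qed
  moreover obtain k where "x / z < 2 ^ k" using real_arch_pow[of 2 "x / z"] by auto
  then have "x \<le> 2 ^ Suc k * z" using assms(1,2) by (auto simp: field_simps)
  ultimately show ?thesis using assms by blast
qed

text \<open>By the doubling estimate \<open>f x * x powr \<beta>\<close> does not decrease when
  \<open>x\<close> is doubled, so a lower bound on one dyadic block persists.\<close>

lemma rv_tail_lower_bound:
  assumes f: "rv_tail \<alpha> f" and "\<beta> > \<alpha>"
  obtains c z where "c > 0" "z > 0" "\<And>x. x \<ge> z \<Longrightarrow> c * x powr (-\<beta>) \<le> f x"
proof -
  obtain z where z: "z > 0" "\<And>x. x \<ge> z \<Longrightarrow> f x \<le> 2 powr \<beta> * f (2 * x)"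
    using rv_tail_doubling[OF assms] by blast
  \<comment> \<open>Between \<open>z\<close> and \<open>2 * z\<close> the value \<open>f x\<close>
    is at least \<open>f (2 * z)\<close>, and \<open>x powr \<beta>\<close> is at least its value at
    one endpoint; which one depends on the sign of \<beta>.\<close>
  define c where "c = f (2 * z) * min (z powr \<beta>) ((2 * z) powr \<beta>)"
  have "c > 0" using rv_tail_pos[OF f] z by (simp add: c_def)
  have "c \<le> f x * x powr \<beta>" if "x \<ge> z" for x
  proof (induction x rule: dyadic_induct[of z])
    case (base x)
    have "min (z powr \<beta>) ((2 * z) powr \<beta>) \<le> x powr \<beta>"
    proof (cases "\<beta> \<ge> 0")
      case True then show ?thesis using base z(1) by (intro min.coboundedI1 powr_mono2) auto
    next
      case False then show ?thesis using base z(1) by (intro min.coboundedI2 powr_mono2') auto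
    qed
    then show ?case unfolding c_def using base z(1) rv_tail_pos[OF f]
      by (intro mult_mono rv_tail_antimono[OF f]) (auto simp: less_imp_le)
  next
    case (step x)
    have "f x * x powr \<beta> \<le> 2 powr \<beta> * f (2 * x) * x powr \<beta>"
      by (intro mult_right_mono z(2) step(1)) auto
    also have "\<dots> = f (2 * x) * (2 * x) powr \<beta>"
      using z(1) step by (simp add: powr_mult)
    finally show ?case using step by simp
  qed (use z(1) that in auto)
  then have "c * x powr (-\<beta>) \<le> f x" if "x \<ge> z" for x
    using that z by (simp add: powr_minus field_simps)
  with \<open>c > 0\<close> z show thesis using that by blast
qed

lemma rv_tail_smallo_scale:
  assumes "rv_tail \<alpha> h" "f \<in> o[at_top](h)" "q > 0"
  shows "(\<lambda>x. f (q * x)) \<in> o[at_top](h)"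
  by (rule landau_o.small_big_trans[OF landau_o.small.compose[OF assms(2) filterlim_scale_at_top[OF assms(3)]]
        rv_tail_scale_bigo[OF assms(1,3)]])

lemma rv_tail_bigo_scale:
  assumes "rv_tail \<alpha> h" "f \<in> O[at_top](h)" "q > 0"
  shows "(\<lambda>x. f (q * x)) \<in> O[at_top](h)"
  by (rule landau_o.big_trans[OF landau_o.big.compose[OF assms(2) filterlim_scale_at_top[OF assms(3)]]
        rv_tail_scale_bigo[OF assms(1,3)]])

text \<open>Serves for two independent large values: one tail has the order of \<open>h\<close>, the
  other supplies a vanishing factor.\<close>

lemma bigo_mult_tendsto_0:
  fixes f g h :: "real \<Rightarrow> real"
  assumes "f \<in> O[at_top](h)" "(g \<longlongrightarrow> 0) at_top"
  shows "(\<lambda>x. f x * g x) \<in> o[at_top](h)"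
proof -
  have "g \<in> o[at_top](\<lambda>_. 1)" using assms(2) by (intro smalloI_tendsto) auto
  from landau_o.big_small_mult[OF assms(1) this] show ?thesis by simp
qed

section \<open>Tails of sums of two variables, and moment estimates\<close>

context prob_space
begin

lemma prob_disj_le:
  assumes [measurable]: "Measurable.pred M P" "Measurable.pred M Q"
  shows "prob {\<omega> \<in> space M. P \<omega> \<or> Q \<omega>} \<le> prob {\<omega> \<in> space M. P \<omega>} + prob {\<omega> \<in> space M. Q \<omega>}"
proof -
  have "{\<omega> \<in> space M. P \<omega> \<or> Q \<omega>} = {\<omega> \<in> space M. P \<omega>} \<union> {\<omega> \<in> space M. Q \<omega>}" by auto
  then show ?thesis by (simp add: measure_Un_le)
qed

lemma prob_imp_le:
  assumes [measurable]: "Measurable.pred M Q" and "\<And>\<omega>. \<omega> \<in> space M \<Longrightarrow> P \<omega> \<Longrightarrow> Q \<omega>"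
  shows "prob {\<omega> \<in> space M. P \<omega>} \<le> prob {\<omega> \<in> space M. Q \<omega>}"
  using assms(2) by (intro finite_measure_mono) auto

lemma prob_ex_le:
  assumes "finite I" "\<And>i. i \<in> I \<Longrightarrow> Measurable.pred M (P i)"
  shows "prob {\<omega> \<in> space M. \<exists>i\<in>I. P i \<omega>} \<le> (\<Sum>i\<in>I. prob {\<omega> \<in> space M. P i \<omega>})"
proof -
  have "{\<omega> \<in> space M. \<exists>i\<in>I. P i \<omega>} = (\<Union>i\<in>I. {\<omega> \<in> space M. P i \<omega>})" by auto
  then show ?thesis using assms by (simp add: finite_measure_subadditive_finite image_subset_iff pred_def)
qed

lemma tail_antimono:
  assumes [measurable]: "X \<in> borel_measurable M"
  shows "antimono (tail M X)"
  unfolding tail_def by (intro antimonoI prob_imp_le) auto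

lemma tail_nonneg: "0 \<le> tail M X x"
  by (simp add: tail_def)

lemma tail_tendsto_0:
  assumes [measurable]: "X \<in> borel_measurable M"
  shows "(tail M X \<longlongrightarrow> 0) at_top"
proof -
  interpret D: real_distribution "distr M borel X" by simp
  have "tail M X x = 1 - cdf (distr M borel X) x" for x
  proof -
    have "tail M X x = prob (space M - {\<omega> \<in> space M. X \<omega> \<le> x})"
      unfolding tail_def by (intro arg_cong[where f=prob]) auto
    also have "\<dots> = 1 - prob {\<omega> \<in> space M. X \<omega> \<le> x}" by (intro prob_compl) auto
    also have "prob {\<omega> \<in> space M. X \<omega> \<le> x} = cdf (distr M borel X) x"
      by (subst cdf_def, subst measure_distr) (auto intro!: arg_cong[where f=prob])
    finally show ?thesis .
  qed
  then have "tail M X = (\<lambda>x. 1 - cdf (distr M borel X) x)" by auto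
  moreover have "((\<lambda>x. 1 - cdf (distr M borel X) x) \<longlongrightarrow> 1 - 1) at_top"
    by (intro tendsto_diff tendsto_const D.cdf_lim_at_top_prob)
  ultimately show ?thesis by simp
qed

lemma tail_scale_tendsto_0:
  assumes "X \<in> borel_measurable M" "q > 0"
  shows "((\<lambda>x. tail M X (q * x)) \<longlongrightarrow> 0) at_top"
  by (rule filterlim_compose[OF tail_tendsto_0[OF assms(1)] filterlim_scale_at_top[OF assms(2)]])

text \<open>A union bound at the levels \<open>(1 - d) * x\<close> and \<open>d * x\<close> works
  under arbitrary dependence of \<open>X\<close> and \<open>Y\<close>. This is how immigration is
  absorbed.\<close>

lemma tail_add_light:
  assumes [measurable]: "X \<in> borel_measurable M" "Y \<in> borel_measurable M"
    and Y: "\<And>\<omega>. 0 \<le> Y \<omega>"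
    and H: "rv_tail \<alpha> (tail M X)" and l: "tail M Y \<in> o[at_top](tail M X)"
  shows "tail M (\<lambda>\<omega>. X \<omega> + Y \<omega>) \<sim>[at_top] tail M X"
proof (subst asymp_equiv_altdef, rule landau_o.smallI)
  fix c :: real assume c: "c > 0"
  then have "c / 2 > 0" by simp
  from rv_tail_near_one[OF H this] obtain d where d: "0 < d" "d < 1"
    "eventually (\<lambda>x. tail M X ((1 - d) * x) \<le> (1 + c/2) * tail M X x) at_top" by auto
  have "eventually (\<lambda>x. norm (tail M Y (d * x)) \<le> c / 2 * norm (tail M X x)) at_top"
    using landau_o.smallD[OF rv_tail_smallo_scale[OF H l d(1)] \<open>c / 2 > 0\<close>] .
  with d(3) show "eventually (\<lambda>x. norm (tail M (\<lambda>\<omega>. X \<omega> + Y \<omega>) x - tail M X x) \<le> c * norm (tail M X x)) at_top"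
  proof eventually_elim
    case (elim x)
    have "tail M (\<lambda>\<omega>. X \<omega> + Y \<omega>) x \<le> prob {\<omega> \<in> space M. X \<omega> > (1 - d) * x \<or> Y \<omega> > d * x}"
      unfolding tail_def by (intro prob_imp_le) (auto simp: algebra_simps)
    also have "\<dots> \<le> tail M X ((1 - d) * x) + tail M Y (d * x)"
      unfolding tail_def by (intro prob_disj_le) auto
    finally have u: "tail M (\<lambda>\<omega>. X \<omega> + Y \<omega>) x \<le> tail M X ((1 - d) * x) + tail M Y (d * x)" .
    have "tail M X x \<le> tail M (\<lambda>\<omega>. X \<omega> + Y \<omega>) x"
      unfolding tail_def using Y by (intro prob_imp_le) (auto intro: less_le_trans simp: add_increasing2)
    with u elim show ?case using rv_tail_pos[OF H, of x] by (auto simp: algebra_simps)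
  qed
qed

text \<open>The single-large-jump principle for two variables. Independence enters through
  \<open>ind\<close>, which makes the joint exceedance a product of tails and so negligible.\<close>

lemma tail_add_indep:
  assumes [measurable]: "X \<in> borel_measurable M" "Y \<in> borel_measurable M"
    and nn: "\<And>\<omega>. 0 \<le> X \<omega>" "\<And>\<omega>. 0 \<le> Y \<omega>"
    and f: "rv_tail \<alpha> (tail M X)" and g: "rv_tail \<alpha> (tail M Y)"
    and ind: "\<And>x. prob {\<omega> \<in> space M. X \<omega> > x \<and> Y \<omega> > x} = tail M X x * tail M Y x"
  shows "tail M (\<lambda>\<omega>. X \<omega> + Y \<omega>) \<sim>[at_top] (\<lambda>x. tail M X x + tail M Y x)"
proof (subst asymp_equiv_altdef, rule landau_o.smallI)
  fix c :: real assume c: "c > 0"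
  then have c2: "c / 2 > 0" by simp
  let ?h = "\<lambda>x. tail M X x + tail M Y x"
  have h: "rv_tail \<alpha> ?h" by (rule rv_tail_add[OF f g])
  from rv_tail_near_one[OF h c2] obtain d where d: "0 < d" "d < 1"
    "eventually (\<lambda>x. ?h ((1 - d) * x) \<le> (1 + c/2) * ?h x) at_top" by auto
  have o: "eventually (\<lambda>x. norm (tail M X (q * x) * tail M Y (q * x)) \<le> c / 2 * norm (?h x)) at_top" if q: "q > 0" for q
  proof (rule landau_o.smallD[OF smallo_add_pos_right c2])
    show "(\<lambda>x. tail M X (q * x) * tail M Y (q * x)) \<in> o[at_top](tail M X)"
      using q by (intro bigo_mult_tendsto_0 rv_tail_scale_bigo[OF f] tail_scale_tendsto_0) auto
  qed (auto simp: tail_nonneg)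
  from d(3) o[OF d(1)] o[OF zero_less_one]
  show "eventually (\<lambda>x. norm (tail M (\<lambda>\<omega>. X \<omega> + Y \<omega>) x - ?h x) \<le> c * norm (?h x)) at_top"
  proof eventually_elim
    case (elim x)
    \<comment> \<open>If neither variable exceeds \<open>(1 - d) * x\<close> while the sum exceeds
      \<open>x\<close>, both exceed \<open>d * x\<close>.\<close>
    have "tail M (\<lambda>\<omega>. X \<omega> + Y \<omega>) x \<le> prob {\<omega> \<in> space M. (X \<omega> > (1 - d) * x \<or> Y \<omega> > (1 - d) * x) \<or> X \<omega> > d * x \<and> Y \<omega> > d * x}"
      unfolding tail_def by (intro prob_imp_le) (auto simp: algebra_simps)
    also have "\<dots> \<le> prob {\<omega> \<in> space M. X \<omega> > (1 - d) * x \<or> Y \<omega> > (1 - d) * x} + prob {\<omega> \<in> space M. X \<omega> > d * x \<and> Y \<omega> > d * x}"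
      by (intro prob_disj_le) auto
    also have "\<dots> \<le> ?h ((1 - d) * x) + tail M X (d * x) * tail M Y (d * x)"
      unfolding ind by (intro add_right_mono) (auto simp: tail_def intro!: prob_disj_le)
    finally have u: "tail M (\<lambda>\<omega>. X \<omega> + Y \<omega>) x \<le> ?h ((1 - d) * x) + tail M X (d * x) * tail M Y (d * x)" .
    have "?h x - tail M X x * tail M Y x = prob ({\<omega> \<in> space M. X \<omega> > x} \<union> {\<omega> \<in> space M. Y \<omega> > x})"
    proof (subst measure_Un3)
      have "{\<omega> \<in> space M. x < X \<omega>} \<inter> {\<omega> \<in> space M. x < Y \<omega>} = {\<omega> \<in> space M. X \<omega> > x \<and> Y \<omega> > x}" by auto
      then show "?h x - tail M X x * tail M Y x = prob {\<omega> \<in> space M. x < X \<omega>} + prob {\<omega> \<in> space M. x < Y \<omega>} -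
        prob ({\<omega> \<in> space M. x < X \<omega>} \<inter> {\<omega> \<in> space M. x < Y \<omega>})"
        using ind[of x] by (simp add: tail_def)
    qed (auto simp: fmeasurable_eq_sets)
    also have "\<dots> \<le> tail M (\<lambda>\<omega>. X \<omega> + Y \<omega>) x"
      unfolding tail_def using nn by (intro finite_measure_mono) (auto intro: less_le_trans simp: add_increasing2 add_increasing)
    finally have lo: "?h x - tail M X x * tail M Y x \<le> tail M (\<lambda>\<omega>. X \<omega> + Y \<omega>) x" .
    have hn: "norm (?h x) = ?h x" by (simp add: tail_nonneg)
    have 1: "tail M X x * tail M Y x \<le> c / 2 * ?h x" "tail M X (d * x) * tail M Y (d * x) \<le> c / 2 * ?h x"
      using elim(2,3) unfolding hn by (auto simp: tail_nonneg abs_mult)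
    have 2: "c * ?h x = c / 2 * ?h x + c / 2 * ?h x" "(1 + c/2) * ?h x = ?h x + c / 2 * ?h x"
       by (auto simp: algebra_simps)
    have 3: "c / 2 * ?h x \<ge> 0" using c by (simp add: tail_nonneg)
    show ?case unfolding hn using u lo elim(1) 1 3 unfolding 2 real_norm_def by linarith
  qed
qed

text \<open>Markov's inequality gives order \<open>x powr (-r)\<close>, while \<open>h\<close>
  decays no faster than \<open>x powr (-\<beta>)\<close>; any \<beta> strictly between \<alpha> and
  \<open>r\<close> separates the two.\<close>

lemma tail_moment_smallo:
  assumes [measurable]: "Y \<in> borel_measurable M" and Y: "\<And>\<omega>. 0 \<le> Y \<omega>"
    and int: "integrable M (\<lambda>\<omega>. Y \<omega> powr r)" and H: "rv_tail \<alpha> h" and r: "r > \<alpha>" "r > 0"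
  shows "tail M Y \<in> o[at_top](h)"
proof -
  define \<beta> where "\<beta> = (\<alpha> + r) / 2"
  have \<beta>: "\<beta> > \<alpha>" "\<beta> < r" using r by (auto simp: \<beta>_def)
  obtain c z where c: "c > 0" "z > 0" "\<And>x. x \<ge> z \<Longrightarrow> c * x powr (-\<beta>) \<le> h x"
    using rv_tail_lower_bound[OF H \<beta>(1)] by blast
  let ?E = "expectation (\<lambda>\<omega>. Y \<omega> powr r)"
  have up: "tail M Y x \<le> ?E * x powr (-r)" if "x > 0" for x
  proof -
    have "tail M Y x \<le> prob {\<omega> \<in> space M. Y \<omega> powr r \<ge> x powr r}"
      unfolding tail_def using that r by (intro prob_imp_le) (auto intro!: powr_mono2)
    also have "\<dots> \<le> ?E / x powr r"
      using that by (intro integral_Markov_inequality_measure[where A="space M"] int) auto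
    finally show ?thesis by (simp add: powr_minus divide_inverse)
  qed
  have "tail M Y \<in> O[at_top](\<lambda>x. x powr (-r))"
  proof (rule bigoI[where c="?E"])
    show "eventually (\<lambda>x. norm (tail M Y x) \<le> ?E * norm (x powr (-r))) at_top"
      using eventually_gt_at_top[of 0] by eventually_elim (use up in \<open>simp add: tail_nonneg\<close>)
  qed
  also have "(\<lambda>x. x powr (-r)) \<in> o[at_top](\<lambda>x. x powr (-\<beta>))"
    using \<beta> by (subst powr_smallo_iff) (auto simp: filterlim_ident)
  also have "(\<lambda>x. x powr (-\<beta>)) \<in> O[at_top](h)"
  proof (rule bigoI[where c="1 / c"])
    show "eventually (\<lambda>x. norm (x powr (-\<beta>)) \<le> 1 / c * norm (h x)) at_top"
      using eventually_ge_at_top[of z]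
    proof eventually_elim
      case (elim x)
      have "c * x powr (-\<beta>) \<le> h x" using c(3) elim by blast
      then show ?case using c(1) rv_tail_pos[OF H, of x] by (simp add: field_simps)
    qed
  qed
  finally show ?thesis .
qed

text \<open>A one-sided Karamata estimate: for \<open>p > \<alpha>\<close> the upper end of the
  range governs the truncated moment. \<open>G\<close> merely dominates the tail of
  \<open>Z\<close>, because the number of summands will be known only to be dominated by a regularly
  varying tail.\<close>

lemma truncated_moment_bound:
  assumes [measurable]: "Z \<in> borel_measurable M" and Z: "\<And>\<omega>. 0 \<le> Z \<omega>"
    and G: "rv_tail \<alpha> G" and le: "\<And>z. tail M Z z \<le> G z" and p: "p > \<alpha>" "p > 0"
  obtains C z where "C > 0" "z > 0"
    "\<And>x. x \<ge> z \<Longrightarrow> expectation (\<lambda>\<omega>. Z \<omega> powr p * indicator {..x} (Z \<omega>)) \<le> C * (x powr p * G x)"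
proof -
  define J where "J x = expectation (\<lambda>\<omega>. Z \<omega> powr p * indicator {..x} (Z \<omega>))" for x
  define \<beta> where "\<beta> = (\<alpha> + p) / 2"
  have \<beta>: "\<beta> > \<alpha>" "\<beta> < p" using p by (auto simp: \<beta>_def)
  obtain z where z: "z > 0" "\<And>x. x \<ge> z \<Longrightarrow> G x \<le> 2 powr \<beta> * G (2 * x)"
    using rv_tail_doubling[OF G \<beta>(1)] by blast
  have bd: "Z \<omega> powr p * indicator {..x} (Z \<omega>) \<le> \<bar>x\<bar> powr p" for x \<omega>
    using Z[of \<omega>] p by (auto simp: indicator_def intro!: powr_mono2)
  have int: "integrable M (\<lambda>\<omega>. Z \<omega> powr p * indicator {..x} (Z \<omega>))" for x
    using bd by (intro integrable_const_bound[where B="\<bar>x\<bar> powr p"]) auto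
  have \<beta>p: "2 powr \<beta> < 2 powr p" using \<beta> by simp
  \<comment> \<open>The first entry settles the initial block, where the moment is at most
    \<open>x powr p\<close>. The second is the smallest \<open>C\<close> with
    \<open>(C + 2 powr p) * 2 powr \<beta> \<le> C * 2 powr p\<close>, which lets the bound survive
    a doubling.\<close>
  define C where "C = max (1 / G (2 * z)) (2 powr \<beta> * 2 powr p / (2 powr p - 2 powr \<beta>))"
  have C0: "C > 0" unfolding C_def using rv_tail_pos[OF G] by (simp add: less_max_iff_disj)
  have "C \<ge> 2 powr \<beta> * 2 powr p / (2 powr p - 2 powr \<beta>)" by (simp add: C_def)
  then have C1: "(C + 2 powr p) * 2 powr \<beta> \<le> C * 2 powr p" using \<beta>p by (simp add: field_simps)
  have "J x \<le> C * (x powr p * G x)" if "x \<ge> z" for x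
  proof (induction x rule: dyadic_induct[of z])
    case (base x)
    have "J x \<le> x powr p"
      unfolding J_def using bd[of _ x] base z(1) int by (intro integral_le_const) auto
    also have "\<dots> = 1 / G (2 * z) * (x powr p * G (2 * z))" using rv_tail_pos[OF G, of "2 * z"] by simp
    also have "\<dots> \<le> C * (x powr p * G x)" using C0
      by (intro mult_mono rv_tail_antimono[OF G] base) (auto simp: C_def less_imp_le[OF rv_tail_pos[OF G]])
    finally show ?case .
  next
    case (step x)
    have x: "x > 0" using step z(1) by simp
    have ii: "integrable M (indicator {\<omega> \<in> space M. Z \<omega> > x} :: 'a \<Rightarrow> real)"
      by (intro integrable_real_indicator) (auto simp: less_top[symmetric])
    \<comment> \<open>Doubling the cutoff adds values above \<open>x\<close>, each contributing at
      most \<open>(2 * x) powr p\<close>.\<close>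
    have "J (2 * x) \<le> expectation (\<lambda>\<omega>. Z \<omega> powr p * indicator {..x} (Z \<omega>) + (2 * x) powr p * indicator {\<omega> \<in> space M. Z \<omega> > x} \<omega>)"
      unfolding J_def
    proof (rule integral_mono)
      show "integrable M (\<lambda>\<omega>. Z \<omega> powr p * indicator {..x} (Z \<omega>) + (2 * x) powr p * indicator {\<omega> \<in> space M. Z \<omega> > x} \<omega>)"
        by (intro int ii Bochner_Integration.integrable_add integrable_mult_right)
    qed (use x Z p int in \<open>auto simp: indicator_def intro!: powr_mono2\<close>)
    also have "\<dots> = J x + (2 * x) powr p * tail M Z x"
      unfolding J_def tail_def using int ii by (subst Bochner_Integration.integral_add) auto
    also have "\<dots> \<le> C * (x powr p * G x) + (2 * x) powr p * G x"
      by (intro add_mono step mult_left_mono le) auto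
    also have "\<dots> = (C + 2 powr p) * x powr p * G x" using x by (simp add: powr_mult algebra_simps)
    also have "\<dots> \<le> (C + 2 powr p) * x powr p * (2 powr \<beta> * G (2 * x))"
      using C0 by (intro mult_left_mono z step(1)) auto
    also have "\<dots> = ((C + 2 powr p) * 2 powr \<beta>) * (x powr p * G (2 * x))" by (simp add: algebra_simps)
    also have "\<dots> \<le> (C * 2 powr p) * (x powr p * G (2 * x))"
      by (intro mult_right_mono C1) (auto simp: less_imp_le[OF rv_tail_pos[OF G]])
    also have "\<dots> = C * ((2 * x) powr p * G (2 * x))" using x by (simp add: powr_mult)
    finally show ?case .
  qed (use z(1) that in auto)
  with C0 z(1) show thesis by (intro that[of C z]) (auto simp: J_def)
qed

end

section \<open>Sums of independent identically distributed variables\<close>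

locale iid_nonneg = prob_space M for M :: "'a measure" +
  fixes A :: "nat \<Rightarrow> 'a \<Rightarrow> real"
  assumes indep_A: "indep_vars (\<lambda>_. borel) A {1..}"
    and ident: "\<And>i. i \<ge> 1 \<Longrightarrow> distr M borel (A i) = distr M borel (A 1)"
    and A_nonneg: "\<And>i \<omega>. 0 \<le> A i \<omega>"
    and int_A: "integrable M (A 1)"
begin

definition mean :: real where "mean = expectation (A 1)"

lemma A_measurable [measurable]: "i \<ge> 1 \<Longrightarrow> A i \<in> borel_measurable M"
  using indep_A by (auto simp: indep_vars_def2)

lemma A_1_measurable [measurable]: "A 1 \<in> borel_measurable M" "A (Suc 0) \<in> borel_measurable M"
  using A_measurable[of 1] by auto

lemma expectation_A:
  assumes "i \<ge> 1" "g \<in> borel_measurable borel"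
  shows "expectation (\<lambda>\<omega>. g (A i \<omega>)) = expectation (\<lambda>\<omega>. g (A 1 \<omega>) :: real)"
proof -
  have "expectation (\<lambda>\<omega>. g (A i \<omega>)) = (\<integral>x. g x \<partial>distr M borel (A i))"
    using assms by (subst integral_distr) auto
  also have "\<dots> = expectation (\<lambda>\<omega>. g (A 1 \<omega>))"
    unfolding ident[OF assms(1)] using assms by (subst integral_distr) auto
  finally show ?thesis .
qed

lemma tail_A:
  assumes "i \<ge> 1" shows "tail M (A i) = tail M (A 1)"
proof
  fix x
  have "tail M (A j) x = measure (distr M borel (A j)) {x<..}" if "j \<ge> 1" for j
    using that by (subst measure_distr) (auto simp: tail_def intro!: arg_cong[where f=prob])
  from this[of i] this[of 1] assms ident[of i] show "tail M (A i) x = tail M (A 1) x" by simp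
qed

lemma integrable_A:
  assumes "i \<ge> 1" shows "integrable M (A i)"
proof -
  have "integrable (distr M borel (A i)) (\<lambda>x. x)"
    unfolding ident[OF assms] by (subst integrable_distr_eq) (use int_A in auto)
  then show ?thesis using assms by (subst (asm) integrable_distr_eq) auto
qed

lemma prob_pair:
  assumes "i \<ge> 1" "j \<ge> 1" "i \<noteq> j"
  shows "prob {\<omega> \<in> space M. A i \<omega> > s \<and> A j \<omega> > t} = tail M (A 1) s * tail M (A 1) t"
proof -
  have "prob (\<Inter>k\<in>{i,j}. A k -` (if k = i then {s<..} else {t<..}) \<inter> space M) =
        (\<Prod>k\<in>{i,j}. prob (A k -` (if k = i then {s<..} else {t<..}) \<inter> space M))"
    by (rule indep_varsD[OF indep_A]) (use assms in auto)
  also have "\<dots> = tail M (A i) s * tail M (A j) t"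
    using assms by (auto simp: tail_def intro!: arg_cong2[where f="(*)"] arg_cong[where f=prob])
  also have "(\<Inter>k\<in>{i,j}. A k -` (if k = i then {s<..} else {t<..}) \<inter> space M) =
      {\<omega> \<in> space M. A i \<omega> > s \<and> A j \<omega> > t}" using assms by auto
  finally show ?thesis using tail_A[OF assms(1)] tail_A[OF assms(2)] by simp
qed

lemma sum_measurable [measurable]: "(\<lambda>\<omega>. \<Sum>i\<in>{1..k}. A i \<omega>) \<in> borel_measurable M"
  by (intro borel_measurable_sum) auto

lemma truncated_sum_tail_bound:
  assumes k: "k \<ge> 1" and m: "mean > 0" and t: "2 * k * mean \<le> t" and y: "y > 0"
  shows "prob {\<omega> \<in> space M. (\<Sum>i\<in>{1..k}. A i \<omega>) > t \<and> (\<forall>i\<in>{1..k}. A i \<omega> \<le> y)}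
           \<le> (2 * k * mean / t) powr (t / (2 * y))"
proof -
  \<comment> \<open>Chernoff bound for the summands cut off at \<open>y\<close>; \<open>s\<close> is chosen so that half of the exponent \<open>s * t\<close> survives.\<close>
  define v where "v = t / (2 * k * mean)"
  have km: "2 * k * mean > 0" using k m by simp
  have t0: "t > 0" using km t by linarith
  have v: "v \<ge> 1" using t km by (simp add: v_def)
  define s where "s = ln v / y"
  have s: "s \<ge> 0" using v y by (simp add: s_def)
  have esy: "exp (s * y) = v" using v y by (simp add: s_def)
  let ?f = "\<lambda>i \<omega>. exp (s * min (A i \<omega>) y)"
  have fle: "?f i \<omega> \<le> v" for i \<omega>
  proof -
    have "s * min (A i \<omega>) y \<le> s * y" using s by (intro mult_left_mono) auto
    then show ?thesis using esy by (metis exp_le_cancel_iff)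
  qed
  have int: "integrable M (?f i)" if "i \<ge> 1" for i
    using that fle[of i] by (intro integrable_const_bound[where B=v]) auto
  have ind: "indep_vars (\<lambda>_. borel) ?f {1..k}"
    by (rule indep_vars_compose2[OF indep_vars_subset[OF indep_A], where Y="\<lambda>_ a. exp (s * min a y)"]) auto
  have one: "expectation (?f 1) \<le> exp (s * mean * v)"
  proof -
    have "expectation (?f 1) \<le> expectation (\<lambda>\<omega>. 1 + s * v * A 1 \<omega>)"
    proof (rule integral_mono)
      show "?f 1 \<omega> \<le> 1 + s * v * A 1 \<omega>" for \<omega>
      proof -
        let ?u = "s * min (A 1 \<omega>) y"
        have u: "?u \<ge> 0" using s y A_nonneg[of 1 \<omega>] by simp
        \<comment> \<open>The exponential must be bounded linearly in \<open>A 1\<close>, so that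
          only the mean enters: this inequality rearranges to
          \<open>exp u \<le> 1 + u * exp u\<close>, whose last factor is at most
          \<open>v\<close>.\<close>
        have "1 - ?u \<le> exp (- ?u)" using exp_ge_add_one_self[of "- ?u"] by simp
        then have "(1 - ?u) * exp ?u \<le> exp (- ?u) * exp ?u" by (intro mult_right_mono) auto
        then have "exp ?u \<le> 1 + ?u * exp ?u" by (simp add: algebra_simps flip: exp_add)
        also have "?u * exp ?u \<le> (s * A 1 \<omega>) * v"
          using s fle[of 1 \<omega>] A_nonneg[of 1 \<omega>] u by (intro mult_mono mult_left_mono) auto
        finally show ?thesis by (simp add: algebra_simps)
      qed
    qed (use int int_A in auto)
    also have "\<dots> = 1 + s * v * mean" using int_A by (simp add: mean_def prob_space)
    also have "\<dots> \<le> exp (s * v * mean)" by (rule exp_ge_add_one_self)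
    finally show ?thesis by (simp add: mult_ac)
  qed
  have prod: "expectation (\<lambda>\<omega>. \<Prod>i\<in>{1..k}. ?f i \<omega>) = expectation (?f 1) ^ k"
  proof -
    have "expectation (\<lambda>\<omega>. \<Prod>i\<in>{1..k}. ?f i \<omega>) = (\<Prod>i\<in>{1..k}. expectation (?f i))"
      using int by (intro indep_vars_lebesgue_integral ind) auto
    also have "\<dots> = (\<Prod>i\<in>{1..k}. expectation (?f 1))"
      by (intro prod.cong refl expectation_A[where g="\<lambda>a. exp (s * min a y)"]) auto
    finally show ?thesis by simp
  qed
  have "prob {\<omega> \<in> space M. (\<Sum>i\<in>{1..k}. A i \<omega>) > t \<and> (\<forall>i\<in>{1..k}. A i \<omega> \<le> y)}
     \<le> prob {\<omega> \<in> space M. (\<Prod>i\<in>{1..k}. ?f i \<omega>) \<ge> exp (s * t)}"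
  proof (rule prob_imp_le)
    fix \<omega> assume h: "(\<Sum>i\<in>{1..k}. A i \<omega>) > t \<and> (\<forall>i\<in>{1..k}. A i \<omega> \<le> y)"
    have "(\<Prod>i\<in>{1..k}. ?f i \<omega>) = exp (s * (\<Sum>i\<in>{1..k}. A i \<omega>))"
      using h by (simp add: exp_sum sum_distrib_left)
    then show "(\<Prod>i\<in>{1..k}. ?f i \<omega>) \<ge> exp (s * t)" using h s by (simp add: mult_left_mono)
  qed measurable
  also have "\<dots> \<le> expectation (\<lambda>\<omega>. \<Prod>i\<in>{1..k}. ?f i \<omega>) / exp (s * t)"
    using int by (intro integral_Markov_inequality_measure[where A="space M"] indep_vars_integrable ind) (auto intro!: prod_nonneg)
  also have "\<dots> \<le> exp (s * mean * v) ^ k / exp (s * t)"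
    unfolding prod by (intro divide_right_mono power_mono one) auto
  also have "\<dots> = exp (s * (k * mean * v) - s * t)"
    by (simp add: exp_diff mult_ac flip: exp_of_nat_mult)
  also have "k * mean * v = t / 2" using k m by (simp add: v_def)
  also have "exp (s * (t / 2) - s * t) = exp (- s * y * (t / (2 * y)))" using y by (simp add: field_simps)
  also have "\<dots> = (1 / v) powr (t / (2 * y))"
    using v y by (simp add: powr_def s_def ln_div)
  also have "1 / v = 2 * real k * mean / t" by (simp add: v_def)
  finally show ?thesis .
qed

text \<open>With only a first moment at hand, the summands are cut at a level \<open>y\<close>.
  Hoeffding's inequality controls the bounded part and Markov's the sum of the excesses, whose mean
  is small by dominated convergence.\<close>

lemma weak_law:
  fixes e :: real
  assumes e: "e > 0"
  shows "(\<lambda>k. prob {\<omega> \<in> space M. \<bar>(\<Sum>i\<in>{1..k}. A i \<omega>) - k * mean\<bar> > e * k}) \<longlonglongrightarrow> 0"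
proof (rule tendstoI)
  fix c :: real assume c: "c > 0"
  have "(\<lambda>j. expectation (\<lambda>\<omega>. min (A 1 \<omega>) (real j))) \<longlonglongrightarrow> expectation (A 1)"
  proof (rule integral_dominated_convergence[where w="A 1"])
    show "AE \<omega> in M. (\<lambda>j. min (A 1 \<omega>) (real j)) \<longlonglongrightarrow> A 1 \<omega>"
    proof (intro AE_I2 tendsto_eventually)
      fix \<omega>
      have "eventually (\<lambda>j. real j \<ge> A 1 \<omega>) sequentially"
        using filterlim_real_sequentially unfolding filterlim_at_top by blast
      then show "eventually (\<lambda>j. min (A 1 \<omega>) (real j) = A 1 \<omega>) sequentially"
        by eventually_elim auto
    qed
  qed (use int_A A_nonneg in auto)
  \<comment> \<open>The bound \<open>e / 3\<close> limits the shift of the centring from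
    \<open>mean\<close> to the truncated mean; \<open>c * e / 9\<close> lets Markov's inequality at
    level \<open>e * k / 3\<close> cost at most \<open>c / 3\<close>.\<close>
  then have "eventually (\<lambda>j. mean - expectation (\<lambda>\<omega>. min (A 1 \<omega>) (real j)) < min (e / 3) (c * e / 9)) sequentially"
    using c e unfolding mean_def by (intro order_tendstoD(2)[where y="expectation (A 1) - expectation (A 1)"] tendsto_diff tendsto_const) auto
  with eventually_ge_at_top[of 1]
  have "eventually (\<lambda>j. j \<ge> 1 \<and> mean - expectation (\<lambda>\<omega>. min (A 1 \<omega>) (real j)) < min (e / 3) (c * e / 9)) sequentially"
    by eventually_elim auto
  then obtain j :: nat where j: "j \<ge> 1" "mean - expectation (\<lambda>\<omega>. min (A 1 \<omega>) (real j)) < min (e / 3) (c * e / 9)"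
    by (auto simp: eventually_sequentially)
  define y where "y = real j"
  define \<mu> where "\<mu> = expectation (\<lambda>\<omega>. min (A 1 \<omega>) y)"
  have y: "y > 0" using j by (simp add: y_def)
  have d: "mean - \<mu> < e / 3" "mean - \<mu> < c * e / 9" using j by (auto simp: \<mu>_def y_def)
  have intm: "integrable M (\<lambda>\<omega>. min (A i \<omega>) y)" if "i \<ge> 1" for i
    using that integrable_A[OF that] by (intro integrable_min) auto
  have intU: "integrable M (\<lambda>\<omega>. \<Sum>i\<in>{1..k}. A i \<omega> - min (A i \<omega>) y)" for k :: nat
    using intm integrable_A by (intro Bochner_Integration.integrable_sum Bochner_Integration.integrable_diff) auto
  have bound: "prob {\<omega> \<in> space M. \<bar>(\<Sum>i\<in>{1..k}. A i \<omega>) - k * mean\<bar> > e * k}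
     \<le> 2 * exp (- (2 * e\<^sup>2 / (9 * y\<^sup>2)) * k) + c / 3" if k: "k \<ge> 1" for k
  proof -
    interpret H: Hoeffding_ineq_iid M "{1..k}" "\<lambda>i \<omega>. min (A i \<omega>) y" "\<lambda>\<omega>. min (A 1 \<omega>) y" 0 y \<mu>
    proof unfold_locales
      show "indep_vars (\<lambda>_. borel) (\<lambda>i \<omega>. min (A i \<omega>) y) {1..k}"
        by (rule indep_vars_compose2[OF indep_vars_subset[OF indep_A], where Y="\<lambda>_ a. min a y"]) auto
      show "distr M borel (\<lambda>\<omega>. min (A i \<omega>) y) = distr M borel (\<lambda>\<omega>. min (A 1 \<omega>) y)" if "i \<in> {1..k}" for i
      proof -
        have "distr M borel (\<lambda>\<omega>. min (A i \<omega>) y) = distr (distr M borel (A i)) borel (\<lambda>a. min a y)" if "i \<ge> 1" for i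
          using that by (subst distr_distr) (auto simp: comp_def)
        from this[of i] this[of 1] that ident[of i] show ?thesis by simp
      qed
      show "AE \<omega> in M. min (A 1 \<omega>) y \<in> {0..y}" using A_nonneg y by auto
    qed (auto simp: \<mu>_def)
    have hoef: "prob {\<omega>\<in>space M. \<bar>(\<Sum>i\<in>{1..k}. min (A i \<omega>) y) - k * \<mu>\<bar> \<ge> e * k / 3}
       \<le> 2 * exp (- (2 * e\<^sup>2 / (9 * y\<^sup>2)) * k)"
    proof -
      have "prob {\<omega>\<in>space M. \<bar>(\<Sum>i\<in>{1..k}. min (A i \<omega>) y) - k * \<mu>\<bar> \<ge> e * k / 3}
         \<le> 2 * exp (-2 * (e * k / 3)\<^sup>2 / (k * (y - 0)\<^sup>2))"
        using H.Hoeffding_ineq_abs_ge[of "e * k / 3"] e y k by simp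
      also have "-2 * (e * k / 3)\<^sup>2 / (k * (y - 0)\<^sup>2) = - (2 * e\<^sup>2 / (9 * y\<^sup>2)) * k"
        using k y by (simp add: field_simps power2_eq_square)
      finally show ?thesis .
    qed
    have EU: "expectation (\<lambda>\<omega>. \<Sum>i\<in>{1..k}. A i \<omega> - min (A i \<omega>) y) = k * (mean - \<mu>)"
    proof -
      have "expectation (\<lambda>\<omega>. \<Sum>i\<in>{1..k}. A i \<omega> - min (A i \<omega>) y) = (\<Sum>i\<in>{1..k}. expectation (\<lambda>\<omega>. A i \<omega> - min (A i \<omega>) y))"
        using intm integrable_A by (intro Bochner_Integration.integral_sum Bochner_Integration.integrable_diff) auto
      also have "\<dots> = (\<Sum>i\<in>{1..k}. expectation (\<lambda>\<omega>. A 1 \<omega> - min (A 1 \<omega>) y))"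
        by (intro sum.cong refl expectation_A[where g="\<lambda>a. a - min a y"]) auto
      also have "expectation (\<lambda>\<omega>. A 1 \<omega> - min (A 1 \<omega>) y) = mean - \<mu>"
        unfolding mean_def \<mu>_def using intm[of 1] int_A by (intro Bochner_Integration.integral_diff) auto
      finally show ?thesis by simp
    qed
    have mk: "prob {\<omega>\<in>space M. (\<Sum>i\<in>{1..k}. A i \<omega> - min (A i \<omega>) y) \<ge> e * k / 3} \<le> c / 3"
    proof -
      have "prob {\<omega>\<in>space M. (\<Sum>i\<in>{1..k}. A i \<omega> - min (A i \<omega>) y) \<ge> e * k / 3} \<le> k * (mean - \<mu>) / (e * k / 3)"
        unfolding EU[symmetric] using e k
        by (intro integral_Markov_inequality_measure[where A="space M"] intU) (auto intro!: sum_nonneg)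
      also have "\<dots> = 3 * (mean - \<mu>) / e" using k e by (simp add: field_simps)
      also have "\<dots> \<le> c / 3" using d(2) e by (simp add: field_simps)
      finally show ?thesis .
    qed
    \<comment> \<open>The excess is nonnegative and the centring moves by at most
      \<open>k * e / 3\<close>, so a deviation above \<open>e * k\<close> leaves at least
      \<open>e * k / 3\<close> to one of the two parts.\<close>
    have "prob {\<omega> \<in> space M. \<bar>(\<Sum>i\<in>{1..k}. A i \<omega>) - k * mean\<bar> > e * k} \<le>
       prob {\<omega> \<in> space M. \<bar>(\<Sum>i\<in>{1..k}. min (A i \<omega>) y) - k * \<mu>\<bar> \<ge> e * k / 3 \<or> (\<Sum>i\<in>{1..k}. A i \<omega> - min (A i \<omega>) y) \<ge> e * k / 3}"
    proof (rule prob_imp_le)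
      fix \<omega> assume h: "\<bar>(\<Sum>i\<in>{1..k}. A i \<omega>) - k * mean\<bar> > e * k"
      let ?T = "(\<Sum>i\<in>{1..k}. min (A i \<omega>) y)" and ?U = "(\<Sum>i\<in>{1..k}. A i \<omega> - min (A i \<omega>) y)"
      have "(\<Sum>i\<in>{1..k}. A i \<omega>) = ?T + ?U" by (simp add: sum_subtractf)
      moreover have "?U \<ge> 0" by (intro sum_nonneg) auto
      moreover have "k * (mean - \<mu>) \<le> k * (e / 3)" using d by (intro mult_left_mono) auto
      moreover have "\<mu> \<le> mean" unfolding mean_def \<mu>_def using intm[of 1] int_A by (intro integral_mono) auto
      then have "k * (mean - \<mu>) \<ge> 0" by simp
      ultimately show "\<bar>?T - k * \<mu>\<bar> \<ge> e * k / 3 \<or> ?U \<ge> e * k / 3" using h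
        by (auto simp: algebra_simps abs_if split: if_splits)
    qed measurable
    also have "\<dots> \<le> 2 * exp (- (2 * e\<^sup>2 / (9 * y\<^sup>2)) * k) + c / 3"
      by (rule order_trans[OF prob_disj_le add_mono[OF hoef mk]]) measurable
    finally show ?thesis .
  qed
  have "filterlim (\<lambda>k. - (2 * e\<^sup>2 / (9 * y\<^sup>2)) * real k) at_bot sequentially"
    using e y by (intro filterlim_tendsto_neg_mult_at_bot[OF tendsto_const] filterlim_real_sequentially) auto
  then have "(\<lambda>k. exp (- (2 * e\<^sup>2 / (9 * y\<^sup>2)) * real k)) \<longlonglongrightarrow> 0"
    by (rule filterlim_compose[OF exp_at_bot])
  then have "eventually (\<lambda>k. exp (- (2 * e\<^sup>2 / (9 * y\<^sup>2)) * real k) < c / 6) sequentially"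
    using c by (intro order_tendstoD) auto
  with eventually_ge_at_top[of 1]
  show "eventually (\<lambda>k. dist (prob {\<omega> \<in> space M. \<bar>(\<Sum>i\<in>{1..k}. A i \<omega>) - k * mean\<bar> > e * k}) 0 < c) sequentially"
    by eventually_elim (use bound c in \<open>fastforce simp: dist_real_def\<close>)
qed

end

section \<open>Random sums\<close>

text \<open>
  Independence is stated through events, because \<open>indep_var\<close> requires both variables to take values in the same type.
\<close>

locale random_sum = iid_nonneg M A for M :: "'a measure" and A +
  fixes N :: "'a \<Rightarrow> nat" and R :: "'a \<Rightarrow> real"
  assumes N_measurable [measurable]: "N \<in> measurable M (count_space UNIV)"
    and R_measurable [measurable]: "R \<in> borel_measurable M"
    and prob_indep: "\<And>P Q. Measurable.pred (count_space UNIV \<Otimes>\<^sub>M borel) P \<Longrightarrow> Measurable.pred (Pi\<^sub>M {1..} (\<lambda>_. borel)) Q \<Longrightarrow>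
       prob {\<omega> \<in> space M. P (N \<omega>, R \<omega>) \<and> Q (\<lambda>i\<in>{1..}. A i \<omega>)} =
       prob {\<omega> \<in> space M. P (N \<omega>, R \<omega>)} * prob {\<omega> \<in> space M. Q (\<lambda>i\<in>{1..}. A i \<omega>)}"
    and R_nonneg: "\<And>\<omega>. 0 \<le> R \<omega>"
    and int_N: "integrable M (\<lambda>\<omega>. real (N \<omega>))"
begin

lemma vec_A_measurable [measurable]: "(\<lambda>\<omega>. \<lambda>i\<in>{1..}. A i \<omega>) \<in> measurable M (Pi\<^sub>M {1..} (\<lambda>_. borel))"
  by (intro measurable_restrict) auto

lemma random_sum_measurable [measurable]: "(\<lambda>\<omega>. \<Sum>i\<in>{1..N \<omega>}. A i \<omega>) \<in> borel_measurable M"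
  by (rule measurable_compose_countable[OF sum_measurable N_measurable])

lemma random_ex_measurable [measurable]: "Measurable.pred M (\<lambda>\<omega>. \<exists>i\<in>{1..N \<omega>}. A i \<omega> > t)"
proof (rule measurable_compose_countable[OF _ N_measurable])
  fix k :: nat show "Measurable.pred M (\<lambda>\<omega>. \<exists>i\<in>{1..k}. A i \<omega> > t)"
    by (intro pred_intros_finite) auto
qed

lemma random_all_measurable [measurable]: "Measurable.pred M (\<lambda>\<omega>. \<forall>i\<in>{1..N \<omega>}. A i \<omega> \<le> t)"
proof (rule measurable_compose_countable[OF _ N_measurable])
  fix k :: nat show "Measurable.pred M (\<lambda>\<omega>. \<forall>i\<in>{1..k}. A i \<omega> \<le> t)"
    by (intro pred_intros_finite) auto
qed

lemma coord_measurable: "i \<ge> 1 \<Longrightarrow> (\<lambda>a. a i) \<in> borel_measurable (Pi\<^sub>M {1..} (\<lambda>_. borel))" for i :: nat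
  by (intro measurable_component_singleton) auto

lemma prob_indep_A:
  assumes "Measurable.pred (count_space UNIV \<Otimes>\<^sub>M borel) P" and i: "i \<ge> 1"
  shows "prob {\<omega> \<in> space M. P (N \<omega>, R \<omega>) \<and> A i \<omega> > t} = prob {\<omega> \<in> space M. P (N \<omega>, R \<omega>)} * tail M (A 1) t"
proof -
  have [measurable]: "(\<lambda>a. a i) \<in> borel_measurable (Pi\<^sub>M {1..} (\<lambda>_. borel))" by (rule coord_measurable[OF i])
  have "prob {\<omega> \<in> space M. P (N \<omega>, R \<omega>) \<and> (\<lambda>i\<in>{1..}. A i \<omega>) i > t} = prob {\<omega> \<in> space M. P (N \<omega>, R \<omega>)} *
      prob {\<omega> \<in> space M. (\<lambda>i\<in>{1..}. A i \<omega>) i > t}"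
    by (rule prob_indep[OF assms(1), of "\<lambda>a. a i > t"]) measurable
  also have "prob {\<omega> \<in> space M. (\<lambda>i\<in>{1..}. A i \<omega>) i > t} = tail M (A i) t"
    using i by (simp add: tail_def)
  finally show ?thesis using i tail_A[OF i] by simp
qed

text \<open>Stands in for conditioning on \<open>N\<close>: the event is cut along the values of
  \<open>N\<close>, each piece factors by independence, and the bounds \<open>g k\<close> add up to
  an expectation. \<open>D\<close> selects the range of \<open>N\<close> under study.\<close>

lemma random_index_bound:
  assumes Q: "\<And>k. Measurable.pred (Pi\<^sub>M {1..} (\<lambda>_. borel)) (Q k)"
    and g: "\<And>k. k \<in> D \<Longrightarrow> prob {\<omega> \<in> space M. Q k (\<lambda>i\<in>{1..}. A i \<omega>)} \<le> g k"
    and g0: "\<And>k. 0 \<le> g k" and int: "integrable M (\<lambda>\<omega>. g (N \<omega>) * indicator D (N \<omega>))"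
  shows "prob {\<omega> \<in> space M. N \<omega> \<in> D \<and> Q (N \<omega>) (\<lambda>i\<in>{1..}. A i \<omega>)} \<le> expectation (\<lambda>\<omega>. g (N \<omega>) * indicator D (N \<omega>))"
proof -
  define B where "B k = {\<omega> \<in> space M. N \<omega> = k \<and> k \<in> D \<and> Q k (\<lambda>i\<in>{1..}. A i \<omega>)}" for k
  define c where "c k = g k * indicator D k" for k
  have [measurable]: "Measurable.pred M (\<lambda>\<omega>. Q k (\<lambda>i\<in>{1..}. A i \<omega>))" for k
    by (rule measurable_compose[OF vec_A_measurable Q])
  have B [measurable]: "B k \<in> sets M" for k unfolding B_def by measurable
  have Bk: "emeasure M (B k) \<le> (\<integral>\<^sup>+\<omega>. ennreal (c k) * indicator {\<omega> \<in> space M. N \<omega> = k} \<omega> \<partial>M)" for k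
  proof (cases "k \<in> D")
    case True
    have "prob (B k) = prob {\<omega> \<in> space M. N \<omega> = k} * prob {\<omega> \<in> space M. Q k (\<lambda>i\<in>{1..}. A i \<omega>)}"
      using prob_indep[of "\<lambda>z. fst z = k", OF _ Q[of k]] True by (simp add: B_def)
    also have "\<dots> \<le> prob {\<omega> \<in> space M. N \<omega> = k} * c k"
      using g[OF True] True by (intro mult_left_mono) (auto simp: c_def)
    finally have "emeasure M (B k) \<le> ennreal (prob {\<omega> \<in> space M. N \<omega> = k} * c k)"
      by (simp add: emeasure_eq_measure ennreal_leI)
    also have "\<dots> = ennreal (c k) * emeasure M {\<omega> \<in> space M. N \<omega> = k}"
      using g0 by (simp add: emeasure_eq_measure c_def ennreal_mult' mult.commute)
    also have "\<dots> = (\<integral>\<^sup>+\<omega>. ennreal (c k) * indicator {\<omega> \<in> space M. N \<omega> = k} \<omega> \<partial>M)"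
      by (subst nn_integral_cmult_indicator) auto
    finally show ?thesis .
  qed (simp add: B_def)
  have "{\<omega> \<in> space M. N \<omega> \<in> D \<and> Q (N \<omega>) (\<lambda>i\<in>{1..}. A i \<omega>)} = (\<Union>k. B k)"
    by (auto simp: B_def)
  then have "ennreal (prob {\<omega> \<in> space M. N \<omega> \<in> D \<and> Q (N \<omega>) (\<lambda>i\<in>{1..}. A i \<omega>)}) = emeasure M (\<Union>k. B k)"
    by (simp add: emeasure_eq_measure)
  also have "\<dots> = (\<Sum>k. emeasure M (B k))"
  proof (rule suminf_emeasure[symmetric])
    show "disjoint_family B" by (auto simp: disjoint_family_on_def B_def)
  qed (use B in auto)
  also have "\<dots> \<le> (\<Sum>k. \<integral>\<^sup>+\<omega>. ennreal (c k) * indicator {\<omega> \<in> space M. N \<omega> = k} \<omega> \<partial>M)"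
    by (intro suminf_le Bk) auto
  also have "\<dots> = (\<integral>\<^sup>+\<omega>. (\<Sum>k. ennreal (c k) * indicator {\<omega> \<in> space M. N \<omega> = k} \<omega>) \<partial>M)"
    by (intro nn_integral_suminf[symmetric]) measurable
  also have "\<dots> = (\<integral>\<^sup>+\<omega>. ennreal (c (N \<omega>)) \<partial>M)"
  proof (rule nn_integral_cong)
    fix \<omega> assume "\<omega> \<in> space M"
    then have "(\<Sum>k. ennreal (c k) * indicator {\<omega> \<in> space M. N \<omega> = k} \<omega>) =
        (\<Sum>k\<in>{N \<omega>}. ennreal (c k) * indicator {\<omega> \<in> space M. N \<omega> = k} \<omega>)"
      by (intro suminf_finite) auto
    with \<open>\<omega> \<in> space M\<close> show "(\<Sum>k. ennreal (c k) * indicator {\<omega> \<in> space M. N \<omega> = k} \<omega>) = ennreal (c (N \<omega>))" by simp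
  qed
  also have "\<dots> = ennreal (expectation (\<lambda>\<omega>. c (N \<omega>)))"
    using int g0 by (intro nn_integral_eq_integral) (auto simp: c_def)
  finally show ?thesis using g0 by (simp add: c_def)
qed

lemma integrable_N_indicator: "integrable M (\<lambda>\<omega>. real (N \<omega>) * indicator D (N \<omega>))"
  by (rule Bochner_Integration.integrable_bound[OF int_N]) (auto simp: indicator_def)

text \<open>For \<open>N = k\<close> the union bound costs \<open>k\<close> times the tail of one
  summand. Restricting to \<open>D\<close> allows the contribution of large \<open>N\<close> to be
  isolated.\<close>

lemma prob_jump_le:
  "prob {\<omega> \<in> space M. N \<omega> \<in> D \<and> (\<exists>i\<in>{1..N \<omega>}. A i \<omega> > t)} \<le>
     expectation (\<lambda>\<omega>. real (N \<omega>) * indicator D (N \<omega>)) * tail M (A 1) t"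
proof -
  let ?F = "tail M (A 1) t"
  have "prob {\<omega> \<in> space M. N \<omega> \<in> D \<and> (\<exists>i\<in>{1..N \<omega>}. (\<lambda>i\<in>{1..}. A i \<omega>) i > t)} \<le>
     expectation (\<lambda>\<omega>. (real (N \<omega>) * ?F) * indicator D (N \<omega>))"
  proof (rule random_index_bound[where Q="\<lambda>k a. \<exists>i\<in>{1..k}. a i > t"])
    fix k :: nat
    show "Measurable.pred (Pi\<^sub>M {1..} (\<lambda>_. borel)) (\<lambda>a. \<exists>i\<in>{1..k}. a i > t)"
      by (intro pred_intros_finite borel_measurable_pred_less measurable_const coord_measurable) auto
    have "prob {\<omega> \<in> space M. \<exists>i\<in>{1..k}. (\<lambda>i\<in>{1..}. A i \<omega>) i > t} = prob {\<omega> \<in> space M. \<exists>i\<in>{1..k}. A i \<omega> > t}"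
      by (intro arg_cong[where f=prob]) auto
    also have "\<dots> \<le> (\<Sum>i\<in>{1..k}. tail M (A i) t)"
      unfolding tail_def by (intro prob_ex_le) auto
    also have "\<dots> = (\<Sum>i\<in>{1..k}. ?F)" by (intro sum.cong refl) (metis tail_A atLeastAtMost_iff)
    finally show "prob {\<omega> \<in> space M. \<exists>i\<in>{1..k}. (\<lambda>i\<in>{1..}. A i \<omega>) i > t} \<le> real k * ?F" by simp
    show "0 \<le> real k * ?F" by (simp add: tail_nonneg)
    show "integrable M (\<lambda>\<omega>. (real (N \<omega>) * ?F) * indicator D (N \<omega>))"
      using integrable_mult_right[OF integrable_N_indicator, of ?F D] by (simp add: mult_ac)
  qed
  also have "(\<lambda>\<omega>. (real (N \<omega>) * ?F) * indicator D (N \<omega>)) = (\<lambda>\<omega>. ?F * (real (N \<omega>) * indicator D (N \<omega>)))"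
    by (auto simp: mult_ac)
  also have "expectation \<dots> = ?F * expectation (\<lambda>\<omega>. real (N \<omega>) * indicator D (N \<omega>))"
    by simp
  also have "prob {\<omega> \<in> space M. N \<omega> \<in> D \<and> (\<exists>i\<in>{1..N \<omega>}. (\<lambda>i\<in>{1..}. A i \<omega>) i > t)} =
     prob {\<omega> \<in> space M. N \<omega> \<in> D \<and> (\<exists>i\<in>{1..N \<omega>}. A i \<omega> > t)}"
    by (intro arg_cong[where f=prob]) auto
  finally show ?thesis by (simp add: mult.commute)
qed

lemma expectation_N_above:
  assumes "c > 0"
  shows "\<exists>K. expectation (\<lambda>\<omega>. real (N \<omega>) * indicator {K<..} (N \<omega>)) < c"
proof -
  have "(\<lambda>K. expectation (\<lambda>\<omega>. real (N \<omega>) * indicator {K<..} (N \<omega>))) \<longlonglongrightarrow> expectation (\<lambda>\<omega>. 0)"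
  proof (rule integral_dominated_convergence[OF _ _ int_N])
    show "AE \<omega> in M. (\<lambda>K. real (N \<omega>) * indicator {K<..} (N \<omega>)) \<longlonglongrightarrow> 0"
    proof (intro AE_I2 tendsto_eventually)
      fix \<omega> show "eventually (\<lambda>K. real (N \<omega>) * indicator {K<..} (N \<omega>) = 0) sequentially"
        using eventually_ge_at_top[of "N \<omega>"] by eventually_elim auto
    qed
  qed (auto simp: indicator_def)
  then have "eventually (\<lambda>K. expectation (\<lambda>\<omega>. real (N \<omega>) * indicator {K<..} (N \<omega>)) < c) sequentially"
    using assms by (intro order_tendstoD) auto
  then show ?thesis by (auto simp: eventually_sequentially)
qed

end

text \<open>Regular variation is asked of the combination \<open>mean * N + R\<close>, not of
  \<open>N\<close> and \<open>R\<close> separately: these may depend on each other, and in the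
  recursion it is the tail of the combination that is known.\<close>

locale random_sum_rv = random_sum M A N R for M :: "'a measure" and A N R +
  fixes \<alpha> :: real
  assumes \<alpha>_nonneg: "0 \<le> \<alpha>" and mean_pos: "mean > 0"
    and rv_A: "rv_tail \<alpha> (tail M (A 1))"
    and rv_lin: "rv_tail \<alpha> (tail M (\<lambda>\<omega>. mean * real (N \<omega>) + R \<omega>))"
    and A_bigo: "tail M (A 1) \<in> O[at_top](tail M (\<lambda>\<omega>. mean * real (N \<omega>) + R \<omega>))"
begin

abbreviation "H \<equiv> tail M (\<lambda>\<omega>. mean * real (N \<omega>) + R \<omega>)"
abbreviation "F \<equiv> tail M (A 1)"

lemma H_pos: "0 < H x" by (rule rv_tail_pos[OF rv_lin])

lemma bigo_H_bound:
  assumes "f \<in> O[at_top](H)" "\<And>x. 0 \<le> f x"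
  obtains B where "B > 0" "eventually (\<lambda>x. f x \<le> B * H x) at_top"
proof -
  obtain B where B: "B > 0" "eventually (\<lambda>x. norm (f x) \<le> B * norm (H x)) at_top"
    using landau_o.bigE[OF assms(1)] by blast
  from B(2) have "eventually (\<lambda>x. f x \<le> B * H x) at_top"
    by eventually_elim (use assms(2) less_imp_le[OF H_pos] in auto)
  with B(1) show thesis by (rule that)
qed

lemma smallo_H_bound:
  assumes "f \<in> o[at_top](H)" "c > 0"
  shows "eventually (\<lambda>x. f x \<le> c * H x) at_top"
  using landau_o.smallD[OF assms] by eventually_elim (use less_imp_le[OF H_pos] in auto)

text \<open>Because \<open>R\<close> is nonnegative, \<open>H\<close> controls \<open>N\<close> even
  though the tail of \<open>N\<close> itself need not vary regularly.\<close>

lemma tail_N_le: "prob {\<omega> \<in> space M. real (N \<omega>) > z} \<le> H (mean * z)"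
  unfolding tail_def
proof (rule prob_imp_le)
  fix \<omega> assume "real (N \<omega>) > z"
  then have "mean * real (N \<omega>) > mean * z" using mean_pos by simp
  then show "mean * real (N \<omega>) + R \<omega> > mean * z" using R_nonneg[of \<omega>] by linarith
qed measurable

lemma tail_R_le: "prob {\<omega> \<in> space M. R \<omega> > z} \<le> H z"
  unfolding tail_def
  by (rule prob_imp_le) (use mean_pos in \<open>auto intro: less_le_trans simp: add_increasing\<close>)

text \<open>The jump contributes the order \<open>H\<close>, and integrability of \<open>N\<close>
  contributes the smallness: \<open>K\<close> is taken so that the part of the mean of
  \<open>N\<close> above \<open>K\<close> is below \<open>c / B\<close>.\<close>

lemma large_jump_large_N:
  assumes c: "c > 0" and \<epsilon>: "\<epsilon> > 0"
  shows "\<exists>K. eventually (\<lambda>x. prob {\<omega> \<in> space M. N \<omega> \<in> {K<..} \<and> (\<exists>i\<in>{1..N \<omega>}. A i \<omega> > \<epsilon> * x)} \<le> c * H x) at_top"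
proof -
  obtain B where B: "B > 0" "eventually (\<lambda>x. F (\<epsilon> * x) \<le> B * H x) at_top"
    using bigo_H_bound[OF rv_tail_bigo_scale[OF rv_lin A_bigo \<epsilon>]] by (auto simp: tail_nonneg)
  obtain K where K: "expectation (\<lambda>\<omega>. real (N \<omega>) * indicator {K<..} (N \<omega>)) < c / B"
    using expectation_N_above[of "c / B"] B c by auto
  have "eventually (\<lambda>x. prob {\<omega> \<in> space M. N \<omega> \<in> {K<..} \<and> (\<exists>i\<in>{1..N \<omega>}. A i \<omega> > \<epsilon> * x)} \<le> c * H x) at_top"
    using B(2)
  proof eventually_elim
    case (elim x)
    have "prob {\<omega> \<in> space M. N \<omega> \<in> {K<..} \<and> (\<exists>i\<in>{1..N \<omega>}. A i \<omega> > \<epsilon> * x)}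
       \<le> expectation (\<lambda>\<omega>. real (N \<omega>) * indicator {K<..} (N \<omega>)) * F (\<epsilon> * x)"
      by (rule prob_jump_le)
    also have "\<dots> \<le> (c / B) * (B * H x)"
      using K elim c B by (intro mult_mono) (auto simp: tail_nonneg)
    finally show ?case using B by simp
  qed
  then show ?thesis by blast
qed

text \<open>One summand is large but leaves at least \<open>d * x\<close> to be covered. With at
  most \<open>K\<close> summands this forces \<open>R\<close> or a second summand to be of order
  \<open>x\<close> as well, and two independent large values are negligible.\<close>

lemma large_jump_small_N:
  assumes d: "0 < d" and \<epsilon>: "\<epsilon> > 0"
  shows "(\<lambda>x. prob {\<omega> \<in> space M. N \<omega> \<le> K \<and> (\<exists>i\<in>{1..N \<omega>}. \<epsilon> * x < A i \<omega>) \<and> (\<forall>i\<in>{1..N \<omega>}. A i \<omega> \<le> (1 - d) * x) \<and>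
       (\<Sum>i\<in>{1..N \<omega>}. A i \<omega>) + R \<omega> > x}) \<in> o[at_top](H)" (is "?f \<in> _")
proof -
  \<comment> \<open>Summands of size at most \<open>q * x\<close>, no more than \<open>K + 1\<close>
    of them, total at most \<open>d / 2 * x\<close>; the other half of the gap is left to
    \<open>R\<close>. The \<open>+ 1\<close> keeps the denominator positive for
    \<open>K = 0\<close>.\<close>
  define q where "q = d / (2 * (real K + 1))"
  have q: "q > 0" using d by (simp add: q_def)
  define g where "g x = K * (F (\<epsilon> * x) * H (d / 2 * x)) + (real K * real K) * (F (\<epsilon> * x) * F (q * x))" for x
  have F: "(\<lambda>x. F (\<epsilon> * x)) \<in> O[at_top](H)" by (rule rv_tail_bigo_scale[OF rv_lin A_bigo \<epsilon>])
  have "g \<in> o[at_top](H)" unfolding g_def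
  proof (intro sum_in_smallo(1))
    have "(\<lambda>x. F (\<epsilon> * x) * H (d / 2 * x)) \<in> o[at_top](H)"
      using d by (intro bigo_mult_tendsto_0 F tail_scale_tendsto_0) auto
    then show "(\<lambda>x. K * (F (\<epsilon> * x) * H (d / 2 * x))) \<in> o[at_top](H)" by simp
    have "(\<lambda>x. F (\<epsilon> * x) * F (q * x)) \<in> o[at_top](H)"
      using q by (intro bigo_mult_tendsto_0 F tail_scale_tendsto_0) auto
    then show "(\<lambda>x. real K * real K * (F (\<epsilon> * x) * F (q * x))) \<in> o[at_top](H)" by simp
  qed
  moreover have "?f \<in> O[at_top](g)"
  proof (rule landau_o.big_mono, rule eventually_mono[OF eventually_gt_at_top[of 0]])
    fix x :: real assume x: "x > 0"
    let ?I = "{1..K}" and ?J = "{p \<in> {1..K} \<times> {1..K}. fst p \<noteq> snd p}"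
    have Rm: "Measurable.pred M (\<lambda>\<omega>. R \<omega> > d / 2 * x \<and> A i \<omega> > \<epsilon> * x)" if "i \<in> ?I" for i
    proof -
      have [measurable]: "A i \<in> borel_measurable M" using that by (intro A_measurable) auto
      show ?thesis by measurable
    qed
    have Pm: "Measurable.pred M (\<lambda>\<omega>. A (fst p) \<omega> > \<epsilon> * x \<and> A (snd p) \<omega> > q * x)" if "p \<in> ?J" for p
    proof -
      have [measurable]: "A (fst p) \<in> borel_measurable M" "A (snd p) \<in> borel_measurable M"
        using that by (auto intro!: A_measurable)
      show ?thesis by measurable
    qed
    have m1: "Measurable.pred M (\<lambda>\<omega>. \<exists>i\<in>?I. R \<omega> > d / 2 * x \<and> A i \<omega> > \<epsilon> * x)"
      by (intro pred_intros_finite Rm) auto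
    have m2: "Measurable.pred M (\<lambda>\<omega>. \<exists>p\<in>?J. A (fst p) \<omega> > \<epsilon> * x \<and> A (snd p) \<omega> > q * x)"
      by (intro pred_intros_finite(4) Pm) auto
    have "?f x \<le> prob {\<omega> \<in> space M. (\<exists>i\<in>?I. R \<omega> > d / 2 * x \<and> A i \<omega> > \<epsilon> * x) \<or>
        (\<exists>p\<in>?J. A (fst p) \<omega> > \<epsilon> * x \<and> A (snd p) \<omega> > q * x)}"
    proof (rule prob_imp_le)
      fix \<omega> assume h: "N \<omega> \<le> K \<and> (\<exists>i\<in>{1..N \<omega>}. \<epsilon> * x < A i \<omega>) \<and> (\<forall>i\<in>{1..N \<omega>}. A i \<omega> \<le> (1 - d) * x) \<and>
         (\<Sum>i\<in>{1..N \<omega>}. A i \<omega>) + R \<omega> > x"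
      then obtain i where i: "i \<in> {1..N \<omega>}" "A i \<omega> > \<epsilon> * x" by blast
      have iK: "i \<in> ?I" using i h by auto
      show "(\<exists>i\<in>?I. R \<omega> > d / 2 * x \<and> A i \<omega> > \<epsilon> * x) \<or> (\<exists>p\<in>?J. A (fst p) \<omega> > \<epsilon> * x \<and> A (snd p) \<omega> > q * x)"
      proof (rule ccontr)
        assume n: "\<not> ?thesis"
        then have R: "R \<omega> \<le> d / 2 * x" using i iK by force
        have le: "A j \<omega> \<le> q * x" if "j \<in> {1..N \<omega>} - {i}" for j
        proof -
          have "(i, j) \<in> ?J" using that i h by auto
          then show ?thesis using n i by force
        qed
        have "(\<Sum>j\<in>{1..N \<omega>}. A j \<omega>) = A i \<omega> + (\<Sum>j\<in>{1..N \<omega>} - {i}. A j \<omega>)"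
          using i by (simp add: sum.remove)
        also have "(\<Sum>j\<in>{1..N \<omega>} - {i}. A j \<omega>) \<le> of_nat (card ({1..N \<omega>} - {i})) * (q * x)"
          by (intro sum_bounded_above le)
        also have "\<dots> \<le> (real K + 1) * (q * x)"
          using h x q i by (intro mult_right_mono) auto
        also have "\<dots> = d / 2 * x" by (simp add: q_def field_simps)
        finally have "(\<Sum>j\<in>{1..N \<omega>}. A j \<omega>) + R \<omega> \<le> (1 - d) * x + d / 2 * x + d / 2 * x"
          using R h i by force
        then show False using h by (simp add: algebra_simps)
      qed
    qed (use m1 m2 in measurable)
    also have "\<dots> \<le> prob {\<omega> \<in> space M. \<exists>i\<in>?I. R \<omega> > d / 2 * x \<and> A i \<omega> > \<epsilon> * x} +
        prob {\<omega> \<in> space M. \<exists>p\<in>?J. A (fst p) \<omega> > \<epsilon> * x \<and> A (snd p) \<omega> > q * x}"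
      by (rule prob_disj_le[OF m1 m2])
    also have "\<dots> \<le> (\<Sum>i\<in>?I. prob {\<omega> \<in> space M. R \<omega> > d / 2 * x \<and> A i \<omega> > \<epsilon> * x}) +
        (\<Sum>p\<in>?J. prob {\<omega> \<in> space M. A (fst p) \<omega> > \<epsilon> * x \<and> A (snd p) \<omega> > q * x})"
      by (intro add_mono prob_ex_le Rm Pm) auto
    also have "\<dots> \<le> (\<Sum>i\<in>?I. F (\<epsilon> * x) * H (d / 2 * x)) + (\<Sum>p\<in>?J. F (\<epsilon> * x) * F (q * x))"
    proof (intro add_mono sum_mono)
      fix i assume "i \<in> ?I"
      then have "prob {\<omega> \<in> space M. R \<omega> > d / 2 * x \<and> A i \<omega> > \<epsilon> * x} = prob {\<omega> \<in> space M. R \<omega> > d / 2 * x} * F (\<epsilon> * x)"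
        using prob_indep_A[of "\<lambda>z. snd z > d / 2 * x" i "\<epsilon> * x"] by simp
      also have "\<dots> \<le> H (d / 2 * x) * F (\<epsilon> * x)"
        by (intro mult_right_mono tail_R_le tail_nonneg)
      finally show "prob {\<omega> \<in> space M. R \<omega> > d / 2 * x \<and> A i \<omega> > \<epsilon> * x} \<le> F (\<epsilon> * x) * H (d / 2 * x)"
        by (simp add: mult.commute)
    next
      fix p assume "p \<in> ?J"
      then show "prob {\<omega> \<in> space M. A (fst p) \<omega> > \<epsilon> * x \<and> A (snd p) \<omega> > q * x} \<le> F (\<epsilon> * x) * F (q * x)"
        using prob_pair[of "fst p" "snd p" "\<epsilon> * x" "q * x"] by auto
    qed
    also have "\<dots> \<le> g x"
    proof -
      have "card ?J \<le> card ({1..K} \<times> {1..K})" by (intro card_mono) auto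
      then have "real (card ?J) \<le> real K * real K" by (simp flip: of_nat_mult)
      then have "real (card ?J) * (F (\<epsilon> * x) * F (q * x)) \<le> (real K * real K) * (F (\<epsilon> * x) * F (q * x))"
        by (intro mult_right_mono) (auto simp: tail_nonneg)
      then show ?thesis by (simp add: g_def)
    qed
    finally show "norm (?f x) \<le> norm (g x)" by simp
  qed
  ultimately show ?thesis using landau_o.big_small_trans by blast
qed

lemma restrict_from_one: "(\<forall>i\<in>{1..k}. (\<lambda>i\<in>{1..}. a i) i \<le> y) \<longleftrightarrow> (\<forall>i\<in>{1..k}. a i \<le> (y::real))"
  "(\<Sum>i\<in>{1..k}. (\<lambda>i\<in>{1..}. a i) i) = (\<Sum>i\<in>{1..k}. a i :: real)" for k :: nat
  by auto

text \<open>
  The truncation level \<open>\<epsilon> * x\<close> makes the Chernoff bound a power \<open>(N / x) ^ p\<close> with \<open>p > \<alpha>\<close>, so that its expectation over \<open>N \<le> e * x\<close>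
  is of order \<open>e powr (p - \<alpha>) * H x\<close>. This needs no moment of \<open>A\<close> beyond the first and covers \<open>\<alpha> = 1\<close>.
\<close>

lemma no_jump_small_N:
  assumes d: "d > 0" and \<epsilon>: "\<epsilon> > 0" and p: "d / (2 * \<epsilon>) > \<alpha>" and c: "c > 0"
  shows "\<exists>e>0. eventually (\<lambda>x. prob {\<omega> \<in> space M. real (N \<omega>) \<le> e * x \<and>
     (\<Sum>i\<in>{1..N \<omega>}. A i \<omega>) > d * x \<and> (\<forall>i\<in>{1..N \<omega>}. A i \<omega> \<le> \<epsilon> * x)} \<le> c * H x) at_top"
proof -
  define p where "p = d / (2 * \<epsilon>)"
  have p: "p > \<alpha>" "p > 0" using p d \<epsilon> by (auto simp: p_def)
  have G: "rv_tail \<alpha> (\<lambda>z. H (mean * z))" by (rule rv_tail_scale[OF rv_lin mean_pos])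
  obtain C z where C: "C > 0" "z > 0" "\<And>x. x \<ge> z \<Longrightarrow>
      expectation (\<lambda>\<omega>. real (N \<omega>) powr p * indicator {..x} (real (N \<omega>))) \<le> C * (x powr p * H (mean * x))"
  proof (rule truncated_moment_bound[OF _ _ G _ p, of "\<lambda>\<omega>. real (N \<omega>)"])
    show "tail M (\<lambda>\<omega>. real (N \<omega>)) z \<le> H (mean * z)" for z
      using tail_N_le by (simp add: tail_def)
  qed auto
  \<comment> \<open>\<open>b s * H x\<close> is what the estimate below yields when
    \<open>mean * N\<close> is at most \<open>s * x\<close>. The Chernoff factor and the truncated
    moment give \<open>s powr p\<close>, and \<open>H (s * x)\<close> costs
    \<open>2 * s powr (- \<alpha>)\<close>; since \<open>p > \<alpha>\<close>, \<open>b s\<close>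
    vanishes as \<open>s\<close> tends to 0.\<close>
  define b where "b s = C * 2 * (2 / d) powr p * s powr (p - \<alpha>)" for s
  have "(b \<longlongrightarrow> C * 2 * (2 / d) powr p * 0 powr (p - \<alpha>)) (at_right 0)"
    unfolding b_def using p by (intro tendsto_mult tendsto_const tendsto_powr' tendsto_ident_at) (auto simp: eventually_at_filter)
  then have "eventually (\<lambda>s. b s < c) (at_right 0)"
    using c p by (intro order_tendstoD) auto
  \<comment> \<open>This guarantees \<open>2 * k * mean \<le> d * x\<close>, the range in which the
    Chernoff bound applies.\<close>
  moreover have "eventually (\<lambda>s. s < d / 2) (at_right 0)"
    using d eventually_at_right_real[of 0 "d / 2"] by (auto elim: eventually_mono)
  ultimately have "eventually (\<lambda>s. b s < c \<and> s < d / 2) (at_right 0)" by eventually_elim auto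
  then obtain s0 where s0: "s0 > 0" "\<And>s. 0 < s \<Longrightarrow> s < s0 \<Longrightarrow> b s < c \<and> s < d / 2"
    by (auto simp: eventually_at_right_field)
  define s where "s = s0 / 2"
  have s: "s > 0" "b s < c" "s < d / 2" using s0(1) s0(2)[of s] by (auto simp: s_def)
  define e where "e = s / mean"
  have e: "e > 0" "mean * e = s" using s mean_pos by (auto simp: e_def)
  have "eventually (\<lambda>x. H (s * x) / H x < 2 * s powr (-\<alpha>)) at_top"
    using s by (intro order_tendstoD(2)[OF rv_tail_lim[OF rv_lin]]) auto
  moreover have "eventually (\<lambda>x. x \<ge> z / e) at_top" by (rule eventually_ge_at_top)
  ultimately have "eventually (\<lambda>x. prob {\<omega> \<in> space M. real (N \<omega>) \<le> e * x \<and>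
     (\<Sum>i\<in>{1..N \<omega>}. A i \<omega>) > d * x \<and> (\<forall>i\<in>{1..N \<omega>}. A i \<omega> \<le> \<epsilon> * x)} \<le> c * H x) at_top"
    using eventually_gt_at_top[of 0]
  proof eventually_elim
    case (elim x)
    then have x: "x > 0" "e * x \<ge> z" using e by (auto simp: field_simps)
    have Hs: "H (s * x) \<le> 2 * s powr (-\<alpha>) * H x" using elim(1) H_pos[of x] by (simp add: field_simps)
    let ?g = "\<lambda>k. (2 * real k * mean / (d * x)) powr p"
    let ?D = "{k. real k \<le> e * x}"
    have geq: "?g k * indicator ?D k = (2 * mean / (d * x)) powr p * (real k powr p * indicator {..e * x} (real k))" for k
    proof -
      have "2 * real k * mean / (d * x) = (2 * mean / (d * x)) * real k" by simp
      then have "?g k = (2 * mean / (d * x)) powr p * real k powr p"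
        using x d mean_pos by (simp only: powr_mult[symmetric])
      then show ?thesis by (auto simp: indicator_def)
    qed
    have kp: "real k powr p * indicator {..e * x} (real k) \<le> (e * x) powr p" for k
      using p by (auto simp: indicator_def intro!: powr_mono2)
    have "prob {\<omega> \<in> space M. N \<omega> \<in> ?D \<and> ((\<Sum>i\<in>{1..N \<omega>}. (\<lambda>i\<in>{1..}. A i \<omega>) i) > d * x \<and> (\<forall>i\<in>{1..N \<omega>}. (\<lambda>i\<in>{1..}. A i \<omega>) i \<le> \<epsilon> * x))}
       \<le> expectation (\<lambda>\<omega>. ?g (N \<omega>) * indicator ?D (N \<omega>))"
    proof (rule random_index_bound[where Q="\<lambda>k a. (\<Sum>i\<in>{1..k}. a i) > d * x \<and> (\<forall>i\<in>{1..k}. a i \<le> \<epsilon> * x)"])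
      fix k :: nat
      have m: "(\<lambda>a. \<Sum>i\<in>{1..k}. a i :: real) \<in> borel_measurable (Pi\<^sub>M {1..} (\<lambda>_. borel))"
        by (intro borel_measurable_sum coord_measurable) auto
      have le: "Measurable.pred (Pi\<^sub>M {1..} (\<lambda>_. borel)) (\<lambda>a. a i \<le> \<epsilon> * x)" if "i \<in> {1..k}" for i
      proof -
        have [measurable]: "(\<lambda>a. a i) \<in> borel_measurable (Pi\<^sub>M {1..} (\<lambda>_. borel))"
          using that by (intro coord_measurable) auto
        show ?thesis by measurable
      qed
      show "Measurable.pred (Pi\<^sub>M {1..} (\<lambda>_. borel)) (\<lambda>a. (\<Sum>i\<in>{1..k}. a i) > d * x \<and> (\<forall>i\<in>{1..k}. a i \<le> \<epsilon> * x))"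
        by (intro pred_intros_logic pred_intros_finite borel_measurable_pred_less measurable_const le m) auto
      show "0 \<le> ?g k" by simp
      assume k: "k \<in> ?D"
      show "prob {\<omega> \<in> space M. (\<Sum>i\<in>{1..k}. (\<lambda>i\<in>{1..}. A i \<omega>) i) > d * x \<and> (\<forall>i\<in>{1..k}. (\<lambda>i\<in>{1..}. A i \<omega>) i \<le> \<epsilon> * x)} \<le> ?g k"
      proof (cases "k = 0")
        case True
        \<comment> \<open>The Chernoff bound requires at least one summand; an empty sum cannot
          exceed \<open>d * x\<close>.\<close>
        have "\<not> d * x < 0" using d x by (simp add: not_less)
        with True show ?thesis by simp
      next
        case False
        have "2 * real k * mean \<le> 2 * (e * x) * mean" using k mean_pos by (intro mult_mono) auto
        also have "\<dots> = 2 * s * x" using e by (simp add: algebra_simps)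
        also have "\<dots> \<le> d * x" using s x by (intro mult_right_mono) auto
        finally have kle: "2 * real k * mean \<le> d * x" .
        have "prob {\<omega> \<in> space M. (\<Sum>i\<in>{1..k}. A i \<omega>) > d * x \<and> (\<forall>i\<in>{1..k}. A i \<omega> \<le> \<epsilon> * x)}
           \<le> (2 * real k * mean / (d * x)) powr (d * x / (2 * (\<epsilon> * x)))"
          using False kle x \<epsilon> mean_pos by (intro truncated_sum_tail_bound) auto
        also have "d * x / (2 * (\<epsilon> * x)) = p" using x by (simp add: p_def)
        finally show ?thesis unfolding restrict_from_one by simp
      qed
    next
      show "integrable M (\<lambda>\<omega>. ?g (N \<omega>) * indicator ?D (N \<omega>))"
        unfolding geq using kp by (intro integrable_mult_right integrable_const_bound[where B="(e * x) powr p"]) auto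
    qed
    also have "\<dots> = (2 * mean / (d * x)) powr p * expectation (\<lambda>\<omega>. real (N \<omega>) powr p * indicator {..e * x} (real (N \<omega>)))"
      unfolding geq by simp
    also have "\<dots> \<le> (2 * mean / (d * x)) powr p * (C * ((e * x) powr p * H (mean * (e * x))))"
      using x by (intro mult_left_mono C) auto
    also have "mean * (e * x) = s * x" by (simp add: e(2) flip: mult.assoc)
    also have "(2 * mean / (d * x)) powr p * (C * ((e * x) powr p * H (s * x))) =
        C * ((2 * mean / (d * x)) powr p * (e * x) powr p) * H (s * x)"
      by (simp add: mult_ac)
    also have "(2 * mean / (d * x)) powr p * (e * x) powr p = (2 / d * s) powr p"
    proof -
      have "(2 * mean / (d * x)) powr p * (e * x) powr p = ((2 * mean / (d * x)) * (e * x)) powr p"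
        using x e d mean_pos by (subst powr_mult) auto
      also have "(2 * mean / (d * x)) * (e * x) = 2 / d * s" using x e(2) by (simp add: field_simps)
      finally show ?thesis .
    qed
    also have "C * (2 / d * s) powr p * H (s * x) \<le> C * (2 / d * s) powr p * (2 * s powr (-\<alpha>) * H x)"
      using C by (intro mult_left_mono Hs) auto
    also have "\<dots> = b s * H x"
    proof -
      have "(2 / d * s) powr p * s powr (-\<alpha>) = (2 / d) powr p * (s powr p * s powr (-\<alpha>))"
        using s(1) d by (subst powr_mult) auto
      also have "s powr p * s powr (-\<alpha>) = s powr (p - \<alpha>)" by (simp flip: powr_add)
      finally show ?thesis unfolding b_def by (simp add: ac_simps)
    qed
    also have "\<dots> \<le> c * H x" using s H_pos[of x] by (intro mult_right_mono) auto
    finally show ?case unfolding restrict_from_one by simp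
  qed
  with e show ?thesis by blast
qed

text \<open>Once \<open>b * x\<close> exceeds the threshold \<open>k0\<close> of the weak law, a
  deviation has conditional probability below \<open>c / B\<close>, while \<open>N > b * x\<close>
  itself has probability at most \<open>B * H x\<close>.\<close>

lemma lln_deviation_large_N:
  fixes e :: real
  assumes e: "e > 0" and b: "b > 0"
  shows "(\<lambda>x. prob {\<omega> \<in> space M. real (N \<omega>) > b * x \<and>
      \<bar>(\<Sum>i\<in>{1..N \<omega>}. A i \<omega>) - N \<omega> * mean\<bar> > e * N \<omega>}) \<in> o[at_top](H)"
proof (rule landau_o.smallI)
  fix c :: real assume c: "c > 0"
  have "(\<lambda>x. H (mean * b * x)) \<in> O[at_top](H)"
    using mean_pos b by (intro rv_tail_scale_bigo[OF rv_lin]) auto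
  then obtain B where B: "B > 0" "eventually (\<lambda>x. H (mean * b * x) \<le> B * H x) at_top"
    by (rule bigo_H_bound) (auto simp: tail_nonneg)
  have "eventually (\<lambda>k. prob {\<omega> \<in> space M. \<bar>(\<Sum>i\<in>{1..k}. A i \<omega>) - k * mean\<bar> > e * k} < c / B) sequentially"
    using c B by (intro order_tendstoD(2)[OF weak_law[OF e]]) auto
  then obtain k0 where k0: "\<And>k. k \<ge> k0 \<Longrightarrow> prob {\<omega> \<in> space M. \<bar>(\<Sum>i\<in>{1..k}. A i \<omega>) - k * mean\<bar> > e * k} < c / B"
    by (auto simp: eventually_sequentially)
  show "eventually (\<lambda>x. norm (prob {\<omega> \<in> space M. real (N \<omega>) > b * x \<and>
      \<bar>(\<Sum>i\<in>{1..N \<omega>}. A i \<omega>) - N \<omega> * mean\<bar> > e * N \<omega>}) \<le> c * norm (H x)) at_top"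
    using B(2) eventually_ge_at_top[of "real k0 / b"]
  proof eventually_elim
    case (elim x)
    then have bx: "b * x \<ge> k0" using b by (simp add: field_simps)
    let ?D = "{k. real k > b * x}"
    have ind: "(\<lambda>\<omega>. indicator ?D (N \<omega>) :: real) \<in> borel_measurable M" by measurable
    have int: "integrable M (\<lambda>\<omega>. indicator ?D (N \<omega>) :: real)"
      using ind by (intro integrable_const_bound[where B=1]) auto
    have "prob {\<omega> \<in> space M. N \<omega> \<in> ?D \<and> \<bar>(\<Sum>i\<in>{1..N \<omega>}. (\<lambda>i\<in>{1..}. A i \<omega>) i) - N \<omega> * mean\<bar> > e * N \<omega>}
       \<le> expectation (\<lambda>\<omega>. c / B * indicator ?D (N \<omega>))"
    proof (rule random_index_bound[where Q="\<lambda>k a. \<bar>(\<Sum>i\<in>{1..k}. a i) - k * mean\<bar> > e * k"])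
      fix k :: nat
      have m [measurable]: "(\<lambda>a. \<Sum>i\<in>{1..k}. a i :: real) \<in> borel_measurable (Pi\<^sub>M {1..} (\<lambda>_. borel))"
        by (intro borel_measurable_sum coord_measurable) auto
      show "Measurable.pred (Pi\<^sub>M {1..} (\<lambda>_. borel)) (\<lambda>a. \<bar>(\<Sum>i\<in>{1..k}. a i) - k * mean\<bar> > e * k)"
        by measurable
      assume "k \<in> ?D"
      then have "k \<ge> k0" using bx by (metis mem_Collect_eq le_less_trans of_nat_less_iff less_imp_le)
      then show "prob {\<omega> \<in> space M. \<bar>(\<Sum>i\<in>{1..k}. (\<lambda>i\<in>{1..}. A i \<omega>) i) - k * mean\<bar> > e * k} \<le> c / B"
        unfolding restrict_from_one using k0 less_imp_le by blast
    qed (use c B int in auto)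
    also have "\<dots> = c / B * prob {\<omega> \<in> space M. real (N \<omega>) > b * x}"
    proof -
      have "expectation (\<lambda>\<omega>. indicator ?D (N \<omega>) :: real) = expectation (indicator {\<omega> \<in> space M. real (N \<omega>) > b * x})"
        by (intro Bochner_Integration.integral_cong) (auto simp: indicator_def)
      then show ?thesis by simp
    qed
    also have "\<dots> \<le> c / B * (B * H x)"
    proof (intro mult_left_mono)
      have "prob {\<omega> \<in> space M. real (N \<omega>) > b * x} \<le> H (mean * b * x)"
        using tail_N_le[of "b * x"] by (simp add: mult.assoc)
      then show "prob {\<omega> \<in> space M. real (N \<omega>) > b * x} \<le> B * H x" using elim by simp
    qed (use c B in auto)
    finally show ?case unfolding restrict_from_one using B H_pos[of x] by simp
  qed
qed

abbreviation "T \<equiv> tail M (\<lambda>\<omega>. (\<Sum>i\<in>{1..N \<omega>}. A i \<omega>) + R \<omega>)"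
abbreviation "EN \<equiv> expectation (\<lambda>\<omega>. real (N \<omega>))"

lemma EN_nonneg: "0 \<le> EN" by simp

lemma EN_jump: "prob {\<omega> \<in> space M. \<exists>i\<in>{1..N \<omega>}. A i \<omega> > t} \<le> EN * F t"
  using prob_jump_le[of UNIV t] by simp

lemma tail_random_sum_upper:
  assumes c: "c > 0"
  shows "eventually (\<lambda>x. T x \<le> H x + EN * F x + c * H x) at_top"
proof -
  \<comment> \<open>Six errors of size \<open>c' * H x\<close> will arise: one from each of
    \<open>C1\<close> and \<open>C2\<close>, and one from each of the four bad events.\<close>
  define c' where "c' = c / 8"
  have c': "c' > 0" using c by (simp add: c'_def)
  obtain B where B: "B > 0" "eventually (\<lambda>x. F x \<le> B * H x) at_top"
    using bigo_H_bound[OF A_bigo] by (auto simp: tail_nonneg)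
  \<comment> \<open>Chosen so that the loss \<open>EN * e * F x\<close> is at most
    \<open>c' * H x\<close>; \<open>EN + 1\<close> avoids dividing by a vanishing mean.\<close>
  define e where "e = c' / ((EN + 1) * B)"
  have e: "e > 0" using c' B by (simp add: e_def add_nonneg_pos)
  obtain d1 where d1: "0 < d1" "d1 < 1" "\<And>d. 0 < d \<and> d \<le> d1 \<Longrightarrow> eventually (\<lambda>x. H ((1 - d) * x) \<le> (1 + c') * H x) at_top"
    using rv_tail_near_one[OF rv_lin c'] by blast
  obtain d2 where d2: "0 < d2" "d2 < 1" "\<And>d. 0 < d \<and> d \<le> d2 \<Longrightarrow> eventually (\<lambda>x. F ((1 - d) * x) \<le> (1 + e) * F x) at_top"
    using rv_tail_near_one[OF rv_A e] by blast
  define d where "d = min d1 d2"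
  have d: "0 < d" "d < 1" using d1 d2 by (auto simp: d_def)
  have Hd: "eventually (\<lambda>x. H ((1 - d) * x) \<le> (1 + c') * H x) at_top" using d1 d2 by (auto simp: d_def)
  have Fd: "eventually (\<lambda>x. F ((1 - d) * x) \<le> (1 + e) * F x) at_top" using d1 d2 by (auto simp: d_def)
  \<comment> \<open>This makes the Chernoff exponent \<open>d / (2 * \<epsilon>)\<close> equal to
    \<open>2 * (\<alpha> + 1)\<close>, above \<alpha> as required.\<close>
  define \<epsilon> where "\<epsilon> = d / (4 * (\<alpha> + 1))"
  have \<epsilon>: "\<epsilon> > 0" using d \<alpha>_nonneg by (simp add: \<epsilon>_def)
  have "d / (2 * \<epsilon>) = 2 * (\<alpha> + 1)" using d \<alpha>_nonneg by (simp add: \<epsilon>_def field_simps)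
  then have p: "d / (2 * \<epsilon>) > \<alpha>" using \<alpha>_nonneg by simp
  \<comment> \<open>If neither \<open>mean * N + R\<close> nor a single summand exceeds \<open>(1 - d) * x\<close>, the sum exceeds \<open>x\<close> only through a jump above
    \<open>\<epsilon> * x\<close> with many (\<open>B1\<close>) or few (\<open>B2\<close>) summands, or without such a jump and with few (\<open>B3\<close>) or many (\<open>B4\<close>) summands.\<close>
  define B1 where "B1 K x = {\<omega> \<in> space M. N \<omega> \<in> {K<..} \<and> (\<exists>i\<in>{1..N \<omega>}. A i \<omega> > \<epsilon> * x)}" for K x
  define B2 where "B2 K x = {\<omega> \<in> space M. N \<omega> \<le> K \<and> (\<exists>i\<in>{1..N \<omega>}. \<epsilon> * x < A i \<omega>) \<and> (\<forall>i\<in>{1..N \<omega>}. A i \<omega> \<le> (1 - d) * x) \<and>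
       (\<Sum>i\<in>{1..N \<omega>}. A i \<omega>) + R \<omega> > x}" for K x
  define B3 where "B3 b x = {\<omega> \<in> space M. real (N \<omega>) \<le> b * x \<and>
     (\<Sum>i\<in>{1..N \<omega>}. A i \<omega>) > d * x \<and> (\<forall>i\<in>{1..N \<omega>}. A i \<omega> \<le> \<epsilon> * x)}" for b x
  define B4 where "B4 b x = {\<omega> \<in> space M. real (N \<omega>) > b * x \<and>
      \<bar>(\<Sum>i\<in>{1..N \<omega>}. A i \<omega>) - N \<omega> * mean\<bar> > (d * mean) * N \<omega>}" for b x
  define C1 where "C1 x = {\<omega> \<in> space M. mean * real (N \<omega>) + R \<omega> > (1 - d) * x}" for x
  define C2 where "C2 x = {\<omega> \<in> space M. \<exists>i\<in>{1..N \<omega>}. A i \<omega> > (1 - d) * x}" for x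
  have [measurable]: "B1 K x \<in> sets M" for K x
    unfolding B1_def greaterThan_iff by measurable
  have [measurable]: "B2 K x \<in> sets M" for K x
    unfolding B2_def by measurable
  have [measurable]: "B3 b x \<in> sets M" for b x
    unfolding B3_def by measurable
  have [measurable]: "B4 b x \<in> sets M" for b x
    unfolding B4_def by measurable
  have [measurable]: "C1 x \<in> sets M" for x
    unfolding C1_def by measurable
  have [measurable]: "C2 x \<in> sets M" for x
    unfolding C2_def by measurable
  obtain K where K: "eventually (\<lambda>x. prob (B1 K x) \<le> c' * H x) at_top"
    using large_jump_large_N[OF c' \<epsilon>] by (auto simp: B1_def)
  have b2: "eventually (\<lambda>x. prob (B2 K x) \<le> c' * H x) at_top"
    using smallo_H_bound[OF large_jump_small_N[OF d(1) \<epsilon>] c'] by (simp add: B2_def)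
  obtain b where b: "b > 0" "eventually (\<lambda>x. prob (B3 b x) \<le> c' * H x) at_top"
    using no_jump_small_N[OF d(1) \<epsilon> p c'] by (auto simp: B3_def)
  have b4: "eventually (\<lambda>x. prob (B4 b x) \<le> c' * H x) at_top"
    unfolding B4_def using d mean_pos by (intro smallo_H_bound[OF lln_deviation_large_N[OF _ b(1)] c']) auto
  from Hd Fd K b2 b(2) b4 B(2) eventually_gt_at_top[of 0]
  show ?thesis
  proof eventually_elim
    case (elim x)
    have "T x \<le> prob (C1 x \<union> (C2 x \<union> (B1 K x \<union> (B2 K x \<union> (B3 b x \<union> B4 b x)))))"
      unfolding tail_def
    proof (rule finite_measure_mono)
      show "{\<omega> \<in> space M. x < (\<Sum>i\<in>{1..N \<omega>}. A i \<omega>) + R \<omega>} \<subseteq> C1 x \<union> (C2 x \<union> (B1 K x \<union> (B2 K x \<union> (B3 b x \<union> B4 b x))))"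
      proof (rule subsetI, rule ccontr)
        fix \<omega> assume h: "\<omega> \<in> {\<omega> \<in> space M. x < (\<Sum>i\<in>{1..N \<omega>}. A i \<omega>) + R \<omega>}"
          and n: "\<omega> \<notin> C1 x \<union> (C2 x \<union> (B1 K x \<union> (B2 K x \<union> (B3 b x \<union> B4 b x))))"
        let ?S = "\<Sum>i\<in>{1..N \<omega>}. A i \<omega>"
        have \<omega>: "\<omega> \<in> space M" using h by simp
        have L: "mean * real (N \<omega>) + R \<omega> \<le> (1 - d) * x" using n \<omega> by (auto simp: C1_def)
        have A: "\<forall>i\<in>{1..N \<omega>}. A i \<omega> \<le> (1 - d) * x" using n \<omega> by (auto simp: C2_def not_less)
        have nb: "\<not> (\<exists>i\<in>{1..N \<omega>}. A i \<omega> > \<epsilon> * x)"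
        proof
          assume a: "\<exists>i\<in>{1..N \<omega>}. A i \<omega> > \<epsilon> * x"
          then have "N \<omega> \<le> K" using n \<omega> by (auto simp: B1_def)
          then have "\<omega> \<in> B2 K x" using a A h by (auto simp: B2_def)
          then show False using n by auto
        qed
        have dev: "?S - mean * real (N \<omega>) > d * x" using L h by (simp add: algebra_simps)
        have mN: "mean * real (N \<omega>) \<ge> 0" using mean_pos by simp
        have "(1 - d) * x \<le> x" using d elim by (simp add: algebra_simps)
        then have Nx: "mean * real (N \<omega>) \<le> x" using L R_nonneg[of \<omega>] by linarith
        show False
        proof (cases "real (N \<omega>) \<le> b * x")
          case True
          then have "\<omega> \<in> B3 b x" using \<omega> nb dev mN by (auto simp: B3_def not_less)
          then show False using n by auto
        next
          case False
          \<comment> \<open>Since \<open>mean * N\<close> is at most \<open>x\<close>, the absolute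
            deviation \<open>d * x\<close> is also a relative one, above \<open>d * mean\<close> per
            summand, as the weak law needs.\<close>
          have "d * (mean * real (N \<omega>)) \<le> d * x" using d Nx by (intro mult_left_mono) auto
          then have "\<omega> \<in> B4 b x" using \<omega> dev False by (auto simp: B4_def mult_ac)
          then show False using n by auto
        qed
      qed
    qed measurable
    also have "\<dots> \<le> prob (C1 x) + (prob (C2 x) + (prob (B1 K x) + (prob (B2 K x) + (prob (B3 b x) + prob (B4 b x)))))"
      by (rule order_trans[OF measure_Un_le add_left_mono], measurable)+
    also have "prob (C1 x) = H ((1 - d) * x)" by (simp add: C1_def tail_def)
    finally have t: "T x \<le> H ((1 - d) * x) + (prob (C2 x) + (prob (B1 K x) + (prob (B2 K x) + (prob (B3 b x) + prob (B4 b x)))))" .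
    have "prob (C2 x) \<le> EN * F ((1 - d) * x)" unfolding C2_def by (rule EN_jump)
    also have "\<dots> \<le> EN * ((1 + e) * F x)" using elim by (intro mult_left_mono EN_nonneg) auto
    also have "\<dots> = EN * F x + (EN * e) * F x" by (simp add: algebra_simps)
    also have "(EN * e) * F x \<le> ((EN + 1) * e) * (B * H x)"
      using elim e EN_nonneg B H_pos[of x] by (intro mult_mono) (auto simp: tail_nonneg)
    also have "(EN + 1) * e = c' / B"
      using EN_nonneg add_nonneg_pos[OF EN_nonneg zero_less_one] by (simp add: e_def)
    also have "c' / B * (B * H x) = c' * H x" using B(1) by simp
    finally have c2: "prob (C2 x) \<le> EN * F x + c' * H x" by simp
    have "T x \<le> H x + EN * F x + 6 * (c' * H x)"
      using t c2 elim by (simp add: algebra_simps)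
    also have "6 * (c' * H x) \<le> c * H x" using H_pos[of x] c by (simp add: c'_def)
    finally show ?case by simp
  qed
qed

text \<open>The two sources of exceedance are placed on disjoint events, so that their probabilities
  add: \<open>E1\<close> has the linear part above \<open>(1 + d) * x\<close>, the events
  \<open>E2 i\<close> have it at most that. The overlaps thrown away are products of two
  tails.\<close>

lemma tail_random_sum_lower:
  assumes c: "c > 0"
  shows "eventually (\<lambda>x. T x \<ge> H x + EN * F x - c * H x) at_top"
proof -
  \<comment> \<open>Four losses of size \<open>c' * H x\<close> will arise: from the shifted level,
    from \<open>B4\<close>, from cutting \<open>N\<close> at \<open>K\<close>, and from the overlaps
    \<open>g\<close>.\<close>
  define c' where "c' = c / 5"
  have c': "c' > 0" using c by (simp add: c'_def)
  obtain B where B: "B > 0" "eventually (\<lambda>x. F x \<le> B * H x) at_top"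
    using bigo_H_bound[OF A_bigo] by (auto simp: tail_nonneg)
  obtain d where d: "0 < d" "d < 1" "eventually (\<lambda>x. H ((1 + d) * x) \<ge> (1 - c') * H x) at_top"
    using rv_tail_near_one[OF rv_lin c'] by blast
  obtain K where K: "expectation (\<lambda>\<omega>. real (N \<omega>) * indicator {K<..} (N \<omega>)) < c' / B"
    using expectation_N_above[of "c' / B"] B c' by auto
  \<comment> \<open>Let \<open>L = mean * N + R\<close> exceed \<open>(1 + d) * x\<close> while the
    sum with \<open>R\<close> stays at most \<open>x\<close>. Then the sum falls short of its mean
    by at least \<open>L - x > d / (1 + d) * L \<ge> e * N\<close>.\<close>
  define e where "e = d / (1 + d) * mean"
  have e: "e > 0" using d mean_pos by (simp add: e_def)
  \<comment> \<open>In that situation the shortfall exceeds \<open>d * x\<close> and the sum is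
    nonnegative, so \<open>mean * N > d * x\<close>: there are enough summands for the weak
    law.\<close>
  define b where "b = d / mean"
  have b: "b > 0" using d mean_pos by (simp add: b_def)
  define B4 where "B4 x = {\<omega> \<in> space M. real (N \<omega>) > b * x \<and>
      \<bar>(\<Sum>i\<in>{1..N \<omega>}. A i \<omega>) - N \<omega> * mean\<bar> > e * N \<omega>}" for x
  have b4: "eventually (\<lambda>x. prob (B4 x) \<le> c' * H x) at_top"
    unfolding B4_def by (intro smallo_H_bound[OF lln_deviation_large_N[OF e b] c'])
  \<comment> \<open>\<open>E2 i\<close> fixes the first index \<open>i\<close> of a summand above \<open>x\<close>, which makes these events disjoint.\<close>
  define E1 where "E1 x = {\<omega> \<in> space M. (\<Sum>i\<in>{1..N \<omega>}. A i \<omega>) + R \<omega> > x \<and> mean * real (N \<omega>) + R \<omega> > (1 + d) * x}" for x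
  define E2 where "E2 i x = {\<omega> \<in> space M. A i \<omega> > x \<and> (\<forall>j\<in>{1..<i}. A j \<omega> \<le> x) \<and> i \<le> N \<omega> \<and> N \<omega> \<le> K \<and>
      mean * real (N \<omega>) + R \<omega> \<le> (1 + d) * x}" for i x
  have sets [measurable]: "E1 x \<in> sets M" "B4 x \<in> sets M" for x
    unfolding E1_def B4_def by measurable
  have E2m: "E2 i x \<in> sets M" if "i \<in> {1..K}" for i x
  proof -
    have [measurable]: "A i \<in> borel_measurable M" using that by (intro A_measurable) auto
    have "Measurable.pred M (\<lambda>\<omega>. A j \<omega> \<le> x)" if "j \<in> {1..<i}" for j
    proof -
      have [measurable]: "A j \<in> borel_measurable M" using that by (intro A_measurable) auto
      show ?thesis by measurable
    qed
    then have [measurable]: "Measurable.pred M (\<lambda>\<omega>. \<forall>j\<in>{1..<i}. A j \<omega> \<le> x)"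
      by (intro pred_intros_finite) auto
    show ?thesis unfolding E2_def by measurable
  qed
  \<comment> \<open>Overlaps to be discarded: two summands above \<open>x\<close>, or one summand
    above \<open>x\<close> together with a large linear part. The form \<open>F (1 * x)\<close> fits
    the lemma on scaled tails.\<close>
  define g where "g x = (real K * real K) * (F x * F (1 * x)) + real K * (F x * H ((1 + d) * x))" for x
  have "g \<in> o[at_top](H)" unfolding g_def
  proof (intro sum_in_smallo(1))
    have "(\<lambda>x. F x * H ((1 + d) * x)) \<in> o[at_top](H)"
      using d by (intro bigo_mult_tendsto_0 A_bigo tail_scale_tendsto_0) auto
    then show "(\<lambda>x. K * (F x * H ((1 + d) * x))) \<in> o[at_top](H)" by simp
    have "(\<lambda>x. F x * F (1 * x)) \<in> o[at_top](H)"
      by (intro bigo_mult_tendsto_0 A_bigo tail_scale_tendsto_0) auto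
    then show "(\<lambda>x. real K * real K * (F x * F (1 * x))) \<in> o[at_top](H)" by simp
  qed
  then have g: "eventually (\<lambda>x. g x \<le> c' * H x) at_top" by (rule smallo_H_bound[OF _ c'])
  \<comment> \<open>The tail-sum formula: the left side is the mean of \<open>N\<close> restricted
    to \<open>N \<le> K\<close>.\<close>
  have ENK: "(\<Sum>i\<in>{1..K}. prob {\<omega> \<in> space M. i \<le> N \<omega> \<and> N \<omega> \<le> K}) \<ge> EN - c' / B"
  proof -
    have "(\<Sum>i\<in>{1..K}. prob {\<omega> \<in> space M. i \<le> N \<omega> \<and> N \<omega> \<le> K}) =
        (\<Sum>i\<in>{1..K}. expectation (indicator {\<omega> \<in> space M. i \<le> N \<omega> \<and> N \<omega> \<le> K}))"
      by simp
    also have "\<dots> = expectation (\<lambda>\<omega>. \<Sum>i\<in>{1..K}. indicator {\<omega> \<in> space M. i \<le> N \<omega> \<and> N \<omega> \<le> K} \<omega>)"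
      by (intro Bochner_Integration.integral_sum[symmetric] integrable_real_indicator) (auto simp: less_top[symmetric])
    also have "\<dots> = expectation (\<lambda>\<omega>. real (N \<omega>) - real (N \<omega>) * indicator {K<..} (N \<omega>))"
    proof (rule Bochner_Integration.integral_cong[OF refl])
      fix \<omega> assume \<omega>: "\<omega> \<in> space M"
      have "(\<Sum>i\<in>{1..K}. indicator {\<omega> \<in> space M. i \<le> N \<omega> \<and> N \<omega> \<le> K} \<omega> :: real) =
         (\<Sum>i\<in>{1..K}. if i \<in> {i. i \<le> N \<omega> \<and> N \<omega> \<le> K} then 1 else 0)"
        using \<omega> by (intro sum.cong) (auto simp: indicator_def)
      also have "\<dots> = real (card ({1..K} \<inter> {i. i \<le> N \<omega> \<and> N \<omega> \<le> K}))"
        by (subst sum.inter_restrict[symmetric]) auto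
      also have "{1..K} \<inter> {i. i \<le> N \<omega> \<and> N \<omega> \<le> K} = (if N \<omega> \<le> K then {1..N \<omega>} else {})"
        by auto
      finally show "(\<Sum>i\<in>{1..K}. indicator {\<omega> \<in> space M. i \<le> N \<omega> \<and> N \<omega> \<le> K} \<omega>) =
           real (N \<omega>) - real (N \<omega>) * indicator {K<..} (N \<omega>)"
        by (auto simp: indicator_def)
    qed
    also have "\<dots> = EN - expectation (\<lambda>\<omega>. real (N \<omega>) * indicator {K<..} (N \<omega>))"
      by (intro Bochner_Integration.integral_diff int_N integrable_N_indicator)
    finally show ?thesis using K by simp
  qed
  from d(3) b4 g B(2) eventually_gt_at_top[of 0] show ?thesis
  proof eventually_elim
    case (elim x)
    have "H ((1 + d) * x) \<le> prob (E1 x \<union> B4 x)"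
      unfolding tail_def
    proof (rule finite_measure_mono)
      show "{\<omega> \<in> space M. (1 + d) * x < mean * real (N \<omega>) + R \<omega>} \<subseteq> E1 x \<union> B4 x"
      proof
        fix \<omega> assume "\<omega> \<in> {\<omega> \<in> space M. (1 + d) * x < mean * real (N \<omega>) + R \<omega>}"
        then have \<omega>: "\<omega> \<in> space M" and L: "(1 + d) * x < mean * real (N \<omega>) + R \<omega>" by auto
        let ?S = "\<Sum>i\<in>{1..N \<omega>}. A i \<omega>"
        show "\<omega> \<in> E1 x \<union> B4 x"
        proof (cases "?S + R \<omega> > x")
          case False
          let ?L = "mean * real (N \<omega>) + R \<omega>"
          have S: "?S \<ge> 0" by (intro sum_nonneg A_nonneg)
          have "x < ?L / (1 + d)" using L d by (simp add: field_simps)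
          moreover have "?L - ?L / (1 + d) = d / (1 + d) * ?L" using d by (simp add: field_simps)
          moreover have "d / (1 + d) * (mean * real (N \<omega>)) \<le> d / (1 + d) * ?L"
            using R_nonneg[of \<omega>] d by (intro mult_left_mono) auto
          moreover have "d / (1 + d) * (mean * real (N \<omega>)) = e * real (N \<omega>)" by (simp add: e_def)
          ultimately have 1: "?L - x > e * real (N \<omega>)" by linarith
          have 2: "mean * real (N \<omega>) - ?S \<ge> ?L - x" using False by simp
          have "mean * real (N \<omega>) > d * x" using 2 S L by (simp add: algebra_simps)
          then have "real (N \<omega>) > b * x" using mean_pos by (simp add: b_def field_simps)
          then have "\<omega> \<in> B4 x" using \<omega> 1 2 by (auto simp: B4_def mult_ac)
          then show ?thesis by simp
        qed (use \<omega> L in \<open>auto simp: E1_def\<close>)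
      qed
    qed measurable
    also have "\<dots> \<le> prob (E1 x) + prob (B4 x)" by (intro measure_Un_le) auto
    finally have e1: "prob (E1 x) \<ge> H ((1 + d) * x) - prob (B4 x)" by simp
    \<comment> \<open>From the independent event that \<open>A i > x\<close> and
      \<open>i \<le> N \<le> K\<close>, the cases with an earlier summand above \<open>x\<close> or
      with a large linear part are removed.\<close>
    have E2i: "prob (E2 i x) \<ge> F x * prob {\<omega> \<in> space M. i \<le> N \<omega> \<and> N \<omega> \<le> K} - (real K * (F x * F x) + F x * H ((1 + d) * x))"
      if i: "i \<in> {1..K}" for i
    proof -
      have [measurable]: "A i \<in> borel_measurable M" using that by (intro A_measurable) auto
      have Am [measurable]: "Measurable.pred M (\<lambda>\<omega>. A i \<omega> > x \<and> A j \<omega> > x)" if "j \<in> {1..<i}" for j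
      proof -
        have [measurable]: "A j \<in> borel_measurable M" using that by (intro A_measurable) auto
        show ?thesis by measurable
      qed
      have ex [measurable]: "Measurable.pred M (\<lambda>\<omega>. \<exists>j\<in>{1..<i}. A i \<omega> > x \<and> A j \<omega> > x)"
        by (intro pred_intros_finite Am) auto
      note [measurable] = E2m[OF i]
      have "F x * prob {\<omega> \<in> space M. i \<le> N \<omega> \<and> N \<omega> \<le> K} = prob {\<omega> \<in> space M. (i \<le> N \<omega> \<and> N \<omega> \<le> K) \<and> A i \<omega> > x}"
        using prob_indep_A[of "\<lambda>z. i \<le> fst z \<and> fst z \<le> K" i x] i by (simp add: mult.commute)
      also have "\<dots> \<le> prob {\<omega> \<in> space M. \<omega> \<in> E2 i x \<or> ((\<exists>j\<in>{1..<i}. A i \<omega> > x \<and> A j \<omega> > x) \<or> mean * real (N \<omega>) + R \<omega> > (1 + d) * x \<and> A i \<omega> > x)}"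
        by (intro prob_imp_le) (measurable, auto simp: E2_def not_less)
      also have "\<dots> \<le> prob {\<omega> \<in> space M. \<omega> \<in> E2 i x} + (prob {\<omega> \<in> space M. \<exists>j\<in>{1..<i}. A i \<omega> > x \<and> A j \<omega> > x} +
          prob {\<omega> \<in> space M. mean * real (N \<omega>) + R \<omega> > (1 + d) * x \<and> A i \<omega> > x})"
        by (intro order_trans[OF prob_disj_le add_left_mono[OF prob_disj_le]]) measurable
      also have "{\<omega> \<in> space M. \<omega> \<in> E2 i x} = E2 i x" by (auto simp: E2_def)
      also have "prob {\<omega> \<in> space M. mean * real (N \<omega>) + R \<omega> > (1 + d) * x \<and> A i \<omega> > x} = H ((1 + d) * x) * F x"
        using prob_indep_A[of "\<lambda>z. mean * real (fst z) + snd z > (1 + d) * x" i x] i by (simp add: tail_def)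
      also have "prob {\<omega> \<in> space M. \<exists>j\<in>{1..<i}. A i \<omega> > x \<and> A j \<omega> > x} \<le> (\<Sum>j\<in>{1..<i}. prob {\<omega> \<in> space M. A i \<omega> > x \<and> A j \<omega> > x})"
        by (intro prob_ex_le Am) auto
      also have "\<dots> = (\<Sum>j\<in>{1..<i}. F x * F x)"
        by (intro sum.cong refl prob_pair) (use i in auto)
      also have "\<dots> \<le> real K * (F x * F x)"
        using i by (auto intro!: mult_right_mono simp: tail_nonneg)
      finally show ?thesis by (simp add: algebra_simps)
    qed
    have "EN * F x - c' * H x \<le> F x * (EN - c' / B)"
      using elim B c' by (simp add: field_simps)
    also have "\<dots> \<le> F x * (\<Sum>i\<in>{1..K}. prob {\<omega> \<in> space M. i \<le> N \<omega> \<and> N \<omega> \<le> K})"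
      by (intro mult_left_mono ENK tail_nonneg)
    also have "\<dots> - g x = (\<Sum>i\<in>{1..K}. F x * prob {\<omega> \<in> space M. i \<le> N \<omega> \<and> N \<omega> \<le> K} - (real K * (F x * F x) + F x * H ((1 + d) * x)))"
      by (simp add: g_def sum_subtractf sum_distrib_left algebra_simps)
    also have "\<dots> \<le> (\<Sum>i\<in>{1..K}. prob (E2 i x))" by (intro sum_mono E2i)
    also have "\<dots> = prob (\<Union>i\<in>{1..K}. E2 i x)"
    proof (rule finite_measure_finite_Union[symmetric])
      show "disjoint_family_on (\<lambda>i. E2 i x) {1..K}"
        unfolding disjoint_family_on_def
      proof (intro ballI impI)
        fix i j assume "i \<in> {1..K}" "j \<in> {1..K}" "i \<noteq> j"
        then show "E2 i x \<inter> E2 j x = {}"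
          by (cases i j rule: linorder_cases) (force simp: E2_def)+
      qed
    qed (use E2m in auto)
    finally have e2: "EN * F x - c' * H x - g x \<le> prob (\<Union>i\<in>{1..K}. E2 i x)" by simp
    have "prob (E1 x) + prob (\<Union>i\<in>{1..K}. E2 i x) = prob (E1 x \<union> (\<Union>i\<in>{1..K}. E2 i x))"
      using E2m by (intro finite_measure_Union[symmetric]) (auto simp: E1_def E2_def)
    also have "\<dots> \<le> T x" unfolding tail_def
    proof (rule finite_measure_mono)
      show "E1 x \<union> (\<Union>i\<in>{1..K}. E2 i x) \<subseteq> {\<omega> \<in> space M. x < (\<Sum>i\<in>{1..N \<omega>}. A i \<omega>) + R \<omega>}"
      proof -
        have "x < (\<Sum>i\<in>{1..N \<omega>}. A i \<omega>) + R \<omega>" if "\<omega> \<in> E2 i x" "i \<in> {1..K}" for \<omega> i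
        proof -
          have "A i \<omega> \<le> (\<Sum>i\<in>{1..N \<omega>}. A i \<omega>)"
            using that by (intro member_le_sum A_nonneg) (auto simp: E2_def)
          then show ?thesis using that R_nonneg[of \<omega>] by (auto simp: E2_def)
        qed
        then show ?thesis by (auto simp: E1_def E2_def)
      qed
    qed measurable
    finally have "T x \<ge> (H ((1 + d) * x) - prob (B4 x)) + (EN * F x - c' * H x - g x)"
      using e1 e2 by linarith
    then have "T x \<ge> H x + EN * F x - 4 * (c' * H x)" using elim by (simp add: algebra_simps)
    moreover have "4 * (c' * H x) \<le> c * H x" using H_pos[of x] c by (simp add: c'_def)
    ultimately show ?case by linarith
  qed
qed

theorem tail_random_sum: "T \<sim>[at_top] (\<lambda>x. H x + EN * F x)"
proof (subst asymp_equiv_altdef, rule landau_o.small_big_trans)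
  show "(\<lambda>x. T x - (H x + EN * F x)) \<in> o[at_top](H)"
  proof (rule landau_o.smallI)
    fix c :: real assume "c > 0"
    from tail_random_sum_upper[OF this] tail_random_sum_lower[OF this]
    show "eventually (\<lambda>x. norm (T x - (H x + EN * F x)) \<le> c * norm (H x)) at_top"
    proof eventually_elim
      case (elim x)
      then show ?case using H_pos[of x] by (simp add: abs_le_iff)
    qed
  qed
  show "H \<in> O[at_top](\<lambda>x. H x + EN * F x)"
    by (intro landau_o.big_mono always_eventually) (auto simp: tail_nonneg)
qed

end

section \<open>The branching process\<close>

lemma asymp_equiv_add_nonneg:
  fixes f g f' g' :: "real \<Rightarrow> real"
  assumes "f \<sim>[at_top] f'" "g \<sim>[at_top] g'" "\<And>x. 0 \<le> f' x" "\<And>x. 0 \<le> g' x"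
  shows "(\<lambda>x. f x + g x) \<sim>[at_top] (\<lambda>x. f' x + g' x)"
proof (subst asymp_equiv_altdef)
  have "(\<lambda>x. f x - f' x) \<in> o[at_top](\<lambda>x. f' x + g' x)"
    using assms by (intro smallo_add_pos_right) (auto simp: asymp_equiv_altdef)
  moreover have "(\<lambda>x. g x - g' x) \<in> o[at_top](\<lambda>x. g' x + f' x)"
    using assms by (intro smallo_add_pos_right) (auto simp: asymp_equiv_altdef)
  ultimately have "(\<lambda>x. (f x - f' x) + (g x - g' x)) \<in> o[at_top](\<lambda>x. f' x + g' x)"
    by (intro sum_in_smallo(1)) (simp_all only: add.commute)
  then show "(\<lambda>x. f x + g x - (f' x + g' x)) \<in> o[at_top](\<lambda>x. f' x + g' x)"
    by (simp add: algebra_simps)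
qed

lemma rv_tail_add_nonneg:
  assumes "rv_tail \<alpha> f" "rv_tail \<alpha> g" "c \<ge> 0"
  shows "rv_tail \<alpha> (\<lambda>x. f x + c * g x)"
proof (cases "c = 0")
  case False
  then have "c > 0" using assms(3) by simp
  then show ?thesis by (intro rv_tail_add assms rv_tail_cmult)
qed (use assms in simp)

section \<open>Transfer of regular variation, Wald's identity and independent blocks\<close>

context prob_space
begin

text \<open>Equivalence gives positivity only near infinity; monotonicity of a tail carries it to
  every \<open>x\<close>.\<close>

lemma rv_tail_tail_asymp:
  assumes X: "X \<in> borel_measurable M" and f: "tail M X \<sim>[at_top] g" and g: "rv_tail \<alpha> g"
  shows "rv_tail \<alpha> (tail M X)"
proof (rule rv_tail_asymp_equiv[OF g f tail_antimono[OF X]])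
  fix x
  have "((\<lambda>x. tail M X x / g x) \<longlongrightarrow> 1) at_top"
    using rv_tail_pos[OF g] by (intro asymp_equivD_strong[OF f] always_eventually) (metis less_irrefl)
  then have "eventually (\<lambda>x. tail M X x / g x > 0) at_top" by (intro order_tendstoD) auto
  with eventually_ge_at_top[of x] have "eventually (\<lambda>y. y \<ge> x \<and> tail M X y / g y > 0) at_top"
    by eventually_elim auto
  then obtain y where y: "y \<ge> x" "tail M X y / g y > 0" by (auto simp: eventually_at_top_linorder)
  then have "tail M X y > 0" using tail_nonneg[of X y] by (cases "tail M X y = 0") auto
  then show "0 < tail M X x" using antimonoD[OF tail_antimono[OF X] y(1)] by linarith
qed

text \<open>Positivity is hidden in the case \<open>q = 1\<close>: division by zero yields 0, so a
  limit of 1 excludes zeros of the tail for large arguments, and monotonicity excludes the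
  rest.\<close>

lemma regularly_varying_iff_rv_tail:
  assumes X: "X \<in> borel_measurable M" and \<alpha>: "\<alpha> \<ge> 0"
  shows "regularly_varying M X \<alpha> \<longleftrightarrow> rv_tail \<alpha> (tail M X)"
proof
  assume rv: "regularly_varying M X \<alpha>"
  have "tail M X x > 0" for x
  proof -
    have "((\<lambda>x. tail M X (1 * x) / tail M X x) \<longlongrightarrow> 1 powr (-\<alpha>)) at_top"
      using rv unfolding regularly_varying_def by (meson zero_less_one)
    then have "((\<lambda>x. tail M X x / tail M X x) \<longlongrightarrow> 1) at_top" by simp
    then have "eventually (\<lambda>x. tail M X x / tail M X x > 0) at_top" by (intro order_tendstoD) auto
    with eventually_ge_at_top[of x] have "eventually (\<lambda>y. y \<ge> x \<and> tail M X y / tail M X y > 0) at_top"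
      by eventually_elim auto
    then obtain y where y: "y \<ge> x" "tail M X y / tail M X y > 0" by (auto simp: eventually_at_top_linorder)
    then have "tail M X y > 0" using tail_nonneg[of X y] by (cases "tail M X y = 0") auto
    then show ?thesis using antimonoD[OF tail_antimono[OF X] y(1)] by linarith
  qed
  then show "rv_tail \<alpha> (tail M X)"
    using rv tail_antimono[OF X] by (auto simp: rv_tail_def regularly_varying_def)
qed (use \<alpha> in \<open>auto simp: rv_tail_def regularly_varying_def\<close>)

lemma tail_cmult:
  assumes "a > 0"
  shows "tail M (\<lambda>\<omega>. a * X \<omega>) x = tail M X (1 / a * x)"
  using assms by (simp add: tail_def field_simps)

lemma rv_tail_tail_cmult:
  assumes "rv_tail \<alpha> (tail M X)" "a > 0"
  shows "rv_tail \<alpha> (tail M (\<lambda>\<omega>. a * X \<omega>))"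
    and "tail M (\<lambda>\<omega>. a * X \<omega>) \<sim>[at_top] (\<lambda>x. a powr \<alpha> * tail M X x)"
proof -
  have eq: "tail M (\<lambda>\<omega>. a * X \<omega>) = (\<lambda>x. tail M X (1 / a * x))" using tail_cmult[OF assms(2)] by auto
  show "rv_tail \<alpha> (tail M (\<lambda>\<omega>. a * X \<omega>))"
    unfolding eq using assms by (intro rv_tail_scale) auto
  have "(1 / a) powr (- \<alpha>) = a powr \<alpha>" using assms(2) by (simp add: powr_divide powr_minus field_simps)
  then show "tail M (\<lambda>\<omega>. a * X \<omega>) \<sim>[at_top] (\<lambda>x. a powr \<alpha> * tail M X x)"
    unfolding eq using rv_tail_scale_asymp[OF assms(1), of "1 / a"] assms(2) by simp
qed

text \<open>Wald's identity from layer sums: the random sum is a series of terms \<open>Z i\<close>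
  on \<open>i \<le> N\<close>, and each \<open>Z i\<close> is a series of indicators of
  \<open>t < Z i\<close>, so factorization of these simple events suffices. Nonnegative integrals
  deliver integrability along with the value.\<close>

lemma wald_nat:
  fixes N :: "'a \<Rightarrow> nat" and Z :: "nat \<Rightarrow> 'a \<Rightarrow> nat"
  assumes [measurable]: "N \<in> measurable M (count_space UNIV)"
    and Zm: "\<And>i. i \<ge> 1 \<Longrightarrow> Z i \<in> measurable M (count_space UNIV)"
    and ind: "\<And>i t. i \<ge> 1 \<Longrightarrow> prob {\<omega> \<in> space M. i \<le> N \<omega> \<and> t < Z i \<omega>} =
        prob {\<omega> \<in> space M. i \<le> N \<omega>} * prob {\<omega> \<in> space M. t < Z 1 \<omega>}"
    and int: "integrable M (\<lambda>\<omega>. real (N \<omega>))" "integrable M (\<lambda>\<omega>. real (Z 1 \<omega>))"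
  shows "integrable M (\<lambda>\<omega>. real (\<Sum>i\<in>{1..N \<omega>}. Z i \<omega>))"
    and "expectation (\<lambda>\<omega>. real (\<Sum>i\<in>{1..N \<omega>}. Z i \<omega>)) =
      expectation (\<lambda>\<omega>. real (N \<omega>)) * expectation (\<lambda>\<omega>. real (Z 1 \<omega>))"
proof -
  have [measurable]: "Z (Suc i) \<in> measurable M (count_space UNIV)" for i by (rule Zm) simp
  have Z1: "(\<integral>\<^sup>+\<omega>. of_nat (Z 1 \<omega>) \<partial>M) = ennreal (expectation (\<lambda>\<omega>. real (Z 1 \<omega>)))"
    using nn_integral_eq_integral[OF int(2)] by (simp add: ennreal_of_nat_eq_real_of_nat)
  have N1: "(\<integral>\<^sup>+\<omega>. of_nat (N \<omega>) \<partial>M) = ennreal (expectation (\<lambda>\<omega>. real (N \<omega>)))"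
    using nn_integral_eq_integral[OF int(1)] by (simp add: ennreal_of_nat_eq_real_of_nat)
  have summand: "(\<integral>\<^sup>+\<omega>. of_nat (if i < N \<omega> then Z (Suc i) \<omega> else 0) \<partial>M) =
     emeasure M {\<omega> \<in> space M. i < N \<omega>} * (\<integral>\<^sup>+\<omega>. of_nat (Z 1 \<omega>) \<partial>M)" for i
  proof -
    have "(\<integral>\<^sup>+\<omega>. of_nat (if i < N \<omega> then Z (Suc i) \<omega> else 0) \<partial>M) =
      (\<Sum>t. emeasure M {\<omega> \<in> space M. t < (if i < N \<omega> then Z (Suc i) \<omega> else 0)})"
      by (intro nn_integral_nat_function) measurable
    also have "\<dots> = (\<Sum>t. emeasure M {\<omega> \<in> space M. i < N \<omega>} * emeasure M {\<omega> \<in> space M. t < Z 1 \<omega>})"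
    proof (intro suminf_cong)
      fix t
      have "{\<omega> \<in> space M. t < (if i < N \<omega> then Z (Suc i) \<omega> else 0)} = {\<omega> \<in> space M. Suc i \<le> N \<omega> \<and> t < Z (Suc i) \<omega>}" by auto
      then show "emeasure M {\<omega> \<in> space M. t < (if i < N \<omega> then Z (Suc i) \<omega> else 0)} =
        emeasure M {\<omega> \<in> space M. i < N \<omega>} * emeasure M {\<omega> \<in> space M. t < Z 1 \<omega>}"
        using ind[of "Suc i" t] by (simp add: emeasure_eq_measure ennreal_mult' Suc_le_eq)
    qed
    also have "\<dots> = emeasure M {\<omega> \<in> space M. i < N \<omega>} * (\<integral>\<^sup>+\<omega>. of_nat (Z 1 \<omega>) \<partial>M)"
      using Zm[of 1] by (subst ennreal_suminf_cmult, subst nn_integral_nat_function) auto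
    finally show ?thesis .
  qed
  have "(\<integral>\<^sup>+\<omega>. ennreal (real (\<Sum>i\<in>{1..N \<omega>}. Z i \<omega>)) \<partial>M) = (\<integral>\<^sup>+\<omega>. (\<Sum>i. of_nat (if i < N \<omega> then Z (Suc i) \<omega> else 0)) \<partial>M)"
  proof (rule nn_integral_cong)
    fix \<omega>
    have "(\<Sum>i. of_nat (if i < N \<omega> then Z (Suc i) \<omega> else 0) :: ennreal) = (\<Sum>i\<in>{..<N \<omega>}. of_nat (if i < N \<omega> then Z (Suc i) \<omega> else 0))"
      by (intro suminf_finite) auto
    also have "\<dots> = (\<Sum>i\<in>{..<N \<omega>}. of_nat (Z (Suc i) \<omega>))" by (intro sum.cong) auto
    also have "\<dots> = (\<Sum>i\<in>{1..N \<omega>}. of_nat (Z i \<omega>))"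
      by (rule sum.reindex_bij_witness[of _ "\<lambda>i. i - 1" Suc]) auto
    finally show "ennreal (real (\<Sum>i\<in>{1..N \<omega>}. Z i \<omega>)) = (\<Sum>i. of_nat (if i < N \<omega> then Z (Suc i) \<omega> else 0))"
      by (subst ennreal_of_nat_eq_real_of_nat[symmetric], subst of_nat_sum) simp
  qed
  also have "\<dots> = (\<Sum>i. \<integral>\<^sup>+\<omega>. of_nat (if i < N \<omega> then Z (Suc i) \<omega> else 0) \<partial>M)"
    by (intro nn_integral_suminf) measurable
  also have "\<dots> = (\<Sum>i. (\<integral>\<^sup>+\<omega>. of_nat (Z 1 \<omega>) \<partial>M) * emeasure M {\<omega> \<in> space M. i < N \<omega>})"
    unfolding summand by (simp add: mult.commute)
  also have "\<dots> = (\<integral>\<^sup>+\<omega>. of_nat (Z 1 \<omega>) \<partial>M) * (\<integral>\<^sup>+\<omega>. of_nat (N \<omega>) \<partial>M)"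
    by (subst ennreal_suminf_cmult, subst nn_integral_nat_function) auto
  also have "\<dots> = ennreal (expectation (\<lambda>\<omega>. real (N \<omega>)) * expectation (\<lambda>\<omega>. real (Z 1 \<omega>)))"
    unfolding Z1 N1 by (simp add: ennreal_mult' mult.commute)
  finally have *: "(\<integral>\<^sup>+\<omega>. ennreal (real (\<Sum>i\<in>{1..N \<omega>}. Z i \<omega>)) \<partial>M) =
    ennreal (expectation (\<lambda>\<omega>. real (N \<omega>)) * expectation (\<lambda>\<omega>. real (Z 1 \<omega>)))" .
  have Zi [measurable]: "i \<ge> 1 \<Longrightarrow> (\<lambda>\<omega>. real (Z i \<omega>)) \<in> borel_measurable M" for i
    using measurable_compose[OF Zm, of i "\<lambda>n. real n"] by simp
  have m: "(\<lambda>\<omega>. real (\<Sum>i\<in>{1..N \<omega>}. Z i \<omega>)) \<in> borel_measurable M"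
  proof (rule measurable_compose_countable[where g=N])
    fix k :: nat show "(\<lambda>\<omega>. real (\<Sum>i\<in>{1..k}. Z i \<omega>)) \<in> borel_measurable M"
      unfolding of_nat_sum by (intro borel_measurable_sum Zi) auto
  qed measurable
  show "integrable M (\<lambda>\<omega>. real (\<Sum>i\<in>{1..N \<omega>}. Z i \<omega>))"
    by (rule integrableI_nonneg[OF m]) (use * in \<open>simp_all add: sum_nonneg\<close>)
  show "expectation (\<lambda>\<omega>. real (\<Sum>i\<in>{1..N \<omega>}. Z i \<omega>)) =
      expectation (\<lambda>\<omega>. real (N \<omega>)) * expectation (\<lambda>\<omega>. real (Z 1 \<omega>))"
    by (rule integral_eq_nn_integral[OF m, THEN trans]) (use * in \<open>simp_all add: sum_nonneg\<close>)
qed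

lemma indep_vars_reindex:
  assumes "inj_on f J" "indep_vars (\<lambda>_. N) X (f ` J)"
  shows "indep_vars (\<lambda>_. N) (\<lambda>j. X (f j)) J"
proof -
  have "indep_vars (\<lambda>j. Pi\<^sub>M {f j} (\<lambda>_. N)) (\<lambda>j \<omega>. restrict (\<lambda>i. X i \<omega>) {f j}) J"
    by (rule indep_vars_restrict[OF assms(2)])
       (use assms(1) in \<open>auto simp: disjoint_family_on_def inj_on_def\<close>)
  from indep_vars_compose2[OF this, of "\<lambda>j z. z (f j)" "\<lambda>_. N"]
  show ?thesis by (simp add: measurable_component_singleton)
qed

text \<open>Independence of disjoint blocks, brought by predicates into the form demanded by
  \<open>random_sum\<close>.\<close>

lemma prob_restrict_indep:
  assumes V: "indep_vars (\<lambda>_. count_space UNIV) V I" and JK: "J \<inter> K = {}" "J \<subseteq> I" "K \<subseteq> I"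
    and [measurable]: "Measurable.pred (Pi\<^sub>M J (\<lambda>_. count_space UNIV)) P" "Measurable.pred (Pi\<^sub>M K (\<lambda>_. count_space UNIV)) Q"
  shows "prob {\<omega> \<in> space M. P (\<lambda>i\<in>J. V i \<omega>) \<and> Q (\<lambda>i\<in>K. V i \<omega>)} =
     prob {\<omega> \<in> space M. P (\<lambda>i\<in>J. V i \<omega>)} * prob {\<omega> \<in> space M. Q (\<lambda>i\<in>K. V i \<omega>)}"
proof -
  let ?P = "{z \<in> space (Pi\<^sub>M J (\<lambda>_. count_space UNIV)). P z}" and ?Q = "{z \<in> space (Pi\<^sub>M K (\<lambda>_. count_space UNIV)). Q z}"
  have "prob ((\<lambda>\<omega>. (\<lambda>i\<in>J. V i \<omega>, \<lambda>i\<in>K. V i \<omega>)) -` (?P \<times> ?Q) \<inter> space M) =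
     prob ((\<lambda>\<omega>. \<lambda>i\<in>J. V i \<omega>) -` ?P \<inter> space M) * prob ((\<lambda>\<omega>. \<lambda>i\<in>K. V i \<omega>) -` ?Q \<inter> space M)"
    by (intro indep_varD[OF indep_var_restrict[OF V JK]]) measurable
  also have "(\<lambda>\<omega>. \<lambda>i\<in>J. V i \<omega>) -` ?P \<inter> space M = {\<omega> \<in> space M. P (\<lambda>i\<in>J. V i \<omega>)}"
    by (auto simp: space_PiM)
  also have "(\<lambda>\<omega>. \<lambda>i\<in>K. V i \<omega>) -` ?Q \<inter> space M = {\<omega> \<in> space M. Q (\<lambda>i\<in>K. V i \<omega>)}"
    by (auto simp: space_PiM)
  also have "(\<lambda>\<omega>. (\<lambda>i\<in>J. V i \<omega>, \<lambda>i\<in>K. V i \<omega>)) -` (?P \<times> ?Q) \<inter> space M =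
      {\<omega> \<in> space M. P (\<lambda>i\<in>J. V i \<omega>) \<and> Q (\<lambda>i\<in>K. V i \<omega>)}"
    by (auto simp: space_PiM)
  finally show ?thesis .
qed

end

section \<open>The process as a function of its driving variables\<close>

definition gw_family :: "('a \<Rightarrow> nat) \<Rightarrow> ('a \<Rightarrow> nat) \<Rightarrow> (nat \<Rightarrow> nat \<Rightarrow> 'a \<Rightarrow> nat)
    \<Rightarrow> (nat \<Rightarrow> nat \<Rightarrow> 'a \<Rightarrow> nat) \<Rightarrow> (nat \<Rightarrow> 'a \<Rightarrow> nat) \<Rightarrow> gw_idx \<Rightarrow> 'a \<Rightarrow> nat" where
  "gw_family X0 Xm1 xi eta eps = (\<lambda>k. case k of IX0 \<Rightarrow> X0 | IXm1 \<Rightarrow> Xm1 | IXi n i \<Rightarrow> xi n i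
                       | IEta n j \<Rightarrow> eta n j | IEps n \<Rightarrow> eps n)"

definition gw_index :: "gw_idx set" where
  "gw_index = {IX0, IXm1} \<union> {IXi n i |n i. n \<ge> 1 \<and> i \<ge> 1}
             \<union> {IEta n j |n j. n \<ge> 1 \<and> j \<ge> 1} \<union> {IEps n |n. n \<ge> 1}"

text \<open>The information up to generation \<open>m\<close>: it determines X_m, which is
  \<open>gw_Y\<close> at \<open>m + 1\<close>. For \<open>m = 0\<close> only the two initial values
  remain.\<close>

definition gw_past :: "nat \<Rightarrow> gw_idx set" where
  "gw_past m = {IX0, IXm1} \<union> {IXi n i |n i. n \<ge> 1 \<and> n \<le> m \<and> i \<ge> 1}
             \<union> {IEta n j |n j. n \<ge> 1 \<and> n \<le> m \<and> j \<ge> 1} \<union> {IEps n |n. n \<ge> 1 \<and> n \<le> m}"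

text \<open>The process as a functional of the family of driving variables, so that independence of disjoint subfamilies applies.\<close>

definition gw_path :: "nat \<Rightarrow> (gw_idx \<Rightarrow> nat) \<Rightarrow> nat" where
  "gw_path = gw_Y (\<lambda>z. z IX0) (\<lambda>z. z IXm1) (\<lambda>n i z. z (IXi n i)) (\<lambda>n j z. z (IEta n j)) (\<lambda>n z. z (IEps n))"

lemma gw_past_subset: "gw_past m \<subseteq> gw_index"
  by (auto simp: gw_past_def gw_index_def)

lemma gw_past_mono: "m \<le> n \<Longrightarrow> gw_past m \<subseteq> gw_past n"
  by (auto simp: gw_past_def)

lemma measurable_add_nat:
  fixes f g :: "'b \<Rightarrow> nat"
  assumes "f \<in> measurable M (count_space UNIV)" "g \<in> measurable M (count_space UNIV)"
  shows "(\<lambda>x. f x + g x) \<in> measurable M (count_space UNIV)"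
  using measurable_sum_nat[of UNIV "\<lambda>b. if b then f else g" M] assms by (simp add: UNIV_bool add.commute)

text \<open>The shift reflects that \<open>gw_Y\<close> at \<open>k\<close> is X_{k-1}. Truncated
  subtraction gives \<open>gw_past 0\<close> for both initial values.\<close>

lemma gw_path_measurable:
  assumes "gw_past (k - 1) \<subseteq> J"
  shows "gw_path k \<in> measurable (Pi\<^sub>M J (\<lambda>_. count_space UNIV)) (count_space UNIV)"
  using assms
proof (induction k rule: induct_nat_012)
  case 0
  then show ?case unfolding gw_path_def gw_Y.simps
    by (intro measurable_component_singleton) (auto simp: gw_past_def)
next
  case 1
  then show ?case unfolding gw_path_def gw_Y.simps
    by (intro measurable_component_singleton) (auto simp: gw_past_def)
next
  case (ge2 n)
  have [measurable]: "gw_path n \<in> measurable (Pi\<^sub>M J (\<lambda>_. count_space UNIV)) (count_space UNIV)"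
    "gw_path (Suc n) \<in> measurable (Pi\<^sub>M J (\<lambda>_. count_space UNIV)) (count_space UNIV)"
    using ge2.prems gw_past_mono[OF le_SucI[OF diff_le_self[of n 1]]] gw_past_mono[of n "Suc n"]
    by (auto intro!: ge2.IH)
  have c: "(\<lambda>z. z i) \<in> measurable (Pi\<^sub>M J (\<lambda>_. count_space UNIV)) (count_space UNIV)" if "i \<in> gw_past (Suc n)" for i
    using that ge2.prems by (intro measurable_component_singleton) auto
  have m1: "(\<lambda>z. \<Sum>i\<in>{1..gw_path (Suc n) z}. z (IXi (Suc n) i)) \<in> measurable (Pi\<^sub>M J (\<lambda>_. count_space UNIV)) (count_space UNIV)"
    by (rule measurable_compose_countable[where g="gw_path (Suc n)"])
       (auto intro!: measurable_sum_nat c simp: gw_past_def)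
  have m2: "(\<lambda>z. \<Sum>j\<in>{1..gw_path n z}. z (IEta (Suc n) j)) \<in> measurable (Pi\<^sub>M J (\<lambda>_. count_space UNIV)) (count_space UNIV)"
    by (rule measurable_compose_countable[where g="gw_path n"])
       (auto intro!: measurable_sum_nat c simp: gw_past_def)
  have m3: "(\<lambda>z. z (IEps (Suc n))) \<in> measurable (Pi\<^sub>M J (\<lambda>_. count_space UNIV)) (count_space UNIV)"
    by (rule c) (auto simp: gw_past_def)
  have "gw_path (Suc (Suc n)) = (\<lambda>z. (\<Sum>i\<in>{1..gw_path (Suc n) z}. z (IXi (Suc n) i)) + (\<Sum>j\<in>{1..gw_path n z}. z (IEta (Suc n) j)) + z (IEps (Suc n)))"
    unfolding gw_path_def by simp
  then show ?case by (simp only: measurable_add_nat[OF measurable_add_nat[OF m1 m2] m3])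
qed

text \<open>The functional reads only coordinates in \<open>gw_past (k - 1)\<close>, so the
  undefined values outside \<open>J\<close> never matter.\<close>

lemma gw_path_restrict:
  assumes "gw_past (k - 1) \<subseteq> J"
  shows "gw_path k (\<lambda>i\<in>J. gw_family X0 Xm1 xi eta eps i \<omega>) = gw_Y X0 Xm1 xi eta eps k \<omega>"
  using assms
proof (induction k rule: induct_nat_012)
  case (ge2 n)
  let ?z = "\<lambda>i\<in>J. gw_family X0 Xm1 xi eta eps i \<omega>"
  have IH: "gw_path n ?z = gw_Y X0 Xm1 xi eta eps n \<omega>" "gw_path (Suc n) ?z = gw_Y X0 Xm1 xi eta eps (Suc n) \<omega>"
    using ge2.prems gw_past_mono[OF le_SucI[OF diff_le_self[of n 1]]] gw_past_mono[of n "Suc n"]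
    by (auto intro!: ge2.IH)
  have J: "IEps (Suc n) \<in> J" "\<And>i. i \<ge> 1 \<Longrightarrow> IXi (Suc n) i \<in> J" "\<And>i. i \<ge> 1 \<Longrightarrow> IEta (Suc n) i \<in> J"
    using ge2.prems by (auto simp: gw_past_def)
  have "gw_path (Suc (Suc n)) ?z = (\<Sum>i\<in>{1..gw_path (Suc n) ?z}. ?z (IXi (Suc n) i)) + (\<Sum>j\<in>{1..gw_path n ?z}. ?z (IEta (Suc n) j)) + ?z (IEps (Suc n))"
    unfolding gw_path_def by simp
  also have "(\<Sum>i\<in>{1..gw_path (Suc n) ?z}. ?z (IXi (Suc n) i)) = (\<Sum>i\<in>{1..gw_path (Suc n) ?z}. xi (Suc n) i \<omega>)"
    using J by (intro sum.cong) (auto simp: gw_family_def)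
  also have "(\<Sum>i\<in>{1..gw_path n ?z}. ?z (IEta (Suc n) i)) = (\<Sum>i\<in>{1..gw_path n ?z}. eta (Suc n) i \<omega>)"
    using J by (intro sum.cong) (auto simp: gw_family_def)
  also have "?z (IEps (Suc n)) = eps (Suc n) \<omega>" using J by (simp add: gw_family_def)
  finally show ?case unfolding IH by simp
qed (auto simp: gw_path_def gw_past_def gw_family_def)

section \<open>Random sums inside the process and its first moments\<close>

locale gw_process = prob_space M for M :: "'a measure" +
  fixes X0 Xm1 :: "'a \<Rightarrow> nat" and xi eta :: "nat \<Rightarrow> nat \<Rightarrow> 'a \<Rightarrow> nat" and eps :: "nat \<Rightarrow> 'a \<Rightarrow> nat"
  assumes indep: "indep_vars (\<lambda>_. count_space UNIV) (gw_family X0 Xm1 xi eta eps) gw_index"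
    and xi_id: "\<And>n i. n \<ge> 1 \<Longrightarrow> i \<ge> 1 \<Longrightarrow>
          distr M (count_space UNIV) (xi n i) = distr M (count_space UNIV) (xi 1 1)"
    and eta_id: "\<And>n j. n \<ge> 1 \<Longrightarrow> j \<ge> 1 \<Longrightarrow>
          distr M (count_space UNIV) (eta n j) = distr M (count_space UNIV) (eta 1 1)"
    and eps_id: "\<And>n. n \<ge> 1 \<Longrightarrow>
          distr M (count_space UNIV) (eps n) = distr M (count_space UNIV) (eps 1)"
    and int_X0: "integrable M (\<lambda>\<omega>. real (X0 \<omega>))"
    and int_Xm1: "integrable M (\<lambda>\<omega>. real (Xm1 \<omega>))"
    and int_xi: "integrable M (\<lambda>\<omega>. real (xi 1 1 \<omega>))"
    and int_eta: "integrable M (\<lambda>\<omega>. real (eta 1 1 \<omega>))"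
    and int_eps: "integrable M (\<lambda>\<omega>. real (eps 1 \<omega>))"
begin

abbreviation "Y \<equiv> gw_Y X0 Xm1 xi eta eps"
abbreviation "V \<equiv> gw_family X0 Xm1 xi eta eps"
abbreviation "mxi \<equiv> expectation (\<lambda>\<omega>. real (xi 1 1 \<omega>))"
abbreviation "meta \<equiv> expectation (\<lambda>\<omega>. real (eta 1 1 \<omega>))"
abbreviation "meps \<equiv> expectation (\<lambda>\<omega>. real (eps 1 \<omega>))"
abbreviation "EY k \<equiv> expectation (\<lambda>\<omega>. real (Y k \<omega>))"

lemma V_measurable: "k \<in> gw_index \<Longrightarrow> V k \<in> measurable M (count_space UNIV)"
  using indep by (auto simp: indep_vars_def2)

lemma X0_measurable [measurable]: "X0 \<in> measurable M (count_space UNIV)"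
  and Xm1_measurable [measurable]: "Xm1 \<in> measurable M (count_space UNIV)"
  using V_measurable[of IX0] V_measurable[of IXm1] by (auto simp: gw_index_def gw_family_def)

lemma xi_measurable: "n \<ge> 1 \<Longrightarrow> i \<ge> 1 \<Longrightarrow> xi n i \<in> measurable M (count_space UNIV)"
  using V_measurable[of "IXi n i"] by (auto simp: gw_index_def gw_family_def)

lemma eta_measurable: "n \<ge> 1 \<Longrightarrow> i \<ge> 1 \<Longrightarrow> eta n i \<in> measurable M (count_space UNIV)"
  using V_measurable[of "IEta n i"] by (auto simp: gw_index_def gw_family_def)

lemma eps_measurable: "n \<ge> 1 \<Longrightarrow> eps n \<in> measurable M (count_space UNIV)"
  using V_measurable[of "IEps n"] by (auto simp: gw_index_def gw_family_def)

lemma Y_measurable [measurable]: "Y k \<in> measurable M (count_space UNIV)"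
proof -
  have "(\<lambda>\<omega>. gw_path k (\<lambda>i\<in>gw_index. V i \<omega>)) \<in> measurable M (count_space UNIV)"
    by (rule measurable_compose[OF _ gw_path_measurable[OF gw_past_subset]]) (intro measurable_restrict V_measurable)
  then show ?thesis unfolding gw_path_restrict[OF gw_past_subset] .
qed

lemma distr_real_cong:
  fixes X Z :: "'a \<Rightarrow> nat" and g :: "nat \<Rightarrow> real"
  assumes "distr M (count_space UNIV) X = distr M (count_space UNIV) Z"
    and [measurable]: "X \<in> measurable M (count_space UNIV)" "Z \<in> measurable M (count_space UNIV)"
  shows "distr M borel (\<lambda>\<omega>. g (X \<omega>)) = distr M borel (\<lambda>\<omega>. g (Z \<omega>))"
proof -
  have "distr M borel (\<lambda>\<omega>. g (X \<omega>)) = distr (distr M (count_space UNIV) X) borel g"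
    by (subst distr_distr) (auto simp: comp_def)
  also have "\<dots> = distr M borel (\<lambda>\<omega>. g (Z \<omega>))"
    unfolding assms(1) by (subst distr_distr) (auto simp: comp_def)
  finally show ?thesis .
qed

text \<open>Reduces independence of the summands from the pair \<open>(N, R)\<close> to disjointness
  of index sets: the pair is a function of the variables in \<open>J\<close>, the summands sit at
  the indices \<open>idx i\<close>. \<open>N\<close> and \<open>R\<close> may share
  variables.\<close>

lemma random_sumI:
  fixes idx :: "nat \<Rightarrow> gw_idx" and f :: "(gw_idx \<Rightarrow> nat) \<Rightarrow> nat \<times> real" and a :: real
  assumes inj: "inj_on idx {1..}" and K: "idx ` {1..} \<subseteq> gw_index" and J: "J \<subseteq> gw_index" "J \<inter> idx ` {1..} = {}"
    and id: "\<And>i. i \<ge> 1 \<Longrightarrow> distr M (count_space UNIV) (V (idx i)) = distr M (count_space UNIV) (V (idx 1))"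
    and int: "integrable M (\<lambda>\<omega>. real (V (idx 1) \<omega>))" and a: "a \<ge> 0"
    and f: "f \<in> measurable (Pi\<^sub>M J (\<lambda>_. count_space UNIV)) (count_space UNIV \<Otimes>\<^sub>M borel)"
    and NR: "\<And>\<omega>. f (\<lambda>i\<in>J. V i \<omega>) = (N \<omega>, R \<omega>)"
    and R: "\<And>\<omega>. 0 \<le> R \<omega>" and int_N: "integrable M (\<lambda>\<omega>. real (N \<omega>))"
  shows "random_sum M (\<lambda>i \<omega>. a * real (V (idx i) \<omega>)) N R"
proof
  have Vm [measurable]: "V (idx i) \<in> measurable M (count_space UNIV)" if "i \<ge> 1" for i
    using K that by (intro V_measurable) auto
  have "indep_vars (\<lambda>_. count_space UNIV) (\<lambda>i. V (idx i)) {1..}"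
    using indep_vars_reindex[OF inj indep_vars_subset[OF indep K]] by (simp add: comp_def)
  then show "indep_vars (\<lambda>_. borel) (\<lambda>i \<omega>. a * real (V (idx i) \<omega>)) {1..}"
    by (rule indep_vars_compose2[where Y="\<lambda>_ x. a * real x"]) auto
  show "distr M borel (\<lambda>\<omega>. a * real (V (idx i) \<omega>)) = distr M borel (\<lambda>\<omega>. a * real (V (idx 1) \<omega>))" if "i \<ge> 1" for i
    using that by (intro distr_real_cong[where g="\<lambda>x. a * real x"] id Vm) auto
  show "0 \<le> a * real (V (idx i) \<omega>)" for i \<omega> using a by simp
  show "integrable M (\<lambda>\<omega>. a * real (V (idx 1) \<omega>))" using int by simp
  show "0 \<le> R \<omega>" for \<omega> by (rule R)
  show "integrable M (\<lambda>\<omega>. real (N \<omega>))" by (rule int_N)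
  have "(\<lambda>\<omega>. f (\<lambda>i\<in>J. V i \<omega>)) \<in> measurable M (count_space UNIV \<Otimes>\<^sub>M borel)"
    using J by (intro measurable_compose[OF _ f] measurable_restrict V_measurable) auto
  then have NRm: "(\<lambda>\<omega>. (N \<omega>, R \<omega>)) \<in> measurable M (count_space UNIV \<Otimes>\<^sub>M borel)" by (simp add: NR)
  show "N \<in> measurable M (count_space UNIV)" using measurable_compose[OF NRm measurable_fst] by simp
  show "R \<in> borel_measurable M" using measurable_compose[OF NRm measurable_snd] by simp
  fix P :: "nat \<times> real \<Rightarrow> bool" and Q :: "(nat \<Rightarrow> real) \<Rightarrow> bool"
  assume P: "Measurable.pred (count_space UNIV \<Otimes>\<^sub>M borel) P" and Q: "Measurable.pred (Pi\<^sub>M {1..} (\<lambda>_. borel)) Q"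
  \<comment> \<open>Recovers the scaled summands from their block of driving variables, so that
    \<open>Q\<close> becomes an event of that block.\<close>
  define h where "h z = (\<lambda>i\<in>{1..}. a * real (z (idx i) :: nat))" for z
  have h: "h \<in> measurable (Pi\<^sub>M (idx ` {1..}) (\<lambda>_. count_space UNIV)) (Pi\<^sub>M {1..} (\<lambda>_. borel))"
    unfolding h_def
  proof (rule measurable_restrict)
    fix i :: nat assume "i \<in> {1..}"
    then have "(\<lambda>z. z (idx i)) \<in> measurable (Pi\<^sub>M (idx ` {1..}) (\<lambda>_. count_space UNIV)) (count_space UNIV :: nat measure)"
      by (intro measurable_component_singleton) auto
    from measurable_compose[OF this, of "\<lambda>x. a * real x" borel]
    show "(\<lambda>z. a * real (z (idx i) :: nat)) \<in> measurable (Pi\<^sub>M (idx ` {1..}) (\<lambda>_. count_space UNIV)) borel" by simp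
  qed
  have hV: "h (\<lambda>i\<in>idx ` {1..}. V i \<omega>) = (\<lambda>i\<in>{1..}. a * real (V (idx i) \<omega>))" for \<omega>
    by (auto simp: h_def fun_eq_iff restrict_def)
  have "prob {\<omega> \<in> space M. P (f (\<lambda>i\<in>J. V i \<omega>)) \<and> Q (h (\<lambda>i\<in>idx ` {1..}. V i \<omega>))} =
     prob {\<omega> \<in> space M. P (f (\<lambda>i\<in>J. V i \<omega>))} * prob {\<omega> \<in> space M. Q (h (\<lambda>i\<in>idx ` {1..}. V i \<omega>))}"
    by (rule prob_restrict_indep[OF indep J(2,1) K measurable_compose[OF f P] measurable_compose[OF h Q]])
  then show "prob {\<omega> \<in> space M. P (N \<omega>, R \<omega>) \<and> Q (\<lambda>i\<in>{1..}. a * real (V (idx i) \<omega>))} =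
     prob {\<omega> \<in> space M. P (N \<omega>, R \<omega>)} * prob {\<omega> \<in> space M. Q (\<lambda>i\<in>{1..}. a * real (V (idx i) \<omega>))}"
    unfolding NR hV .
qed

lemma ident_moments:
  fixes X Z :: "'a \<Rightarrow> nat" and g :: "nat \<Rightarrow> real"
  assumes "distr M (count_space UNIV) X = distr M (count_space UNIV) Z"
    and [measurable]: "X \<in> measurable M (count_space UNIV)" "Z \<in> measurable M (count_space UNIV)"
  shows "integrable M (\<lambda>\<omega>. g (X \<omega>)) \<longleftrightarrow> integrable M (\<lambda>\<omega>. g (Z \<omega>))"
    and "expectation (\<lambda>\<omega>. g (X \<omega>)) = expectation (\<lambda>\<omega>. g (Z \<omega>))"
    and "tail M (\<lambda>\<omega>. g (X \<omega>)) = tail M (\<lambda>\<omega>. g (Z \<omega>))"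
proof -
  have d: "distr M borel (\<lambda>\<omega>. g (X \<omega>)) = distr M borel (\<lambda>\<omega>. g (Z \<omega>))"
    by (rule distr_real_cong[OF assms])
  have i: "integrable M (\<lambda>\<omega>. g (W \<omega>)) \<longleftrightarrow> integrable (distr M borel (\<lambda>\<omega>. g (W \<omega>))) (\<lambda>x. x)"
    if "W \<in> measurable M (count_space UNIV)" for W
    using that by (subst integrable_distr_eq) auto
  show "integrable M (\<lambda>\<omega>. g (X \<omega>)) \<longleftrightarrow> integrable M (\<lambda>\<omega>. g (Z \<omega>))"
    unfolding i[OF assms(2)] i[OF assms(3)] d ..
  have e: "expectation (\<lambda>\<omega>. g (W \<omega>)) = (\<integral>x. x \<partial>distr M borel (\<lambda>\<omega>. g (W \<omega>)))"
    if "W \<in> measurable M (count_space UNIV)" for W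
    using that by (subst integral_distr) auto
  show "expectation (\<lambda>\<omega>. g (X \<omega>)) = expectation (\<lambda>\<omega>. g (Z \<omega>))"
    unfolding e[OF assms(2)] e[OF assms(3)] d ..
  have t: "tail M (\<lambda>\<omega>. g (W \<omega>)) x = measure (distr M borel (\<lambda>\<omega>. g (W \<omega>))) {x<..}"
    if "W \<in> measurable M (count_space UNIV)" for W x
    using that by (subst measure_distr) (auto simp: tail_def intro!: arg_cong[where f=prob])
  show "tail M (\<lambda>\<omega>. g (X \<omega>)) = tail M (\<lambda>\<omega>. g (Z \<omega>))"
    unfolding t[OF assms(2)] t[OF assms(3)] d ..
qed

lemma xi_ident:
  assumes "n \<ge> 1" "i \<ge> 1"
  shows "integrable M (\<lambda>\<omega>. real (xi n i \<omega>))" "expectation (\<lambda>\<omega>. a * real (xi n i \<omega>)) = a * mxi"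
    "tail M (\<lambda>\<omega>. a * real (xi n i \<omega>)) = tail M (\<lambda>\<omega>. a * real (xi 1 1 \<omega>))"
  using ident_moments[OF xi_id[OF assms] xi_measurable[OF assms] xi_measurable, of "\<lambda>x. real x"]
    ident_moments[OF xi_id[OF assms] xi_measurable[OF assms] xi_measurable, of "\<lambda>x. a * real x"] int_xi by auto

lemma eta_ident:
  assumes "n \<ge> 1" "i \<ge> 1"
  shows "integrable M (\<lambda>\<omega>. real (eta n i \<omega>))" "expectation (\<lambda>\<omega>. a * real (eta n i \<omega>)) = a * meta"
    "tail M (\<lambda>\<omega>. a * real (eta n i \<omega>)) = tail M (\<lambda>\<omega>. a * real (eta 1 1 \<omega>))"
  using ident_moments[OF eta_id[OF assms] eta_measurable[OF assms] eta_measurable, of "\<lambda>x. real x"]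
    ident_moments[OF eta_id[OF assms] eta_measurable[OF assms] eta_measurable, of "\<lambda>x. a * real x"] int_eta by auto

lemma eps_ident:
  assumes "n \<ge> 1"
  shows "integrable M (\<lambda>\<omega>. real (eps n \<omega>))" "expectation (\<lambda>\<omega>. real (eps n \<omega>)) = meps"
    "integrable M (\<lambda>\<omega>. (a * real (eps n \<omega>)) powr r) \<longleftrightarrow> integrable M (\<lambda>\<omega>. (a * real (eps 1 \<omega>)) powr r)"
  using ident_moments[OF eps_id[OF assms] eps_measurable[OF assms] eps_measurable, of "\<lambda>x. real x"]
    ident_moments(1)[OF eps_id[OF assms] eps_measurable[OF assms] eps_measurable, of "\<lambda>x. (a * real x) powr r"] int_eps by auto

text \<open>The offspring in generation \<open>n + 1\<close> are new, whereas both counts belong to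
  \<open>gw_past n\<close>. The remainder holds \<open>Y (Suc n)\<close>, which in general depends
  on the count \<open>Y n\<close>; the multiple \<open>c\<close> stands for the xi-sum not yet
  restored.\<close>

lemma eta_random_sum:
  assumes "a \<ge> 0" "c \<ge> 0" "integrable M (\<lambda>\<omega>. real (Y n \<omega>))"
  shows "random_sum M (\<lambda>i \<omega>. a * real (eta (Suc n) i \<omega>)) (Y n)
     (\<lambda>\<omega>. c * real (Y (Suc n) \<omega>) + a * real (eps (Suc n) \<omega>))"
proof -
  let ?J = "insert (IEps (Suc n)) (gw_past n)"
  let ?P = "Pi\<^sub>M ?J (\<lambda>_. count_space UNIV) :: (gw_idx \<Rightarrow> nat) measure"
  let ?f = "\<lambda>z. (gw_path n z, c * real (gw_path (Suc n) z) + a * real (z (IEps (Suc n))))"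
  have sub: "gw_past (n - 1) \<subseteq> ?J" "gw_past (Suc n - 1) \<subseteq> ?J"
    using gw_past_mono[of "n - 1" n] by auto
  note [measurable] = gw_path_measurable[OF sub(1)] gw_path_measurable[OF sub(2)]
  have [measurable]: "(\<lambda>z. z (IEps (Suc n))) \<in> measurable ?P (count_space UNIV)"
    by (intro measurable_component_singleton) auto
  have "random_sum M (\<lambda>i \<omega>. a * real (V (IEta (Suc n) i) \<omega>)) (Y n)
     (\<lambda>\<omega>. c * real (Y (Suc n) \<omega>) + a * real (eps (Suc n) \<omega>))"
  proof (rule random_sumI[of "IEta (Suc n)" ?J a ?f])
    show "?f \<in> measurable ?P (count_space UNIV \<Otimes>\<^sub>M borel)" by measurable
    show "?f (\<lambda>i\<in>?J. V i \<omega>) = (Y n \<omega>, c * real (Y (Suc n) \<omega>) + a * real (eps (Suc n) \<omega>))" for \<omega>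
      unfolding gw_path_restrict[OF sub(1)] gw_path_restrict[OF sub(2)] by (simp add: gw_family_def)
    show "distr M (count_space UNIV) (V (IEta (Suc n) i)) = distr M (count_space UNIV) (V (IEta (Suc n) 1))" if "i \<ge> 1" for i
      using eta_id[of "Suc n" i] eta_id[of "Suc n" 1] that by (simp add: gw_family_def)
    show "?J \<subseteq> gw_index" using gw_past_subset[of n] by (auto simp: gw_index_def)
    show "integrable M (\<lambda>\<omega>. real (V (IEta (Suc n) 1) \<omega>))"
      using eta_ident(1)[of "Suc n" 1] by (simp add: gw_family_def)
  qed (use assms in \<open>auto simp: gw_index_def gw_past_def inj_on_def\<close>)
  then show ?thesis by (simp add: gw_family_def)
qed

text \<open>Here the remainder already holds the actual eta-sum, so \<open>J\<close> also takes in
  the eta variables of generation \<open>n + 1\<close>. The remainder contains a multiple of the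
  count itself.\<close>

lemma xi_random_sum:
  assumes "a \<ge> 0" "b \<ge> 0" "integrable M (\<lambda>\<omega>. real (Y (Suc n) \<omega>))"
  shows "random_sum M (\<lambda>i \<omega>. a * real (xi (Suc n) i \<omega>)) (Y (Suc n))
     (\<lambda>\<omega>. b * real (Y (Suc n) \<omega>) + (\<Sum>j\<in>{1..Y n \<omega>}. a * real (eta (Suc n) j \<omega>)) + a * real (eps (Suc n) \<omega>))"
proof -
  let ?J = "insert (IEps (Suc n)) (gw_past n \<union> IEta (Suc n) ` {1..})"
  let ?P = "Pi\<^sub>M ?J (\<lambda>_. count_space UNIV) :: (gw_idx \<Rightarrow> nat) measure"
  let ?f = "\<lambda>z. (gw_path (Suc n) z, b * real (gw_path (Suc n) z) + (\<Sum>j\<in>{1..gw_path n z}. a * real (z (IEta (Suc n) j))) + a * real (z (IEps (Suc n))))"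
  have sub: "gw_past (n - 1) \<subseteq> ?J" "gw_past (Suc n - 1) \<subseteq> ?J"
    using gw_past_mono[of "n - 1" n] by auto
  note [measurable] = gw_path_measurable[OF sub(1)] gw_path_measurable[OF sub(2)]
  have [measurable]: "(\<lambda>z. z (IEps (Suc n))) \<in> measurable ?P (count_space UNIV)"
    by (intro measurable_component_singleton) auto
  have eta: "(\<lambda>z. a * real (z (IEta (Suc n) j))) \<in> borel_measurable ?P" if "j \<ge> 1" for j
  proof -
    have [measurable]: "(\<lambda>z. z (IEta (Suc n) j)) \<in> measurable ?P (count_space UNIV)"
      using that by (intro measurable_component_singleton) auto
    show ?thesis by measurable
  qed
  have [measurable]: "(\<lambda>z. \<Sum>j\<in>{1..gw_path n z}. a * real (z (IEta (Suc n) j))) \<in> borel_measurable ?P"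
  proof (rule measurable_compose_countable[where g="gw_path n"])
    fix k :: nat show "(\<lambda>z. \<Sum>j\<in>{1..k}. a * real (z (IEta (Suc n) j))) \<in> borel_measurable ?P"
      by (intro borel_measurable_sum eta) auto
  qed measurable
  have "random_sum M (\<lambda>i \<omega>. a * real (V (IXi (Suc n) i) \<omega>)) (Y (Suc n))
     (\<lambda>\<omega>. b * real (Y (Suc n) \<omega>) + (\<Sum>j\<in>{1..Y n \<omega>}. a * real (eta (Suc n) j \<omega>)) + a * real (eps (Suc n) \<omega>))"
  proof (rule random_sumI[of "IXi (Suc n)" ?J a ?f])
    show "?f \<in> measurable ?P (count_space UNIV \<Otimes>\<^sub>M borel)" by measurable
    show "?f (\<lambda>i\<in>?J. V i \<omega>) = (Y (Suc n) \<omega>, b * real (Y (Suc n) \<omega>) + (\<Sum>j\<in>{1..Y n \<omega>}. a * real (eta (Suc n) j \<omega>)) + a * real (eps (Suc n) \<omega>))" for \<omega>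
      unfolding gw_path_restrict[OF sub(1)] gw_path_restrict[OF sub(2)]
      by (auto simp: gw_family_def intro!: sum.cong)
    show "distr M (count_space UNIV) (V (IXi (Suc n) i)) = distr M (count_space UNIV) (V (IXi (Suc n) 1))" if "i \<ge> 1" for i
      using xi_id[of "Suc n" i] xi_id[of "Suc n" 1] that by (simp add: gw_family_def)
    show "?J \<subseteq> gw_index" using gw_past_subset[of n] by (auto simp: gw_index_def)
    show "integrable M (\<lambda>\<omega>. real (V (IXi (Suc n) 1) \<omega>))"
      using xi_ident(1)[of "Suc n" 1] by (simp add: gw_family_def)
    show "0 \<le> b * real (Y (Suc n) \<omega>) + (\<Sum>j\<in>{1..Y n \<omega>}. a * real (eta (Suc n) j \<omega>)) + a * real (eps (Suc n) \<omega>)" for \<omega>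
      using assms by (intro add_nonneg_nonneg sum_nonneg) auto
  qed (use assms in \<open>auto simp: gw_index_def gw_past_def inj_on_def\<close>)
  then show ?thesis by (simp add: gw_family_def)
qed

lemma random_sum_wald:
  fixes Z :: "nat \<Rightarrow> 'a \<Rightarrow> nat"
  assumes rs: "random_sum M (\<lambda>i \<omega>. 1 * real (Z i \<omega>)) N R"
    and Zm: "\<And>i. i \<ge> 1 \<Longrightarrow> Z i \<in> measurable M (count_space UNIV)"
  shows "integrable M (\<lambda>\<omega>. real (\<Sum>i\<in>{1..N \<omega>}. Z i \<omega>))"
    and "expectation (\<lambda>\<omega>. real (\<Sum>i\<in>{1..N \<omega>}. Z i \<omega>)) =
      expectation (\<lambda>\<omega>. real (N \<omega>)) * expectation (\<lambda>\<omega>. real (Z 1 \<omega>))"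
proof -
  interpret rs: random_sum M "\<lambda>i \<omega>. 1 * real (Z i \<omega>)" N R by (rule rs)
  have ind: "prob {\<omega> \<in> space M. i \<le> N \<omega> \<and> t < Z i \<omega>} =
        prob {\<omega> \<in> space M. i \<le> N \<omega>} * prob {\<omega> \<in> space M. t < Z 1 \<omega>}" if "i \<ge> 1" for i t
    using rs.prob_indep_A[of "\<lambda>z. i \<le> fst z" i "real t"] that by (simp add: tail_def)
  show "integrable M (\<lambda>\<omega>. real (\<Sum>i\<in>{1..N \<omega>}. Z i \<omega>))"
    by (rule wald_nat(1)[OF rs.N_measurable Zm ind rs.int_N]) (use rs.int_A in auto)
  show "expectation (\<lambda>\<omega>. real (\<Sum>i\<in>{1..N \<omega>}. Z i \<omega>)) =
      expectation (\<lambda>\<omega>. real (N \<omega>)) * expectation (\<lambda>\<omega>. real (Z 1 \<omega>))"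
    by (rule wald_nat(2)[OF rs.N_measurable Zm ind rs.int_N]) (use rs.int_A in auto)
qed

lemma Y_moments_step:
  assumes "integrable M (\<lambda>\<omega>. real (Y n \<omega>))" "integrable M (\<lambda>\<omega>. real (Y (Suc n) \<omega>))"
  shows "integrable M (\<lambda>\<omega>. real (Y (Suc (Suc n)) \<omega>))"
    and "EY (Suc (Suc n)) = mxi * EY (Suc n) + meta * EY n + meps"
proof -
  note x = random_sum_wald[OF xi_random_sum[of 1 0, OF _ _ assms(2)] xi_measurable]
  note e = random_sum_wald[OF eta_random_sum[of 1 0, OF _ _ assms(1)] eta_measurable]
  have x: "integrable M (\<lambda>\<omega>. real (\<Sum>i\<in>{1..Y (Suc n) \<omega>}. xi (Suc n) i \<omega>))"
    "expectation (\<lambda>\<omega>. real (\<Sum>i\<in>{1..Y (Suc n) \<omega>}. xi (Suc n) i \<omega>)) = EY (Suc n) * mxi"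
    using x xi_ident(2)[of "Suc n" 1 1] by auto
  have e: "integrable M (\<lambda>\<omega>. real (\<Sum>i\<in>{1..Y n \<omega>}. eta (Suc n) i \<omega>))"
    "expectation (\<lambda>\<omega>. real (\<Sum>i\<in>{1..Y n \<omega>}. eta (Suc n) i \<omega>)) = EY n * meta"
    using e eta_ident(2)[of "Suc n" 1 1] by auto
  have eq: "real (Y (Suc (Suc n)) \<omega>) = real (\<Sum>i\<in>{1..Y (Suc n) \<omega>}. xi (Suc n) i \<omega>) +
     real (\<Sum>i\<in>{1..Y n \<omega>}. eta (Suc n) i \<omega>) + real (eps (Suc n) \<omega>)" for \<omega>
    by simp
  note p = eps_ident[of "Suc n"]
  show "integrable M (\<lambda>\<omega>. real (Y (Suc (Suc n)) \<omega>))"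
    unfolding eq by (intro Bochner_Integration.integrable_add x e p) auto
  show "EY (Suc (Suc n)) = mxi * EY (Suc n) + meta * EY n + meps"
    unfolding eq using x e p by (subst Bochner_Integration.integral_add; (subst Bochner_Integration.integral_add)?) (auto simp del: of_nat_sum)
qed

lemma Y_integrable: "integrable M (\<lambda>\<omega>. real (Y k \<omega>))"
  by (induction k rule: induct_nat_012) (use int_X0 int_Xm1 in \<open>auto intro!: Y_moments_step(1) simp del: gw_Y.simps(3)\<close>)

lemma EY_Suc_Suc: "EY (Suc (Suc n)) = mxi * EY (Suc n) + meta * EY n + meps"
  by (rule Y_moments_step(2)[OF Y_integrable Y_integrable])

end

section \<open>Induction over the generations\<close>

locale gw_process_rv = gw_process M X0 Xm1 xi eta eps
  for M :: "'a measure" and X0 Xm1 xi eta eps +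
  fixes \<alpha> r :: real
  assumes alpha: "\<alpha> \<ge> 1"
    and rv_X0: "rv_tail \<alpha> (tail M (\<lambda>\<omega>. real (X0 \<omega>)))"
    and rv_Xm1: "rv_tail \<alpha> (tail M (\<lambda>\<omega>. real (Xm1 \<omega>)))"
    and rv_xi: "rv_tail \<alpha> (tail M (\<lambda>\<omega>. real (xi 1 1 \<omega>)))"
    and rv_eta: "rv_tail \<alpha> (tail M (\<lambda>\<omega>. real (eta 1 1 \<omega>)))"
    and pos_xi: "mxi > 0" and pos_eta: "meta > 0"
    and O1: "tail M (\<lambda>\<omega>. real (xi 1 1 \<omega>)) \<in> O[at_top](tail M (\<lambda>\<omega>. real (X0 \<omega>)))"
    and O2: "tail M (\<lambda>\<omega>. real (xi 1 1 \<omega>)) \<in> O[at_top](tail M (\<lambda>\<omega>. real (Xm1 \<omega>)))"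
    and O3: "tail M (\<lambda>\<omega>. real (eta 1 1 \<omega>)) \<in> O[at_top](tail M (\<lambda>\<omega>. real (X0 \<omega>)))"
    and O4: "tail M (\<lambda>\<omega>. real (eta 1 1 \<omega>)) \<in> O[at_top](tail M (\<lambda>\<omega>. real (Xm1 \<omega>)))"
    and r: "r > \<alpha>"
    and eps_mom: "integrable M (\<lambda>\<omega>. real (eps 1 \<omega>) powr r)"
begin

abbreviation "F0 \<equiv> tail M (\<lambda>\<omega>. real (X0 \<omega>))"
abbreviation "Fm1 \<equiv> tail M (\<lambda>\<omega>. real (Xm1 \<omega>))"
abbreviation "Fxi \<equiv> tail M (\<lambda>\<omega>. real (xi 1 1 \<omega>))"
abbreviation "Feta \<equiv> tail M (\<lambda>\<omega>. real (eta 1 1 \<omega>))"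

text \<open>The asymptotic tail of \<open>a * Y (n + 1) + b * Y n\<close>.\<close>

primrec lim_tail :: "nat \<Rightarrow> real \<Rightarrow> real \<Rightarrow> real \<Rightarrow> real" where
  "lim_tail 0 a b x = a powr \<alpha> * F0 x + b powr \<alpha> * Fm1 x"
| "lim_tail (Suc n) a b x = lim_tail n (a * mxi + b) (a * meta) x +
     a powr \<alpha> * (EY (Suc n) * Fxi x + EY n * Feta x)"

text \<open>In the base case either coefficient may vanish, so offspring tails are compared with
  both initial tails. Afterwards only nonnegative terms are added, which preserves the comparison;
  positivity of \<open>meta\<close> keeps the new coefficients from both vanishing.\<close>

lemma lim_tail_props:
  assumes "a \<ge> 0" "b \<ge> 0" "a + b > 0"
  shows "rv_tail \<alpha> (lim_tail n a b) \<and> Fxi \<in> O[at_top](lim_tail n a b) \<and> Feta \<in> O[at_top](lim_tail n a b)"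
  using assms
proof (induction n arbitrary: a b)
  case 0
  have eq: "lim_tail 0 a b = (\<lambda>x. a powr \<alpha> * F0 x + b powr \<alpha> * Fm1 x)" by auto
  have big: "f \<in> O[at_top](lim_tail 0 a b)" if f: "f \<in> O[at_top](F0)" "f \<in> O[at_top](Fm1)" for f
  proof (cases "a > 0")
    case True
    have "f \<in> O[at_top](\<lambda>x. a powr \<alpha> * F0 x)" using f True by simp
    also have "(\<lambda>x. a powr \<alpha> * F0 x) \<in> O[at_top](lim_tail 0 a b)"
      by (intro landau_o.big_mono always_eventually) (auto simp: tail_nonneg)
    finally show ?thesis .
  next
    case False
    then have b: "b > 0" using 0 by simp
    have "f \<in> O[at_top](\<lambda>x. b powr \<alpha> * Fm1 x)" using f b by simp
    also have "(\<lambda>x. b powr \<alpha> * Fm1 x) \<in> O[at_top](lim_tail 0 a b)"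
      by (intro landau_o.big_mono always_eventually) (auto simp: tail_nonneg)
    finally show ?thesis .
  qed
  have "rv_tail \<alpha> (lim_tail 0 a b)"
  proof (cases "a > 0")
    case True
    then show ?thesis unfolding eq by (intro rv_tail_add_nonneg rv_tail_cmult rv_X0 rv_Xm1) auto
  next
    case False
    then have "b > 0" "a = 0" using 0 by auto
    then show ?thesis unfolding eq using rv_tail_cmult[OF rv_Xm1, of "b powr \<alpha>"] by simp
  qed
  then show ?case using big O1 O2 O3 O4 by blast
next
  case (Suc n)
  let ?L = "lim_tail n (a * mxi + b) (a * meta)"
  have ab: "a * mxi + b \<ge> 0" "a * meta \<ge> 0" using Suc.prems pos_xi pos_eta by auto
  have "a * mxi + b + a * meta > 0"
  proof (cases "a > 0")
    case True then show ?thesis using ab Suc.prems pos_eta by (intro add_nonneg_pos) auto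
  qed (use Suc.prems in auto)
  note IH = Suc.IH[OF ab this]
  have eq: "lim_tail (Suc n) a b = (\<lambda>x. (?L x + (a powr \<alpha> * EY (Suc n)) * Fxi x) + (a powr \<alpha> * EY n) * Feta x)"
    by (simp add: fun_eq_iff algebra_simps)
  have "rv_tail \<alpha> (lim_tail (Suc n) a b)"
    unfolding eq using IH by (intro rv_tail_add_nonneg rv_xi rv_eta) auto
  moreover have "?L \<in> O[at_top](lim_tail (Suc n) a b)"
  proof (intro landau_o.big_mono always_eventually allI)
    fix x
    have "?L x > 0" using IH rv_tail_pos by blast
    moreover have "0 \<le> a powr \<alpha> * (EY (Suc n) * Fxi x + EY n * Feta x)"
      by (intro mult_nonneg_nonneg add_nonneg_nonneg) (auto simp: tail_nonneg)
    ultimately show "norm (?L x) \<le> norm (lim_tail (Suc n) a b x)" by simp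
  qed
  ultimately show ?case using IH landau_o.big_trans by blast
qed

text \<open>Runs from the linear form back to the process: immigration, the eta-sum and the xi-sum
  are restored in this order, and at each stage the tail just obtained is the \<open>H\<close> of
  the next. With \<open>a > 0\<close> the scaled summands have positive mean.\<close>

lemma tail_step:
  assumes a: "a > 0" and b: "b \<ge> 0"
    and IH: "tail M (\<lambda>\<omega>. (a * mxi + b) * real (Y (Suc n) \<omega>) + (a * meta) * real (Y n \<omega>)) \<sim>[at_top] lim_tail n (a * mxi + b) (a * meta)"
  shows "tail M (\<lambda>\<omega>. a * real (Y (Suc (Suc n)) \<omega>) + b * real (Y (Suc n) \<omega>)) \<sim>[at_top] lim_tail (Suc n) a b"
proof -
  let ?c1 = "a * mxi + b" and ?c2 = "a * meta"
  let ?L = "lim_tail n ?c1 ?c2"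
  have c: "?c1 > 0" "?c2 > 0" using a b pos_xi pos_eta by (auto intro!: add_pos_nonneg)
  have L: "rv_tail \<alpha> ?L" "Fxi \<in> O[at_top](?L)" "Feta \<in> O[at_top](?L)"
    using lim_tail_props[of ?c1 ?c2 n] c by auto
  have Ln: "0 \<le> ?L x" for x using rv_tail_pos[OF L(1), of x] by simp
  have [measurable]: "eps (Suc n) \<in> measurable M (count_space UNIV)" "xi 1 1 \<in> measurable M (count_space UNIV)"
    "eta 1 1 \<in> measurable M (count_space UNIV)"
    by (intro eps_measurable xi_measurable eta_measurable; simp)+
  define H0 where "H0 = (\<lambda>\<omega>. ?c1 * real (Y (Suc n) \<omega>) + ?c2 * real (Y n \<omega>))"
  have H0m [measurable]: "H0 \<in> borel_measurable M" unfolding H0_def by measurable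
  have H0: "tail M H0 \<sim>[at_top] ?L" "rv_tail \<alpha> (tail M H0)"
    using IH rv_tail_tail_asymp[OF H0m _ L(1)] by (auto simp: H0_def)
  \<comment> \<open>Immigration comes before the sums, while the comparison tail is still that of
    the linear form.\<close>
  have eps_o: "tail M (\<lambda>\<omega>. a * real (eps (Suc n) \<omega>)) \<in> o[at_top](tail M H0)"
  proof (rule tail_moment_smallo[OF _ _ _ H0(2) r])
    have "(\<lambda>\<omega>. (a * real (eps 1 \<omega>)) powr r) = (\<lambda>\<omega>. a powr r * real (eps 1 \<omega>) powr r)"
      using a by (simp add: powr_mult)
    then show "integrable M (\<lambda>\<omega>. (a * real (eps (Suc n) \<omega>)) powr r)"
      using eps_mom by (subst eps_ident(3)) auto
  qed (use a alpha r in auto)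
  have H1: "tail M (\<lambda>\<omega>. H0 \<omega> + a * real (eps (Suc n) \<omega>)) \<sim>[at_top] ?L"
    using tail_add_light[OF H0m _ _ H0(2) eps_o] a H0(1) by (auto intro: asymp_equiv_trans)
  then have H1rv: "rv_tail \<alpha> (tail M (\<lambda>\<omega>. H0 \<omega> + a * real (eps (Suc n) \<omega>)))"
    by (rule rv_tail_tail_asymp[OF _ _ L(1), rotated]) measurable
  have Fs: "rv_tail \<alpha> (tail M (\<lambda>\<omega>. a * real (xi 1 1 \<omega>)))" "rv_tail \<alpha> (tail M (\<lambda>\<omega>. a * real (eta 1 1 \<omega>)))"
    "tail M (\<lambda>\<omega>. a * real (xi 1 1 \<omega>)) \<sim>[at_top] (\<lambda>x. a powr \<alpha> * Fxi x)"
    "tail M (\<lambda>\<omega>. a * real (eta 1 1 \<omega>)) \<sim>[at_top] (\<lambda>x. a powr \<alpha> * Feta x)"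
    by (intro rv_tail_tail_cmult rv_xi rv_eta a)+
  have OL: "tail M (\<lambda>\<omega>. a * real (xi 1 1 \<omega>)) \<in> O[at_top](?L)" "tail M (\<lambda>\<omega>. a * real (eta 1 1 \<omega>)) \<in> O[at_top](?L)"
    using landau_o.big_trans[OF asymp_equiv_imp_bigo[OF Fs(3)], of ?L] landau_o.big_trans[OF asymp_equiv_imp_bigo[OF Fs(4)], of ?L]
      L a by auto

  define R2 where "R2 = (\<lambda>\<omega>. ?c1 * real (Y (Suc n) \<omega>) + a * real (eps (Suc n) \<omega>))"
  interpret e: random_sum M "\<lambda>i \<omega>. a * real (eta (Suc n) i \<omega>)" "Y n" R2
    unfolding R2_def using a c by (intro eta_random_sum Y_integrable) auto
  have em: "e.mean = ?c2" unfolding e.mean_def by (rule eta_ident(2)) auto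
  have et: "tail M (\<lambda>\<omega>. a * real (eta (Suc n) 1 \<omega>)) = tail M (\<lambda>\<omega>. a * real (eta 1 1 \<omega>))"
    by (rule eta_ident(3)) auto
  have eL: "tail M (\<lambda>\<omega>. e.mean * real (Y n \<omega>) + R2 \<omega>) = tail M (\<lambda>\<omega>. H0 \<omega> + a * real (eps (Suc n) \<omega>))"
    unfolding em by (simp add: R2_def H0_def add_ac)
  interpret e: random_sum_rv M "\<lambda>i \<omega>. a * real (eta (Suc n) i \<omega>)" "Y n" R2 \<alpha>
  proof
    show "0 \<le> \<alpha>" using alpha by simp
    show "e.mean > 0" unfolding em by (rule c)
    show "rv_tail \<alpha> (tail M (\<lambda>\<omega>. a * real (eta (Suc n) 1 \<omega>)))" unfolding et by (rule Fs)
    show "rv_tail \<alpha> (tail M (\<lambda>\<omega>. e.mean * real (Y n \<omega>) + R2 \<omega>))" unfolding eL by (rule H1rv)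
    show "tail M (\<lambda>\<omega>. a * real (eta (Suc n) 1 \<omega>)) \<in> O[at_top](tail M (\<lambda>\<omega>. e.mean * real (Y n \<omega>) + R2 \<omega>))"
      unfolding eL et using OL(2) asymp_equiv_imp_bigo[OF asymp_equiv_symI[OF H1]] by (rule landau_o.big_trans)
  qed
  define H2 where "H2 = (\<lambda>\<omega>. (\<Sum>j\<in>{1..Y n \<omega>}. a * real (eta (Suc n) j \<omega>)) + R2 \<omega>)"
  let ?L2 = "\<lambda>x. ?L x + EY n * (a powr \<alpha> * Feta x)"
  have H2: "tail M H2 \<sim>[at_top] ?L2"
  proof -
    have "tail M H2 \<sim>[at_top] (\<lambda>x. tail M (\<lambda>\<omega>. H0 \<omega> + a * real (eps (Suc n) \<omega>)) x + EY n * tail M (\<lambda>\<omega>. a * real (eta 1 1 \<omega>)) x)"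
      using e.tail_random_sum unfolding eL et H2_def .
    also have "\<dots> \<sim>[at_top] ?L2"
      by (intro asymp_equiv_add_nonneg H1 asymp_equiv_mult asymp_equiv_refl Fs Ln) (auto simp: tail_nonneg)
    finally show ?thesis .
  qed
  have L2: "rv_tail \<alpha> ?L2" using rv_tail_add_nonneg[OF L(1) rv_eta, of "EY n * a powr \<alpha>"] by (simp add: mult.assoc)
  have H2m: "H2 \<in> borel_measurable M" unfolding H2_def by measurable
  have H2rv: "rv_tail \<alpha> (tail M H2)" by (rule rv_tail_tail_asymp[OF H2m H2 L2])

  \<comment> \<open>Only \<open>b * Y (n + 1)\<close> is kept apart; the share
    \<open>a * mxi\<close> of its coefficient in \<open>H2\<close> is exactly the mean of a scaled
    xi, so \<open>x.mean * Y (n + 1) + R3\<close> is \<open>H2\<close>.\<close>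
  define R3 where "R3 = (\<lambda>\<omega>. b * real (Y (Suc n) \<omega>) + (\<Sum>j\<in>{1..Y n \<omega>}. a * real (eta (Suc n) j \<omega>)) + a * real (eps (Suc n) \<omega>))"
  interpret x: random_sum M "\<lambda>i \<omega>. a * real (xi (Suc n) i \<omega>)" "Y (Suc n)" R3
    unfolding R3_def using a b by (intro xi_random_sum Y_integrable) auto
  have xm: "x.mean = a * mxi" unfolding x.mean_def by (rule xi_ident(2)) auto
  have xt: "tail M (\<lambda>\<omega>. a * real (xi (Suc n) 1 \<omega>)) = tail M (\<lambda>\<omega>. a * real (xi 1 1 \<omega>))"
    by (rule xi_ident(3)) auto
  have xL: "tail M (\<lambda>\<omega>. x.mean * real (Y (Suc n) \<omega>) + R3 \<omega>) = tail M H2"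
    unfolding xm by (simp add: R3_def H2_def R2_def algebra_simps)
  interpret x: random_sum_rv M "\<lambda>i \<omega>. a * real (xi (Suc n) i \<omega>)" "Y (Suc n)" R3 \<alpha>
  proof
    show "0 \<le> \<alpha>" using alpha by simp
    show "x.mean > 0" unfolding xm using a pos_xi by simp
    show "rv_tail \<alpha> (tail M (\<lambda>\<omega>. a * real (xi (Suc n) 1 \<omega>)))" unfolding xt by (rule Fs)
    show "rv_tail \<alpha> (tail M (\<lambda>\<omega>. x.mean * real (Y (Suc n) \<omega>) + R3 \<omega>))" unfolding xL by (rule H2rv)
    have "?L \<in> O[at_top](?L2)"
    proof (intro landau_o.big_mono always_eventually allI)
      fix x
      have "0 \<le> EY n * (a powr \<alpha> * Feta x)" by (simp add: tail_nonneg)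
      then show "norm (?L x) \<le> norm (?L2 x)" using Ln[of x] by simp
    qed
    from landau_o.big_trans[OF OL(1) this]
    show "tail M (\<lambda>\<omega>. a * real (xi (Suc n) 1 \<omega>)) \<in> O[at_top](tail M (\<lambda>\<omega>. x.mean * real (Y (Suc n) \<omega>) + R3 \<omega>))"
      unfolding xL xt using asymp_equiv_imp_bigo[OF asymp_equiv_symI[OF H2]] by (rule landau_o.big_trans)
  qed
  have eqX: "tail M (\<lambda>\<omega>. a * real (Y (Suc (Suc n)) \<omega>) + b * real (Y (Suc n) \<omega>)) =
     tail M (\<lambda>\<omega>. (\<Sum>i\<in>{1..Y (Suc n) \<omega>}. a * real (xi (Suc n) i \<omega>)) + R3 \<omega>)"
    by (simp add: R3_def algebra_simps sum_distrib_left)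
  have s1: "tail M (\<lambda>\<omega>. (\<Sum>i\<in>{1..Y (Suc n) \<omega>}. a * real (xi (Suc n) i \<omega>)) + R3 \<omega>) \<sim>[at_top]
     (\<lambda>x. tail M H2 x + EY (Suc n) * tail M (\<lambda>\<omega>. a * real (xi 1 1 \<omega>)) x)"
    using x.tail_random_sum unfolding xL xt .
  have s2: "(\<lambda>x. tail M H2 x + EY (Suc n) * tail M (\<lambda>\<omega>. a * real (xi 1 1 \<omega>)) x) \<sim>[at_top]
     (\<lambda>x. ?L2 x + EY (Suc n) * (a powr \<alpha> * Fxi x))"
  proof (rule asymp_equiv_add_nonneg[OF H2 asymp_equiv_mult[OF asymp_equiv_refl Fs(3)]])
    show "0 \<le> ?L2 x" for x using rv_tail_pos[OF L2, of x] by simp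
    show "0 \<le> EY (Suc n) * (a powr \<alpha> * Fxi x)" for x by (simp add: tail_nonneg)
  qed
  have eqL: "(\<lambda>x. ?L2 x + EY (Suc n) * (a powr \<alpha> * Fxi x)) = lim_tail (Suc n) a b"
    by (simp add: fun_eq_iff algebra_simps)
  show ?thesis unfolding eqX using asymp_equiv_trans[OF s1 s2] unfolding eqL .
qed

lemma prob_X0_Xm1:
  "prob {\<omega> \<in> space M. real (X0 \<omega>) > s \<and> real (Xm1 \<omega>) > t} = F0 s * Fm1 t"
proof -
  have "prob {\<omega> \<in> space M. real ((\<lambda>i\<in>{IX0}. V i \<omega>) IX0) > s \<and> real ((\<lambda>i\<in>{IXm1}. V i \<omega>) IXm1) > t} =
    prob {\<omega> \<in> space M. real ((\<lambda>i\<in>{IX0}. V i \<omega>) IX0) > s} * prob {\<omega> \<in> space M. real ((\<lambda>i\<in>{IXm1}. V i \<omega>) IXm1) > t}"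
  proof (rule prob_restrict_indep[OF indep, of "{IX0}" "{IXm1}" "\<lambda>z. real (z IX0) > s" "\<lambda>z. real (z IXm1) > t"])
    have [measurable]: "(\<lambda>z. z i) \<in> measurable (Pi\<^sub>M {i} (\<lambda>_. count_space UNIV)) (count_space UNIV :: nat measure)" for i :: gw_idx
      by (intro measurable_component_singleton) auto
    show "Measurable.pred (Pi\<^sub>M {IX0} (\<lambda>_. count_space UNIV)) (\<lambda>z. real (z IX0) > s)"
      "Measurable.pred (Pi\<^sub>M {IXm1} (\<lambda>_. count_space UNIV)) (\<lambda>z. real (z IXm1) > t)" by measurable
  qed (auto simp: gw_index_def)
  then show ?thesis by (simp add: tail_def gw_family_def)
qed

text \<open>A zero coefficient produces the zero variable, whose tail does not vary regularly, so
  these cases are separate; there \<open>0 powr \<alpha> = 0\<close> removes the term from the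
  limit.\<close>

lemma tail_base:
  assumes "a \<ge> 0" "b \<ge> 0" "a + b > 0"
  shows "tail M (\<lambda>\<omega>. a * real (X0 \<omega>) + b * real (Xm1 \<omega>)) \<sim>[at_top] lim_tail 0 a b"
proof -
  have l0: "lim_tail 0 a b = (\<lambda>x. a powr \<alpha> * F0 x + b powr \<alpha> * Fm1 x)" by (simp add: fun_eq_iff)
  consider "a = 0" "b > 0" | "a > 0" "b = 0" | "a > 0" "b > 0" using assms by force
  then show ?thesis
  proof cases
    case 1
    then show ?thesis using rv_tail_tail_cmult(2)[OF rv_Xm1, of b] unfolding l0 by simp
  next
    case 2
    then show ?thesis using rv_tail_tail_cmult(2)[OF rv_X0, of a] unfolding l0 by simp
  next
    case 3
    note t0 = rv_tail_tail_cmult[OF rv_X0 3(1)] and t1 = rv_tail_tail_cmult[OF rv_Xm1 3(2)]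
    have "tail M (\<lambda>\<omega>. a * real (X0 \<omega>) + b * real (Xm1 \<omega>)) \<sim>[at_top]
      (\<lambda>x. tail M (\<lambda>\<omega>. a * real (X0 \<omega>)) x + tail M (\<lambda>\<omega>. b * real (Xm1 \<omega>)) x)"
    proof (rule tail_add_indep[OF _ _ _ _ t0(1) t1(1)])
      fix x
      have "prob {\<omega> \<in> space M. x < a * real (X0 \<omega>) \<and> x < b * real (Xm1 \<omega>)} =
        prob {\<omega> \<in> space M. real (X0 \<omega>) > 1 / a * x \<and> real (Xm1 \<omega>) > 1 / b * x}"
        using 3 by (simp add: field_simps)
      also have "\<dots> = tail M (\<lambda>\<omega>. a * real (X0 \<omega>)) x * tail M (\<lambda>\<omega>. b * real (Xm1 \<omega>)) x"
        unfolding prob_X0_Xm1 tail_cmult[OF 3(1)] tail_cmult[OF 3(2)] ..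
      finally show "prob {\<omega> \<in> space M. x < a * real (X0 \<omega>) \<and> x < b * real (Xm1 \<omega>)} =
        tail M (\<lambda>\<omega>. a * real (X0 \<omega>)) x * tail M (\<lambda>\<omega>. b * real (Xm1 \<omega>)) x" .
    qed (use 3 in auto)
    also have "\<dots> \<sim>[at_top] (\<lambda>x. a powr \<alpha> * F0 x + b powr \<alpha> * Fm1 x)"
      by (intro asymp_equiv_add_nonneg t0 t1) (auto simp: tail_nonneg)
    finally show ?thesis unfolding l0 .
  qed
qed

theorem tail_linear_combination:
  assumes "a \<ge> 0" "b \<ge> 0" "a + b > 0"
  shows "tail M (\<lambda>\<omega>. a * real (Y (Suc n) \<omega>) + b * real (Y n \<omega>)) \<sim>[at_top] lim_tail n a b"
  using assms
proof (induction n arbitrary: a b)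
  case 0
  then show ?case using tail_base[of a b] by (simp del: lim_tail.simps)
next
  case (Suc n)
  show ?case
  proof (cases "a > 0")
    case True
    then show ?thesis using Suc.prems pos_xi pos_eta
      by (intro tail_step Suc.IH) (auto intro!: add_nonneg_pos)
  next
    case False
    \<comment> \<open>Without the newest generation no random sum is left: the combination is that
      of the previous step with coefficients \<open>(b, 0)\<close>, and \<open>lim_tail\<close>
      agrees.\<close>
    then have ab: "a = 0" "b > 0" using Suc.prems by auto
    have "tail M (\<lambda>\<omega>. b * real (Y (Suc n) \<omega>) + 0 * real (Y n \<omega>)) \<sim>[at_top] lim_tail n b 0"
      using ab by (intro Suc.IH) auto
    moreover have "lim_tail (Suc n) a b = lim_tail n b 0" using ab by (simp add: fun_eq_iff)
    moreover have "(\<lambda>\<omega>. b * real (Y (Suc n) \<omega>) + 0 * real (Y n \<omega>)) = (\<lambda>\<omega>. a * real (Y (Suc (Suc n)) \<omega>) + b * real (Y (Suc n) \<omega>))"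
      using ab by simp
    ultimately show ?thesis by metis
  qed
qed

end

section \<open>The explicit form of the limit\<close>

text \<open>Both \<open>lam_plus\<close> and \<open>lam_minus\<close> solve
  \<open>y * y = p * y + q\<close>, so their powers, and hence the quotient of differences, obey the
  recursion.\<close>

lemma gw_m_rec:
  assumes "p > 0" "q > 0"
  shows "gw_m p q 0 = 1" "gw_m p q (Suc 0) = p"
    and "gw_m p q (Suc (Suc k)) = p * gw_m p q (Suc k) + q * gw_m p q k"
proof -
  let ?a = "lam_plus p q" and ?b = "lam_minus p q"
  define s where "s = sqrt (p\<^sup>2 + 4 * q)"
  have s2: "s * s = p\<^sup>2 + 4 * q" using assms by (simp add: s_def)
  have s0: "s > 0" using assms by (simp add: s_def add_nonneg_pos)
  have la: "?a = (p + s) / 2" "?b = (p - s) / 2" by (simp_all add: lam_plus_def lam_minus_def s_def)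
  have ab: "?a - ?b \<noteq> 0" "?a + ?b = p"
    unfolding la using s0 by (simp_all add: field_simps)
  have sq: "?a * ?a = p * ?a + q" "?b * ?b = p * ?b + q"
    unfolding la using s2 by (simp_all add: field_simps power2_eq_square)
  have m: "gw_m p q k = (?a ^ (k + 1) - ?b ^ (k + 1)) / (?a - ?b)" for k
    using ab by (simp add: gw_m_def)
  show "gw_m p q 0 = 1" by (simp add: gw_m_def)
  have "?a ^ 2 - ?b ^ 2 = p * (?a - ?b)" using sq by (simp add: power2_eq_square algebra_simps)
  then show "gw_m p q (Suc 0) = p" using ab by (simp add: m flip: power2_eq_square)
  have pw: "y ^ (Suc (Suc k) + 1) = p * y ^ (Suc k + 1) + q * y ^ (k + 1)" if "y * y = p * y + q" for y :: real
  proof -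
    have "y ^ (Suc (Suc k) + 1) = (y * y) * y ^ (k + 1)" by simp
    then show ?thesis unfolding that by (simp add: algebra_simps)
  qed
  have "?a ^ (Suc (Suc k) + 1) - ?b ^ (Suc (Suc k) + 1) =
    p * (?a ^ (Suc k + 1) - ?b ^ (Suc k + 1)) + q * (?a ^ (k + 1) - ?b ^ (k + 1))"
    unfolding pw[OF sq(1)] pw[OF sq(2)] by (simp only: right_diff_distrib)
  then show "gw_m p q (Suc (Suc k)) = p * gw_m p q (Suc k) + q * gw_m p q k"
    unfolding m by (simp only: add_divide_distrib times_divide_eq_right)
qed

text \<open>The sequence shifted by one with the convention m_{-1} = 0; truncated subtraction alone
  would give m_0 = 1 at \<open>k = 0\<close>. It lets the coefficient pair start at
  \<open>(1, 0)\<close>.\<close>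

definition gw_m_prev :: "real \<Rightarrow> real \<Rightarrow> nat \<Rightarrow> real" where
  "gw_m_prev p q k = (if k = 0 then 0 else gw_m p q (k - 1))"

lemma gw_m_Suc:
  assumes "p > 0" "q > 0"
  shows "gw_m p q (Suc k) = gw_m p q k * p + q * gw_m_prev p q k"
  using gw_m_rec[OF assms] by (cases k) (auto simp: gw_m_prev_def)

lemma gw_m_nonneg:
  assumes "p > 0" "q > 0"
  shows "0 \<le> gw_m p q k"
  by (induction k rule: induct_nat_012) (use assms gw_m_rec[OF assms] in auto)

lemma inner_sum_transpose:
  fixes P :: "'i \<Rightarrow> real^'n^'n"
  shows "v \<bullet> ((\<Sum>k\<in>S. c k *\<^sub>R transpose (P k)) *v u) = (\<Sum>k\<in>S. c k * ((P k *v v) \<bullet> u))"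
proof (induction S rule: infinite_finite_induct)
  case (insert k S)
  have "v \<bullet> (transpose (P k) *v u) = (P k *v v) \<bullet> u"
    by (metis dot_lmul_matrix transpose_matrix_vector transpose_transpose)
  then show ?case using insert
    by (simp add: matrix_vector_mult_add_rdistrib inner_add_right flip: scaleR_matrix_vector_assoc)
qed auto

lemma inner_vector_2: "(vector [a, b] :: real^2) \<bullet> vector [c, d] = a * c + b * d"
  by (simp add: inner_vec_def sum_2)

lemma gw_M_vector: "gw_M p q *v vector [a, b] = vector [p * a + q * b, a]"
  by (simp add: gw_M_def vec_eq_iff matrix_vector_mult_def sum_2 forall_2)

lemma vector_2_add: "(vector [a, b] :: real^2) + vector [c, d] = vector [a + c, b + d]"
  by (simp add: vec_eq_iff forall_2)

text \<open>Both sides run over \<open>k \<ge> 0\<close> and \<open>i \<ge> 1\<close> with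
  \<open>i + k \<le> n - 1\<close>; the left order comes from the recursion, the right one is that
  of the claimed formula.\<close>

lemma triangle_sum_swap:
  fixes g :: "nat \<Rightarrow> nat \<Rightarrow> real"
  assumes "n \<ge> 1"
  shows "(\<Sum>k=0..n-1. \<Sum>i=1..n-k-1. g k i) = (\<Sum>i=1..n-1. \<Sum>k=0..n-i-1. g k i)"
proof -
  have "(\<Sum>k=0..n-1. \<Sum>i=1..n-k-1. g k i) = (\<Sum>(k,i)\<in>(SIGMA k:{0..n-1}. {1..n-k-1}). g k i)"
    by (rule sum.Sigma) auto
  also have "\<dots> = (\<Sum>(i,k)\<in>(SIGMA i:{1..n-1}. {0..n-i-1}). g k i)"
    by (rule sum.reindex_bij_witness[of _ "\<lambda>(i,k). (k,i)" "\<lambda>(k,i). (i,k)"]) (use assms in auto)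
  also have "\<dots> = (\<Sum>i=1..n-1. \<Sum>k=0..n-i-1. g k i)"
    by (rule sum.Sigma[symmetric]) auto
  finally show ?thesis .
qed

context gw_process
begin

text \<open>Variation of constants for the affine recursion with matrix \<open>gw_M mxi meta\<close>
  and inhomogeneity \<open>(meps, 0)\<close>.\<close>

lemma EY_vector:
  "(vector [EY (Suc j), EY j] :: real^2) = mat_pow (gw_M mxi meta) j *v vector [EY 1, EY 0] +
     (\<Sum>i=1..j. mat_pow (gw_M mxi meta) (j - i) *v vector [meps, 0])"
proof (induction j)
  case (Suc j)
  let ?P = "mat_pow (gw_M mxi meta)" and ?w = "vector [meps, 0] :: real^2"
  have "vector [EY (Suc (Suc j)), EY (Suc j)] = gw_M mxi meta *v vector [EY (Suc j), EY j] + ?w"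
    unfolding gw_M_vector vector_2_add EY_Suc_Suc by simp
  also have "\<dots> = ?P (Suc j) *v vector [EY 1, EY 0] + ((\<Sum>i=1..j. gw_M mxi meta *v (?P (j - i) *v ?w)) + ?w)"
    unfolding Suc by (simp add: matrix_vector_right_distrib linear_sum[OF matrix_vector_mul_linear] matrix_vector_mul_assoc add.assoc)
  also have "(\<Sum>i=1..j. gw_M mxi meta *v (?P (j - i) *v ?w)) = (\<Sum>i=1..j. ?P (Suc j - i) *v ?w)"
    by (intro sum.cong refl) (auto simp: Suc_diff_le matrix_vector_mul_assoc)
  also have "(\<Sum>i=1..j. ?P (Suc j - i) *v ?w) + ?w = (\<Sum>i=1..Suc j. ?P (Suc j - i) *v ?w)"
    by simp
  finally show ?case .
qed (simp add: numeral_2_eq_2)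

end

context gw_process_rv
begin

text \<open>One step of \<open>lim_tail\<close> sends the coefficients
  \<open>(m_j, meta * m_{j-1})\<close> to the same pair at \<open>j + 1\<close>; hence the induction
  leaves \<open>j\<close> arbitrary.\<close>

lemma lim_tail_shift:
  "lim_tail n (gw_m mxi meta j) (meta * gw_m_prev mxi meta j) x =
     gw_m mxi meta (j + n) powr \<alpha> * F0 x + (meta * gw_m_prev mxi meta (j + n)) powr \<alpha> * Fm1 x +
     (\<Sum>k<n. gw_m mxi meta (j + k) powr \<alpha> * (EY (n - k) * Fxi x + EY (n - k - 1) * Feta x))"
proof (induction n arbitrary: j)
  case (Suc n)
  let ?m = "gw_m mxi meta" and ?g = "gw_m_prev mxi meta"
  have eq: "?m j * mxi + meta * ?g j = ?m (Suc j)" "?m j * meta = meta * ?g (Suc j)"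
    using gw_m_Suc[OF pos_xi pos_eta] by (auto simp: gw_m_prev_def)
  have "lim_tail (Suc n) (?m j) (meta * ?g j) x = lim_tail n (?m (Suc j)) (meta * ?g (Suc j)) x +
     ?m j powr \<alpha> * (EY (Suc n) * Fxi x + EY n * Feta x)"
    unfolding lim_tail.simps(2) eq ..
  then show ?case unfolding Suc.IH sum.lessThan_Suc_shift
    by (simp del: sum.lessThan_Suc gw_Y.simps lim_tail.simps One_nat_def)
qed simp

text \<open>Each weight is an inner product of a mean vector with the offspring tails. By
  \<open>EY_vector\<close> the initial means yield the single sum, the immigration terms the double
  sum after exchanging its indices.\<close>

lemma lim_tail_formula:
  assumes n: "n \<ge> 1"
  shows "lim_tail n 1 0 x =
     (vector [EY 1, EY 0] :: real^2) \<bullet>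
        ((\<Sum>k = 0..n-1. gw_m mxi meta k powr \<alpha> *\<^sub>R transpose (mat_pow (gw_M mxi meta) (n - k - 1))) *v vector [Fxi x, Feta x])
     + (vector [meps, 0] :: real^2) \<bullet>
        ((\<Sum>i = 1..n-1. \<Sum>j = 0..n-i-1.
             gw_m mxi meta j powr \<alpha> *\<^sub>R transpose (mat_pow (gw_M mxi meta) (n - i - j - 1))) *v vector [Fxi x, Feta x])
     + gw_m mxi meta n powr \<alpha> * F0 x + gw_m mxi meta (n - 1) powr \<alpha> * meta powr \<alpha> * Fm1 x"
proof -
  let ?m = "gw_m mxi meta" and ?P = "mat_pow (gw_M mxi meta)" and ?u = "vector [Fxi x, Feta x] :: real^2"
    and ?v = "vector [EY 1, EY 0] :: real^2" and ?w = "vector [meps, 0] :: real^2"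
  have "lim_tail n 1 0 x = lim_tail n (?m 0) (meta * gw_m_prev mxi meta 0) x"
    by (simp add: gw_m_rec(1)[OF pos_xi pos_eta] gw_m_prev_def del: One_nat_def)
  also have "\<dots> = ?m n powr \<alpha> * F0 x + (meta * gw_m_prev mxi meta n) powr \<alpha> * Fm1 x +
     (\<Sum>k<n. ?m k powr \<alpha> * (EY (n - k) * Fxi x + EY (n - k - 1) * Feta x))"
    using lim_tail_shift[of n 0 x] by (simp only: add_0)
  also have "(meta * gw_m_prev mxi meta n) powr \<alpha> = ?m (n - 1) powr \<alpha> * meta powr \<alpha>"
    using n pos_eta gw_m_nonneg[OF pos_xi pos_eta] by (simp add: gw_m_prev_def powr_mult mult.commute del: One_nat_def)
  also have "(\<Sum>k<n. ?m k powr \<alpha> * (EY (n - k) * Fxi x + EY (n - k - 1) * Feta x)) =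
     (\<Sum>k=0..n-1. ?m k powr \<alpha> * ((?P (n - k - 1) *v ?v) \<bullet> ?u) +
        (\<Sum>i=1..n-k-1. ?m k powr \<alpha> * ((?P (n - i - k - 1) *v ?w) \<bullet> ?u)))"
  proof (rule sum.cong)
    show "{..<n} = {0..n-1}" using n by auto
    fix k assume "k \<in> {0..n-1}"
    then have nk: "n - k = Suc (n - k - 1)" using n by auto
    have "EY (n - k) * Fxi x + EY (n - k - 1) * Feta x = vector [EY (Suc (n - k - 1)), EY (n - k - 1)] \<bullet> ?u"
      unfolding inner_vector_2 nk[symmetric] ..
    also have "\<dots> = (?P (n - k - 1) *v ?v) \<bullet> ?u + (\<Sum>i=1..n-k-1. (?P (n - k - 1 - i) *v ?w) \<bullet> ?u)"
      unfolding EY_vector by (simp add: inner_add_left inner_sum_left)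
    also have "(\<Sum>i=1..n-k-1. (?P (n - k - 1 - i) *v ?w) \<bullet> ?u) = (\<Sum>i=1..n-k-1. (?P (n - i - k - 1) *v ?w) \<bullet> ?u)"
    proof (rule sum.cong[OF refl])
      fix i
      have "n - k - 1 - i = n - i - k - 1" by simp
      then show "(?P (n - k - 1 - i) *v ?w) \<bullet> ?u = (?P (n - i - k - 1) *v ?w) \<bullet> ?u" by metis
    qed
    finally show "?m k powr \<alpha> * (EY (n - k) * Fxi x + EY (n - k - 1) * Feta x) =
      ?m k powr \<alpha> * ((?P (n - k - 1) *v ?v) \<bullet> ?u) + (\<Sum>i=1..n-k-1. ?m k powr \<alpha> * ((?P (n - i - k - 1) *v ?w) \<bullet> ?u))"
      by (simp add: distrib_left sum_distrib_left)
  qed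
  also have "\<dots> = (\<Sum>k=0..n-1. ?m k powr \<alpha> * ((?P (n - k - 1) *v ?v) \<bullet> ?u)) +
     (\<Sum>i=1..n-1. \<Sum>k=0..n-i-1. ?m k powr \<alpha> * ((?P (n - i - k - 1) *v ?w) \<bullet> ?u))"
    unfolding sum.distrib triangle_sum_swap[OF n] ..
  also have "(\<Sum>k=0..n-1. ?m k powr \<alpha> * ((?P (n - k - 1) *v ?v) \<bullet> ?u)) =
      ?v \<bullet> ((\<Sum>k = 0..n-1. ?m k powr \<alpha> *\<^sub>R transpose (?P (n - k - 1))) *v ?u)"
    by (rule inner_sum_transpose[symmetric])
  also have "(\<Sum>i=1..n-1. \<Sum>k=0..n-i-1. ?m k powr \<alpha> * ((?P (n - i - k - 1) *v ?w) \<bullet> ?u)) =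
      ?w \<bullet> ((\<Sum>i = 1..n-1. \<Sum>j = 0..n-i-1. ?m j powr \<alpha> *\<^sub>R transpose (?P (n - i - j - 1))) *v ?u)"
  proof -
    \<comment> \<open>Flattened to one sum over index pairs, so that
      \<open>inner_sum_transpose\<close> moves all transposes at once.\<close>
    have "(\<Sum>i=1..n-1. \<Sum>k=0..n-i-1. ?m k powr \<alpha> * ((?P (n - i - k - 1) *v ?w) \<bullet> ?u)) =
       (\<Sum>p\<in>(SIGMA i:{1..n-1}. {0..n-i-1}). ?m (snd p) powr \<alpha> * ((?P (n - fst p - snd p - 1) *v ?w) \<bullet> ?u))"
      by (subst sum.Sigma) (auto intro!: sum.cong)
    also have "\<dots> = ?w \<bullet> ((\<Sum>p\<in>(SIGMA i:{1..n-1}. {0..n-i-1}). ?m (snd p) powr \<alpha> *\<^sub>R transpose (?P (n - fst p - snd p - 1))) *v ?u)"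
      by (rule inner_sum_transpose[symmetric])
    also have "(\<Sum>p\<in>(SIGMA i:{1..n-1}. {0..n-i-1}). ?m (snd p) powr \<alpha> *\<^sub>R transpose (?P (n - fst p - snd p - 1))) =
       (\<Sum>i = 1..n-1. \<Sum>j = 0..n-i-1. ?m j powr \<alpha> *\<^sub>R transpose (?P (n - i - j - 1)))"
      by (subst sum.Sigma) (auto intro!: sum.cong)
    finally show ?thesis .
  qed
  finally show ?thesis by (simp only: ac_simps)
qed

lemma tail_Y:
  shows "tail M (\<lambda>\<omega>. real (Y (Suc n) \<omega>)) \<sim>[at_top] lim_tail n 1 0"
    and "rv_tail \<alpha> (tail M (\<lambda>\<omega>. real (Y (Suc n) \<omega>)))"
proof -
  show t: "tail M (\<lambda>\<omega>. real (Y (Suc n) \<omega>)) \<sim>[at_top] lim_tail n 1 0"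
    using tail_linear_combination[of 1 0 n] by simp
  have "rv_tail \<alpha> (lim_tail n 1 0)" using lim_tail_props[of 1 0 n] by simp
  then show "rv_tail \<alpha> (tail M (\<lambda>\<omega>. real (Y (Suc n) \<omega>)))"
    using t by (intro rv_tail_tail_asymp) measurable
qed

end

theorem theorem3p5:
  fixes M :: "'a measure"
    and X0 Xm1 :: "'a \<Rightarrow> nat"
    and xi eta :: "nat \<Rightarrow> nat \<Rightarrow> 'a \<Rightarrow> nat"
    and eps :: "nat \<Rightarrow> 'a \<Rightarrow> nat"
    and \<alpha> r :: real
  assumes "prob_space M"
    and indep: "prob_space.indep_vars M (\<lambda>_. count_space UNIV)
          (\<lambda>k. case k of IX0 \<Rightarrow> X0 | IXm1 \<Rightarrow> Xm1 | IXi n i \<Rightarrow> xi n i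
                       | IEta n j \<Rightarrow> eta n j | IEps n \<Rightarrow> eps n)
          ({IX0, IXm1} \<union> {IXi n i |n i. n \<ge> 1 \<and> i \<ge> 1}
             \<union> {IEta n j |n j. n \<ge> 1 \<and> j \<ge> 1} \<union> {IEps n |n. n \<ge> 1})"
    and xi_id: "\<And>n i. n \<ge> 1 \<Longrightarrow> i \<ge> 1 \<Longrightarrow>
          distr M (count_space UNIV) (xi n i) = distr M (count_space UNIV) (xi 1 1)"
    and eta_id: "\<And>n j. n \<ge> 1 \<Longrightarrow> j \<ge> 1 \<Longrightarrow>
          distr M (count_space UNIV) (eta n j) = distr M (count_space UNIV) (eta 1 1)"
    and eps_id: "\<And>n. n \<ge> 1 \<Longrightarrow>
          distr M (count_space UNIV) (eps n) = distr M (count_space UNIV) (eps 1)"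
    and alpha: "\<alpha> \<ge> 1"
    and rv_X0: "regularly_varying M (\<lambda>\<omega>. real (X0 \<omega>)) \<alpha>"
    and rv_Xm1: "regularly_varying M (\<lambda>\<omega>. real (Xm1 \<omega>)) \<alpha>"
    and rv_xi: "regularly_varying M (\<lambda>\<omega>. real (xi 1 1 \<omega>)) \<alpha>"
    and rv_eta: "regularly_varying M (\<lambda>\<omega>. real (eta 1 1 \<omega>)) \<alpha>"
    and int_X0: "integrable M (\<lambda>\<omega>. real (X0 \<omega>))"
    and pos_X0: "prob_space.expectation M (\<lambda>\<omega>. real (X0 \<omega>)) > 0"
    and int_Xm1: "integrable M (\<lambda>\<omega>. real (Xm1 \<omega>))"
    and pos_Xm1: "prob_space.expectation M (\<lambda>\<omega>. real (Xm1 \<omega>)) > 0"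
    and int_xi: "integrable M (\<lambda>\<omega>. real (xi 1 1 \<omega>))"
    and pos_xi: "prob_space.expectation M (\<lambda>\<omega>. real (xi 1 1 \<omega>)) > 0"
    and int_eta: "integrable M (\<lambda>\<omega>. real (eta 1 1 \<omega>))"
    and pos_eta: "prob_space.expectation M (\<lambda>\<omega>. real (eta 1 1 \<omega>)) > 0"
    and O1: "tail M (\<lambda>\<omega>. real (xi 1 1 \<omega>)) \<in> O[at_top](tail M (\<lambda>\<omega>. real (X0 \<omega>)))"
    and O2: "tail M (\<lambda>\<omega>. real (xi 1 1 \<omega>)) \<in> O[at_top](tail M (\<lambda>\<omega>. real (Xm1 \<omega>)))"
    and O3: "tail M (\<lambda>\<omega>. real (eta 1 1 \<omega>)) \<in> O[at_top](tail M (\<lambda>\<omega>. real (X0 \<omega>)))"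
    and O4: "tail M (\<lambda>\<omega>. real (eta 1 1 \<omega>)) \<in> O[at_top](tail M (\<lambda>\<omega>. real (Xm1 \<omega>)))"
    and Theta: "tail M (\<lambda>\<omega>. real (xi 1 1 \<omega>)) \<in> \<Theta>[at_top](tail M (\<lambda>\<omega>. real (eta 1 1 \<omega>)))"
    and r: "r > \<alpha>"
    and eps_mom: "integrable M (\<lambda>\<omega>. real (eps 1 \<omega>) powr r)"
    and n: "n \<ge> 1"
  shows "(let mxi = prob_space.expectation M (\<lambda>\<omega>. real (xi 1 1 \<omega>));
              meta = prob_space.expectation M (\<lambda>\<omega>. real (eta 1 1 \<omega>));
              meps = prob_space.expectation M (\<lambda>\<omega>. real (eps 1 \<omega>));
              EX0 = prob_space.expectation M (\<lambda>\<omega>. real (X0 \<omega>));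
              EXm1 = prob_space.expectation M (\<lambda>\<omega>. real (Xm1 \<omega>));
              Mm = gw_M mxi meta;
              m = gw_m mxi meta;
              u = (\<lambda>x. vector [tail M (\<lambda>\<omega>. real (xi 1 1 \<omega>)) x,
                               tail M (\<lambda>\<omega>. real (eta 1 1 \<omega>)) x] :: real^2)
          in (\<lambda>x. tail M (\<lambda>\<omega>. real (gw_X X0 Xm1 xi eta eps n \<omega>)) x)
             \<sim>[at_top]
             (\<lambda>x. (vector [EX0, EXm1] :: real^2) \<bullet>
                     ((\<Sum>k = 0..n-1. m k powr \<alpha> *\<^sub>R transpose (mat_pow Mm (n - k - 1))) *v u x)
                 + (vector [meps, 0] :: real^2) \<bullet>
                     ((\<Sum>i = 1..n-1. \<Sum>j = 0..n-i-1.
                          m j powr \<alpha> *\<^sub>R transpose (mat_pow Mm (n - i - j - 1))) *v u x)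
                 + m n powr \<alpha> * tail M (\<lambda>\<omega>. real (X0 \<omega>)) x
                 + m (n - 1) powr \<alpha> * meta powr \<alpha> * tail M (\<lambda>\<omega>. real (Xm1 \<omega>)) x))
       \<and> regularly_varying M (\<lambda>\<omega>. real (gw_X X0 Xm1 xi eta eps n \<omega>)) \<alpha>"
proof -
  interpret prob_space M by (rule \<open>prob_space M\<close>)
  have ind: "indep_vars (\<lambda>_. count_space UNIV) (gw_family X0 Xm1 xi eta eps) gw_index"
    using indep unfolding gw_family_def gw_index_def .
  then have Vm: "gw_family X0 Xm1 xi eta eps k \<in> measurable M (count_space UNIV)" if "k \<in> gw_index" for k
    using that by (auto simp: indep_vars_def2)
  have ms [measurable]: "X0 \<in> measurable M (count_space UNIV)" "Xm1 \<in> measurable M (count_space UNIV)"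
    "xi 1 1 \<in> measurable M (count_space UNIV)" "eta 1 1 \<in> measurable M (count_space UNIV)"
    "eps 1 \<in> measurable M (count_space UNIV)"
    using Vm[of IX0] Vm[of IXm1] Vm[of "IXi 1 1"] Vm[of "IEta 1 1"] Vm[of "IEps 1"]
    by (auto simp: gw_index_def gw_family_def)
  have rvs: "regularly_varying M (\<lambda>\<omega>. real (W \<omega>)) \<alpha> \<longleftrightarrow> rv_tail \<alpha> (tail M (\<lambda>\<omega>. real (W \<omega>)))"
    if [measurable]: "W \<in> measurable M (count_space UNIV)" for W :: "'a \<Rightarrow> nat"
    using alpha by (intro regularly_varying_iff_rv_tail) auto
  \<comment> \<open>Since \<open>r > 1\<close>, every natural number \<open>k\<close> satisfies
    \<open>k \<le> 1 + k powr r\<close>, so the higher moment yields the mean.\<close>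
  have int_eps: "integrable M (\<lambda>\<omega>. real (eps 1 \<omega>))"
  proof (rule Bochner_Integration.integrable_bound)
    show "integrable M (\<lambda>\<omega>. 1 + real (eps 1 \<omega>) powr r)" using eps_mom by auto
    have "real k \<le> 1 + real k powr r" for k
    proof (cases "k = 0")
      case False
      then have "real k powr 1 \<le> real k powr r" using alpha r by (intro powr_mono) auto
      then show ?thesis using False by simp
    qed simp
    then show "AE \<omega> in M. norm (real (eps 1 \<omega>)) \<le> norm (1 + real (eps 1 \<omega>) powr r)" by simp
  qed measurable
  have rv_tails: "rv_tail \<alpha> (tail M (\<lambda>\<omega>. real (X0 \<omega>)))" "rv_tail \<alpha> (tail M (\<lambda>\<omega>. real (Xm1 \<omega>)))"
    "rv_tail \<alpha> (tail M (\<lambda>\<omega>. real (xi 1 1 \<omega>)))" "rv_tail \<alpha> (tail M (\<lambda>\<omega>. real (eta 1 1 \<omega>)))"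
    using rv_X0 rv_Xm1 rv_xi rv_eta rvs[OF ms(1)] rvs[OF ms(2)] rvs[OF ms(3)] rvs[OF ms(4)] by blast+
  interpret gw_process_rv M X0 Xm1 xi eta eps \<alpha> r
    by unfold_locales fact+
  show ?thesis
    unfolding Let_def gw_X_def
  proof
    \<comment> \<open>The index shift of \<open>gw_Y\<close> turns the moments at 1 and 0 into those
      of \<open>X0\<close> and \<open>Xm1\<close>.\<close>
    have eqX: "real (gw_Y X0 Xm1 xi eta eps 1 \<omega>) = real (X0 \<omega>)" "real (gw_Y X0 Xm1 xi eta eps 0 \<omega>) = real (Xm1 \<omega>)" for \<omega>
      by auto
    show "regularly_varying M (\<lambda>\<omega>. real (gw_Y X0 Xm1 xi eta eps (Suc n) \<omega>)) \<alpha>"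
      using tail_Y(2) by (subst rvs) auto
    show "tail M (\<lambda>\<omega>. real (gw_Y X0 Xm1 xi eta eps (Suc n) \<omega>)) \<sim>[at_top]
      (\<lambda>x. (vector [expectation (\<lambda>\<omega>. real (X0 \<omega>)), expectation (\<lambda>\<omega>. real (Xm1 \<omega>))] :: real^2) \<bullet>
          ((\<Sum>k = 0..n-1. gw_m mxi meta k powr \<alpha> *\<^sub>R transpose (mat_pow (gw_M mxi meta) (n - k - 1))) *v vector [Fxi x, Feta x])
        + (vector [meps, 0] :: real^2) \<bullet>
          ((\<Sum>i = 1..n-1. \<Sum>j = 0..n-i-1.
               gw_m mxi meta j powr \<alpha> *\<^sub>R transpose (mat_pow (gw_M mxi meta) (n - i - j - 1))) *v vector [Fxi x, Feta x])
        + gw_m mxi meta n powr \<alpha> * F0 x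
        + gw_m mxi meta (n - 1) powr \<alpha> * meta powr \<alpha> * Fm1 x)"
      using tail_Y(1)[of n] unfolding lim_tail_formula[OF n, unfolded eqX, abs_def] .
  qed
qed

end
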